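(* Let $X$ be a biquasile, $A$ an abelian group and $\phi:X^3\to A$ a biquasile Boltzmann weight. Let $D$ be the dual graph diagram of an oriented link diagram and let $f$ be an $X$-coloring of $D$. Let $D'$ be obtained from $D$ by a dual graph Reidemeister move supported in a disc $U$, and let $f'$ be the corresponding $X$-coloring of $D'$, i.e. the $X$-coloring of $D'$ which agrees with $f$ outside $U$. Then the sum of the $\phi$ values over all edge crossings is unchanged: $BW(f)=BW(f')$ in $A$.
   Context: Biquasile: a set $X$ with two quasigroup operations $\ast,\cdot:X\times X\to X$ (for each $y\in X$ all the maps $x\mapsto y\ast x$, $x\mapsto x\ast y$, $x\mapsto y\cdot x$, $x\mapsto x\cdot y$ are bijections of $X$), with divisions $\backslash^{\ast},/^{\ast},\backslash,/$ determined by $y\backslash^{\ast}(y\ast x)=x=(x\ast y)/^{\ast}y$ and $y\backslash(y\cdot x)=x=(x\cdot y)/y$ (so $y\backslash^{\ast}x$ is the unique $z$ with $y\ast z=x$, $x/y$ is the unique $z$ with $z\cdot y=x$, etc.), such that for all $a,b,x,y\in X$: (i) $a\ast(x\cdot[y\ast(a\cdot b)])=(a\ast[x\cdot y])\ast(x\cdot[y\ast([a\ast(x\cdot y)]\cdot b)])$, (ii) $y\ast([a\ast(x\cdot y)]\cdot b)=(y\ast[a\cdot b])\ast([a\ast(x\cdot[y\ast(a\cdot b)])]\cdot b)$. Biquasile Boltzmann weight with values in an abelian group $A$: a function $\phi:X^3\to A$ such that for all $x,y,a,b\in X$: (i) $\phi(x,a,a\backslash(x\backslash^{\ast}x))=\phi(x,(x\backslash^{\ast}x)/b,b)=0$,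 and (ii) $\phi(x,a,b)+\phi(b,x\ast(a\cdot b),y)+\phi(x\ast(a\cdot b),a,b\ast([x\ast(a\cdot b)]\cdot y))=\phi(b,x,y)+\phi(x,a,b\ast(x\cdot y))+\phi(b\ast(x\cdot y),x\ast(a\cdot[b\ast(x\cdot y)]),y)$. Dual graph diagram: for an oriented link diagram in the plane, its dual graph diagram has one vertex in each region (component of the complement of the underlying immersed curves) and, for each crossing, two mutually crossing edges joining the two pairs of opposite regions at that crossing, decorated so as to record the strand orientations and the sign of the crossing. Thus edge crossings of the dual graph diagram correspond to crossings of the link diagram and vertices to regions. Dual graph Reidemeister moves are the moves induced on dual graph diagrams by the oriented Reidemeister moves I, II, III (with all orientations) on the link diagram, each supported in a disc $U$. Regions at a crossing: draw the crossing with both strands oriented upward. The "in" region is the bottom one, the "out" region is the top one, and the "left" and "right" regions are the remaining two. $X$-coloring: an assignment of an element of $X$ to each vertex (region) such that, at every crossing with region labels in, out, left, right: if the crossing is positive, $\mathrm{out}=\mathrm{in}\ast(\mathrm{left}\cdot\mathrm{right})$; if the crossing is negative, $\mathrm{in}=\mathrm{out}\ast(\mathrm{left}\cdot\mathrm{right})$. For any $X$-coloring before a Reidemeister move there is a unique $X$-coloring after the move which agrees with it outside the disc $U$ (each point off the diagram and outside $U$ lies in regions of the same color before and after). Boltzmann sum: for an $X$-coloring $f$, $BW(f)\in A$ is the sum over all crossings of $\phi(\mathrm{in},\mathrm{left},\mathrm{right})$ at positive crossings and $-\phi(\mathrm{out},\mathrm{left},\mathrm{right})$ at negative crossings (an empty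 sum being $0$). *)

theory Defs
  imports "HOL-Analysis.Analysis"
begin

section \<open>Biquasiles and Boltzmann weights\<close>

definition ldiv :: "('x \<Rightarrow> 'x \<Rightarrow> 'x) \<Rightarrow> 'x \<Rightarrow> 'x \<Rightarrow> 'x" where
  "ldiv f y x = (THE z. f y z = x)"

definition rdiv :: "('x \<Rightarrow> 'x \<Rightarrow> 'x) \<Rightarrow> 'x \<Rightarrow> 'x \<Rightarrow> 'x" where
  "rdiv f x y = (THE z. f z y = x)"

locale quasigroup =
  fixes f :: "'x \<Rightarrow> 'x \<Rightarrow> 'x"
  assumes bij_left: "bij (\<lambda>x. f y x)"
    and bij_right: "bij (\<lambda>x. f x y)"

locale biquasile =
  star: quasigroup star + dot: quasigroup dot
  for star :: "'x \<Rightarrow> 'x \<Rightarrow> 'x"  (infixl \<open>\<star>\<close> 70)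
    and dot :: "'x \<Rightarrow> 'x \<Rightarrow> 'x"  (infixl \<open>\<odot>\<close> 70) +
  assumes exchange1:
      "a \<star> (x \<odot> (y \<star> (a \<odot> b))) = (a \<star> (x \<odot> y)) \<star> (x \<odot> (y \<star> ((a \<star> (x \<odot> y)) \<odot> b)))"
    and exchange2:
      "y \<star> ((a \<star> (x \<odot> y)) \<odot> b) = (y \<star> (a \<odot> b)) \<star> ((a \<star> (x \<odot> (y \<star> (a \<odot> b)))) \<odot> b)"

locale boltzmann_weight =
  biquasile star dot
  for star :: "'x \<Rightarrow> 'x \<Rightarrow> 'x"  (infixl \<open>\<star>\<close> 70)
    and dot :: "'x \<Rightarrow> 'x \<Rightarrow> 'x"  (infixl \<open>\<odot>\<close> 70) +
  fixes \<phi> :: "'x \<Rightarrow> 'x \<Rightarrow> 'x \<Rightarrow> 'a::ab_group_add"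
  assumes weight_left: "\<phi> x a (ldiv (\<odot>) a (ldiv (\<star>) x x)) = 0"
    and weight_right: "\<phi> x (rdiv (\<odot>) (ldiv (\<star>) x x) b) b = 0"
    and weight_cocycle:
      "\<phi> x a b + \<phi> b (x \<star> (a \<odot> b)) y
         + \<phi> (x \<star> (a \<odot> b)) a (b \<star> ((x \<star> (a \<odot> b)) \<odot> y))
       = \<phi> b x y + \<phi> x a (b \<star> (x \<odot> y))
         + \<phi> (b \<star> (x \<odot> y)) (x \<star> (a \<odot> (b \<star> (x \<odot> y)))) y"


section \<open>Oriented link diagrams in the plane\<close>

text \<open>
  A finite family of parametrized oriented plane curves. The plane is the type of complex numbers.
  Heights serve only to say which of two strands is the upper one where they meet.
\<close>

record strands =
  num :: nat
  params :: "real set"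
  curve :: "nat \<Rightarrow> real \<Rightarrow> complex"
  height :: "nat \<Rightarrow> real \<Rightarrow> real"

definition places :: "strands \<Rightarrow> (nat \<times> real) set" where
  "places S = {..<num S} \<times> params S"

definition underlying :: "strands \<Rightarrow> complex set" where
  "underlying S = {curve S i t | i t. (i, t) \<in> places S}"

definition tangent :: "strands \<Rightarrow> nat \<Rightarrow> real \<Rightarrow> complex" where
  "tangent S i t = sgn (vector_derivative (curve S i) (at t))"

text \<open>
  The underlying oriented curves, and the crossings \<open>(z, u, v)\<close>: position, unit tangent of the
  upper strand, unit tangent of the lower strand. Neither depends on the parametrization.
\<close>

definition oriented_trace :: "strands \<Rightarrow> (complex \<times> complex) set" where
  "oriented_trace S = {(curve S i t, tangent S i t) | i t. (i, t) \<in> places S}"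

type_synonym crossing = "complex \<times> complex \<times> complex"

definition crossings :: "strands \<Rightarrow> crossing set" where
  "crossings S = {(curve S i s, tangent S i s, tangent S j t) | i s j t.
     (i, s) \<in> places S \<and> (j, t) \<in> places S \<and> (i, s) \<noteq> (j, t) \<and>
     curve S i s = curve S j t \<and> height S i s > height S j t}"

definition det2 :: "complex \<Rightarrow> complex \<Rightarrow> real" where
  "det2 u v = Re u * Im v - Im u * Re v"

text \<open>
  Closed curves are 1-periodic maps on the real line, each point being visited once for a parameter
  in \<open>[0,1)\<close>: \<open>C\<^sup>1\<close> immersions, with finitely many multiple points, all of them
  transverse double points with upper and lower strand distinguished.
\<close>

definition oriented_link_diagram :: "strands \<Rightarrow> bool" where
  "oriented_link_diagram L \<longleftrightarrow>
     params L = {0..<1} \<and>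
     (\<forall>i<num L. (\<forall>t. curve L i (t + 1) = curve L i t) \<and>
                curve L i C1_differentiable_on UNIV \<and>
                (\<forall>t. vector_derivative (curve L i) (at t) \<noteq> 0)) \<and>
     finite (crossings L) \<and>
     (\<forall>z. \<nexists>p q r. {p, q, r} \<subseteq> places L \<and> p \<noteq> q \<and> q \<noteq> r \<and> p \<noteq> r \<and>
          case_prod (curve L) p = z \<and> case_prod (curve L) q = z \<and> case_prod (curve L) r = z) \<and>
     (\<forall>i s j t. (i, s) \<in> places L \<longrightarrow> (j, t) \<in> places L \<longrightarrow> (i, s) \<noteq> (j, t) \<longrightarrow>
          curve L i s = curve L j t \<longrightarrow>
          height L i s \<noteq> height L j t \<and> det2 (tangent L i s) (tangent L j t) \<noteq> 0)"

definition regions :: "strands \<Rightarrow> complex set set" where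
  "regions L = components (- underlying L)"

text \<open>The region met first when leaving the crossing point \<open>z\<close> in direction \<open>w\<close>.\<close>

definition region_towards :: "strands \<Rightarrow> complex \<Rightarrow> complex \<Rightarrow> complex set" where
  "region_towards L z w =
     (THE R. R \<in> regions L \<and> (\<forall>\<^sub>F t in at_right (0::real). z + of_real t * w \<in> R))"


section \<open>Dual graph diagrams, colorings, Boltzmann sums\<close>

text \<open>
  At an edge crossing \<open>c\<close> the two edges join \<open>v_in c\<close> to \<open>v_out c\<close> and \<open>v_left c\<close> to \<open>v_right c\<close>.
\<close>

record ('c, 'v) dual_graph_diagram =
  verts :: "'v set"
  edge_crossings :: "'c set"
  v_in :: "'c \<Rightarrow> 'v"
  v_out :: "'c \<Rightarrow> 'v"
  v_left :: "'c \<Rightarrow> 'v"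
  v_right :: "'c \<Rightarrow> 'v"
  positive :: "'c \<Rightarrow> bool"

text \<open>
  With unit tangents \<open>u\<close>, \<open>v\<close>, the sum \<open>u + v\<close> points into the region between the two outgoing
  strands, which is the upper one once both strands point upward; a quarter turn counterclockwise
  leads from there to the left region. The crossing is positive if the upper strand then runs from
  bottom left to top right.
\<close>

definition dual_graph ::
    "strands \<Rightarrow> (crossing, complex set) dual_graph_diagram" where
  "dual_graph L =
     \<lparr> verts = regions L,
       edge_crossings = crossings L,
       v_in = (\<lambda>(z, u, v). region_towards L z (- (u + v))),
       v_out = (\<lambda>(z, u, v). region_towards L z (u + v)),
       v_left = (\<lambda>(z, u, v). region_towards L z (\<i> * (u + v))),
       v_right = (\<lambda>(z, u, v). region_towards L z (- \<i> * (u + v))),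
       positive = (\<lambda>(z, u, v). det2 u v > 0) \<rparr>"

definition coloring ::
    "('x \<Rightarrow> 'x \<Rightarrow> 'x) \<Rightarrow> ('x \<Rightarrow> 'x \<Rightarrow> 'x) \<Rightarrow> ('c, 'v) dual_graph_diagram \<Rightarrow> ('v \<Rightarrow> 'x) \<Rightarrow> bool" where
  "coloring star dot D f \<longleftrightarrow>
     (\<forall>c\<in>edge_crossings D.
        if positive D c
        then f (v_out D c) = star (f (v_in D c)) (dot (f (v_left D c)) (f (v_right D c)))
        else f (v_in D c) = star (f (v_out D c)) (dot (f (v_left D c)) (f (v_right D c))))"

definition BW ::
    "('x \<Rightarrow> 'x \<Rightarrow> 'x \<Rightarrow> 'a::ab_group_add) \<Rightarrow> ('c, 'v) dual_graph_diagram \<Rightarrow> ('v \<Rightarrow> 'x) \<Rightarrow> 'a" where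
  "BW \<phi> D f =
     (\<Sum>c\<in>edge_crossings D.
        if positive D c
        then \<phi> (f (v_in D c)) (f (v_left D c)) (f (v_right D c))
        else - \<phi> (f (v_out D c)) (f (v_left D c)) (f (v_right D c)))"


section \<open>Reidemeister moves\<close>

text \<open>
  The standard pictures are drawn in the square \<open>[-1,1] \<times> [-1,1]\<close>. Each strand is
  parametrized by \<open>[-1,1]\<close> and ends on the boundary; its traversal is reversed for
  \<open>\<epsilon> = -1\<close>. Letting orientations and heights vary gives all oriented versions of each move.
\<close>

definition sq :: "complex set" where
  "sq = {z. \<bar>Re z\<bar> < 1 \<and> \<bar>Im z\<bar> < 1}"

definition csq :: "complex set" where
  "csq = {z. \<bar>Re z\<bar> \<le> 1 \<and> \<bar>Im z\<bar> \<le> 1}"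

definition picture ::
    "(real \<Rightarrow> complex) list \<Rightarrow> (nat \<Rightarrow> real) \<Rightarrow> (nat \<Rightarrow> real \<Rightarrow> real) \<Rightarrow> strands" where
  "picture arcs \<epsilon> ht =
     \<lparr> num = length arcs, params = {-1<..<1},
       curve = (\<lambda>k s. (arcs ! k) (\<epsilon> k * s)), height = ht \<rparr>"

definition endpoints :: "strands \<Rightarrow> complex set" where
  "endpoints T = {curve T k s | k s. k < num T \<and> s \<in> {-1, 1}}"

text \<open>A nodal cubic, crossing itself at the origin for \<open>s = 1/2\<close> and \<open>s = -1/2\<close>.\<close>

definition kink :: "real \<Rightarrow> complex" where
  "kink s = Complex (s\<^sup>2 - 1/4) ((4 * s^3 - s) / 3)"

text \<open>
  The second move replaces two parabolic arcs bounding a bigon by parallel lines. The third one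
  pushes the middle arc across the crossing of two straight lines; the arc meets each of the lines
  once.
\<close>

inductive standard_move :: "strands \<Rightarrow> strands \<Rightarrow> bool" where
  R1: "standard_move (picture [kink] \<epsilon> (\<lambda>k s. \<sigma> * s))
                     (picture [\<lambda>s. Complex (3/4) s] \<epsilon> (\<lambda>k s. \<sigma> * s))"
    if "\<epsilon> 0 \<in> {1, -1}" "\<sigma> \<in> {1, -1}"
| R2: "standard_move
         (picture [\<lambda>s. Complex (1/4 - s\<^sup>2 / 2) s, \<lambda>s. Complex (s\<^sup>2 / 2 - 1/4) s] \<epsilon> (\<lambda>k s. \<eta> k))
         (picture [\<lambda>s. Complex (- 1/4) s, \<lambda>s. Complex (1/4) s] \<epsilon> (\<lambda>k s. \<eta> k))"
    if "\<forall>k<2. \<epsilon> k \<in> {1, -1}" "inj_on \<eta> {..<2}"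
| R3: "standard_move
         (picture [\<lambda>s. Complex (s/2) s, \<lambda>s. Complex ((1 - s\<^sup>2) / 4) s, \<lambda>s. Complex (- s/2) s]
            \<epsilon> (\<lambda>k s. \<eta> k))
         (picture [\<lambda>s. Complex (s/2) s, \<lambda>s. Complex ((s\<^sup>2 - 1) / 4) s, \<lambda>s. Complex (- s/2) s]
            \<epsilon> (\<lambda>k s. \<eta> k))"
    if "\<forall>k<3. \<epsilon> k \<in> {1, -1}" "inj_on \<eta> {..<3}"

text \<open>
  Homeomorphisms of the closed square onto a closed disc, restricting to orientation-preserving
  \<open>C\<^sup>1\<close> diffeomorphisms of the interiors. Smoothness on the boundary is not required, so
  the corners of the square play no role.
\<close>

definition chart :: "(complex \<Rightarrow> complex) \<Rightarrow> bool" where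
  "chart h \<longleftrightarrow>
     continuous_on csq h \<and> inj_on h csq \<and>
     (\<exists>h' :: complex \<Rightarrow> complex \<Rightarrow>\<^sub>L complex. continuous_on sq h' \<and>
        (\<forall>z\<in>sq. (h has_derivative blinfun_apply (h' z)) (at z) \<and>
                 det2 (blinfun_apply (h' z) 1) (blinfun_apply (h' z) \<i>) > 0))"

text \<open>Inside the open disc \<open>U\<close>, the diagram \<open>L\<close> is the image of the picture \<open>T\<close> under \<open>h\<close>.\<close>

definition looks_like :: "strands \<Rightarrow> (complex \<Rightarrow> complex) \<Rightarrow> complex set \<Rightarrow> strands \<Rightarrow> bool" where
  "looks_like L h U T \<longleftrightarrow>
     chart h \<and> h ` sq = U \<and>
     (let hT = T\<lparr>curve := (\<lambda>k s. h (curve T k s))\<rparr> in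
        {p \<in> oriented_trace L. fst p \<in> U} = oriented_trace hT \<and>
        {c \<in> crossings L. fst c \<in> U} = crossings hT) \<and>
     underlying L \<inter> h ` (csq - sq) = h ` endpoints T \<and>
     (\<forall>c\<in>crossings L. fst c \<notin> h ` (csq - sq))"

definition same_outside :: "complex set \<Rightarrow> strands \<Rightarrow> strands \<Rightarrow> bool" where
  "same_outside U L L' \<longleftrightarrow>
     {p \<in> oriented_trace L. fst p \<notin> U} = {p \<in> oriented_trace L'. fst p \<notin> U} \<and>
     {c \<in> crossings L. fst c \<notin> U} = {c \<in> crossings L'. fst c \<notin> U}"

text \<open>
  The two charts agree on the boundary only, so that each of the two pictures may be deformed
  inside the disc.
\<close>

definition reidemeister_move :: "complex set \<Rightarrow> strands \<Rightarrow> strands \<Rightarrow> bool" where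
  "reidemeister_move U L L' \<longleftrightarrow>
     oriented_link_diagram L \<and> oriented_link_diagram L' \<and> same_outside U L L' \<and>
     (\<exists>T T' h h'. (standard_move T T' \<or> standard_move T' T) \<and>
        looks_like L h U T \<and> looks_like L' h' U T' \<and> (\<forall>z\<in>csq - sq. h z = h' z))"

definition dual_reidemeister_move ::
    "complex set \<Rightarrow> (crossing, complex set) dual_graph_diagram \<Rightarrow>
     (crossing, complex set) dual_graph_diagram \<Rightarrow> bool" where
  "dual_reidemeister_move U D D' \<longleftrightarrow>
     (\<exists>L L'. reidemeister_move U L L' \<and> D = dual_graph L \<and> D' = dual_graph L')"

text \<open>The vertices are the regions, as sets of points.\<close>

definition agree_outside ::
    "complex set \<Rightarrow> (crossing, complex set) dual_graph_diagram \<Rightarrow> (complex set \<Rightarrow> 'x) \<Rightarrow>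
     (crossing, complex set) dual_graph_diagram \<Rightarrow> (complex set \<Rightarrow> 'x) \<Rightarrow> bool" where
  "agree_outside U D f D' f' \<longleftrightarrow>
     (\<forall>z R R'. z \<notin> U \<longrightarrow> R \<in> verts D \<longrightarrow> R' \<in> verts D' \<longrightarrow> z \<in> R \<longrightarrow> z \<in> R' \<longrightarrow> f R = f' R')"

end

theory Submission
  imports Defs
begin

text \<open>
  The crossings outside the disc are common to both diagrams and have the same colors around them
  (\<open>outside_weights_agree\<close>), so only the crossings inside the disc matter.
  
  The proof rests on a description of the coloring rule that does not see signs. A region at a crossing is
  determined by the side of the upper strand and the side of the lower strand on which it lies. Writing
  \<open>c(l,m)\<close> for its color, the condition at positive and at negative crossings is the same equation
  \<open>c(L,R) = c(R,L) \<star> (c(L,L) \<odot> c(R,R))\<close>, and the contribution of the crossing is its sign times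
  \<open>\<phi> (c(R,L)) (c(L,L)) (c(R,R))\<close> (\<open>coloring_corners\<close>, \<open>BW_corners\<close>). Reversing a strand renames its sides, and
  so one argument covers all oriented versions of each move.
  
  First move: the in and out regions coincide, since a path around the loop joins them. The relation at
  the crossing then puts the colors into the form for which \<open>\<phi>\<close> vanishes (\<open>kink_weight_zero\<close>).
  
  Second move: the two crossings have opposite signs and the same colors at their corners
  (\<open>bigon_weight_zero\<close>).
  
  Third move: assign to each region the sides of the three strands on which it lies. Six of the eight
  possibilities occur before and after the move, with the same colors; the remaining two are the central
  triangles, one before and one after. So the colors live on the vertices of a cube, and the six
  crossings of both pictures are the faces of the cube, the two crossings of a given pair of strands being
  opposite. If the strands are ordered by height, the cocycle condition says that the differences of
  opposite faces, with suitable signs, sum to zero (\<open>cube_identity\<close>). Reversing one strand changes the signs of two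
  crossings and exchanges the sides for the third pair, so all three differences are negated at once
  (\<open>triangle_identity\<close>).
  
  The rest is plane topology. Near a crossing the diagram lies in narrow double cones around its two
  tangents, so that every curve leaving in between enters the expected region (\<open>region_towards_curve\<close>).
  Charts preserve orientation, hence sides, and they map each face of a picture into one region
  (\<open>corner_face\<close>, \<open>face_constant\<close>). Finally the faces of the pictures in the second and third move, being bounded by
  graphs, are connected as soon as comparing two of these graphs cuts out an interval (\<open>connected_cell\<close>).
\<close>

section \<open>Regions at a crossing\<close>

lemma det2_self_zero [simp]:
  "det2 u u = 0" "det2 u 0 = 0" "det2 0 u = 0"
  by (auto simp: det2_def)

lemma det2_add_right: "det2 u (v + w) = det2 u v + det2 u w"
  and det2_diff_right: "det2 u (v - w) = det2 u v - det2 u w"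
  and det2_minus_right: "det2 u (- v) = - det2 u v"
  and det2_scaleR_right: "det2 u (r *\<^sub>R v) = r * det2 u v"
  and det2_scaleR_left: "det2 (r *\<^sub>R u) v = r * det2 u v"
  by (auto simp: det2_def algebra_simps)

lemma bounded_linear_det2: "bounded_linear (det2 u)"
  unfolding det2_def
  by (intro bounded_linear_sub bounded_linear_mult_const bounded_linear_const_mult
      bounded_linear_Re bounded_linear_Im)

lemma abs_det2_le: "\<bar>det2 u v\<bar> \<le> cmod u * cmod v"
proof -
  have "det2 u v = Im (cnj u * v)" by (simp add: det2_def algebra_simps)
  then show ?thesis using abs_Im_le_cmod[of "cnj u * v"] by (simp add: norm_mult)
qed

text \<open>
  The cross product kills the linear term of \<open>\<gamma>\<close>, so only the remainder of the first order expansion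
  contributes to the left side.
\<close>

lemma chord_near_tangent:
  assumes D: "(\<gamma> has_vector_derivative D) (at \<tau>)" "D \<noteq> 0" and m: "m > 0"
  shows "\<exists>\<delta>>0. \<forall>t. \<bar>t - \<tau>\<bar> < \<delta> \<longrightarrow> \<bar>det2 (sgn D) (\<gamma> t - \<gamma> \<tau>)\<bar> \<le> m * cmod (\<gamma> t - \<gamma> \<tau>)"
proof -
  define e where "e = m * cmod D / (1 + m)"
  have e: "e > 0" "e = m * (cmod D - e)" using D m by (auto simp: e_def field_simps)
  obtain \<delta> where \<delta>: "\<delta> > 0"
    "\<And>t. \<bar>t - \<tau>\<bar> < \<delta> \<Longrightarrow> cmod (\<gamma> t - \<gamma> \<tau> - (t - \<tau>) *\<^sub>R D) \<le> e * \<bar>t - \<tau>\<bar>"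
    using D(1) e(1) unfolding has_vector_derivative_def has_derivative_at_alt by (metis real_norm_def)
  have "\<bar>det2 (sgn D) (\<gamma> t - \<gamma> \<tau>)\<bar> \<le> m * cmod (\<gamma> t - \<gamma> \<tau>)" if t: "\<bar>t - \<tau>\<bar> < \<delta>" for t
  proof -
    let ?r = "\<gamma> t - \<gamma> \<tau> - (t - \<tau>) *\<^sub>R D"
    have "det2 (sgn D) (\<gamma> t - \<gamma> \<tau>) = det2 (sgn D) ?r"
      by (simp add: det2_diff_right det2_scaleR_right det2_scaleR_left sgn_div_norm)
    also have "\<bar>\<dots>\<bar> \<le> cmod ?r" using abs_det2_le[of "sgn D" ?r] D(2) by (simp add: norm_sgn)
    also have "\<dots> \<le> e * \<bar>t - \<tau>\<bar>" by (rule \<delta>(2)[OF t])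
    also have "\<dots> = m * ((cmod D - e) * \<bar>t - \<tau>\<bar>)" using e(2) by (metis mult.assoc)
    also have "\<dots> \<le> m * cmod (\<gamma> t - \<gamma> \<tau>)"
    proof -
      have "\<bar>t - \<tau>\<bar> * cmod D \<le> cmod (\<gamma> t - \<gamma> \<tau>) + cmod ?r"
        using norm_triangle_ineq4[of "\<gamma> t - \<gamma> \<tau>" ?r] by (simp add: norm_scaleR[symmetric] del: norm_scaleR)
      then have "(cmod D - e) * \<bar>t - \<tau>\<bar> \<le> cmod (\<gamma> t - \<gamma> \<tau>)"
        using \<delta>(2)[OF t] unfolding left_diff_distrib by (simp only: mult.commute)
      then show ?thesis using m by simp
    qed
    finally show ?thesis .
  qed
  then show ?thesis using \<delta>(1) by blast
qed

lemma link_diagramD: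
  assumes "oriented_link_diagram L"
  shows diagram_params: "params L = {0..<1}"
    and diagram_closed: "\<And>i t. i < num L \<Longrightarrow> curve L i (t + 1) = curve L i t"
    and diagram_C1: "\<And>i. i < num L \<Longrightarrow> curve L i C1_differentiable_on UNIV"
    and diagram_immersion: "\<And>i t. i < num L \<Longrightarrow> vector_derivative (curve L i) (at t) \<noteq> 0"
    and diagram_finite: "finite (crossings L)"
    and diagram_no_triple: "\<And>p q r. {p, q, r} \<subseteq> places L \<Longrightarrow> p \<noteq> q \<Longrightarrow> q \<noteq> r \<Longrightarrow> p \<noteq> r \<Longrightarrow>
          case_prod (curve L) p = case_prod (curve L) r \<Longrightarrow>
          case_prod (curve L) q = case_prod (curve L) r \<Longrightarrow> False"
    and diagram_transverse: "\<And>i s j t. (i, s) \<in> places L \<Longrightarrow> (j, t) \<in> places L \<Longrightarrow> (i, s) \<noteq> (j, t) \<Longrightarrow>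
          curve L i s = curve L j t \<Longrightarrow> det2 (tangent L i s) (tangent L j t) \<noteq> 0"
proof -
  note * = assms[unfolded oriented_link_diagram_def]
  note ** = *[THEN conjunct2]
  note *** = **[THEN conjunct2, THEN conjunct2]
  show "params L = {0..<1}" by (rule *[THEN conjunct1])
  show "curve L i (t + 1) = curve L i t" if "i < num L" for i t
    using **[THEN conjunct1, rule_format, OF that] by simp
  show "curve L i C1_differentiable_on UNIV" if "i < num L" for i
    using **[THEN conjunct1, rule_format, OF that] by simp
  show "vector_derivative (curve L i) (at t) \<noteq> 0" if "i < num L" for i t
    using **[THEN conjunct1, rule_format, OF that] by simp
  show "finite (crossings L)" by (rule **[THEN conjunct2, THEN conjunct1])
  show False if "{p, q, r} \<subseteq> places L" "p \<noteq> q" "q \<noteq> r" "p \<noteq> r"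
    "case_prod (curve L) p = case_prod (curve L) r" "case_prod (curve L) q = case_prod (curve L) r" for p q r
    using that ***[THEN conjunct1, rule_format, of "case_prod (curve L) r"] by blast
  show "det2 (tangent L i s) (tangent L j t) \<noteq> 0"
    if "(i, s) \<in> places L" "(j, t) \<in> places L" "(i, s) \<noteq> (j, t)" "curve L i s = curve L j t" for i s j t
    using ***[THEN conjunct2, rule_format, OF that] by simp
qed

lemma diagram_curve_deriv:
  assumes "oriented_link_diagram L" "i < num L"
  shows "(curve L i has_vector_derivative vector_derivative (curve L i) (at t)) (at t)"
    and "vector_derivative (curve L i) (at t) \<noteq> 0"
proof -
  show "vector_derivative (curve L i) (at t) \<noteq> 0"
    using diagram_immersion assms .
  obtain D where "(curve L i has_vector_derivative D t) (at t)"
    using diagram_C1[OF assms] unfolding C1_differentiable_on_def by blast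
  then show "(curve L i has_vector_derivative vector_derivative (curve L i) (at t)) (at t)"
    by (simp add: vector_derivative_at)
qed

lemma unit_tangent:
  assumes "oriented_link_diagram L" "i < num L"
  shows "cmod (tangent L i t) = 1"
  using diagram_curve_deriv(2)[OF assms] by (simp add: tangent_def norm_sgn)

text \<open>
  Parameters are taken from \<open>[0,1)\<close>, while compactness arguments need \<open>[0,1]\<close>. This identifies the tangents
  at the two ends.
\<close>

lemma period_vector_derivative:
  assumes "oriented_link_diagram L" "i < num L"
  shows "vector_derivative (curve L i) (at (t + 1)) = vector_derivative (curve L i) (at t)"
proof -
  have per: "curve L i (x + 1) = curve L i x" for x
    using diagram_closed assms .
  have "(curve L i has_vector_derivative vector_derivative (curve L i) (at (t + 1))) (at (t + 1))"
    using diagram_curve_deriv[OF assms] by blast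
  then have "((curve L i \<circ> (\<lambda>x. x + 1)) has_vector_derivative
      1 *\<^sub>R vector_derivative (curve L i) (at (t + 1))) (at t)"
    by (intro vector_diff_chain_at) (auto intro!: derivative_eq_intros)
  moreover have "curve L i \<circ> (\<lambda>x. x + 1) = curve L i" using per by auto
  ultimately have "(curve L i has_vector_derivative vector_derivative (curve L i) (at (t + 1))) (at t)"
    by simp
  from vector_derivative_at[OF this] show ?thesis by simp
qed

lemma crossingE:
  assumes "oriented_link_diagram L" "(z, u, v) \<in> crossings L"
  obtains i s j t where "i < num L" "j < num L" "s \<in> {0..<1}" "t \<in> {0..<1}" "(i, s) \<noteq> (j, t)"
    "z = curve L i s" "z = curve L j t" "u = tangent L i s" "v = tangent L j t"
    "height L i s > height L j t"
  using assms(2) diagram_params[OF assms(1)] unfolding crossings_def places_def by auto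

lemma crossing_tangents:
  assumes "oriented_link_diagram L" "(z, u, v) \<in> crossings L"
  shows "cmod u = 1" "cmod v = 1" "det2 u v \<noteq> 0"
proof -
  obtain i s j t where *: "i < num L" "j < num L" "s \<in> {0..<1}" "t \<in> {0..<1}" "(i, s) \<noteq> (j, t)"
    "z = curve L i s" "z = curve L j t" "u = tangent L i s" "v = tangent L j t"
    by (rule crossingE[OF assms]) blast
  show "cmod u = 1" "cmod v = 1" using * unit_tangent[OF assms(1)] by auto
  have "(i, s) \<in> places L" "(j, t) \<in> places L" using * diagram_params[OF assms(1)] by (auto simp: places_def)
  then show "det2 u v \<noteq> 0"
    using diagram_transverse[OF assms(1)] * by metis
qed

text \<open>
  Near a crossing the diagram stays in narrow double cones around the two tangent lines. Parameters at
  which a curve passes through \<open>z\<close> have neighborhoods where the chord estimate applies, and there are no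
  other passages than the two given ones because a diagram has no triple points. Near any other
  parameter the curve keeps a positive distance from \<open>z\<close>. Finitely many such neighborhoods cover the
  compact parameter interval.
\<close>

lemma underlying_near_crossing:
  assumes L: "oriented_link_diagram L" and c: "(z, u, v) \<in> crossings L" and m: "m > 0"
  shows "\<exists>\<delta>>0. \<forall>q\<in>underlying L. q \<noteq> z \<longrightarrow> cmod (q - z) < \<delta> \<longrightarrow>
     \<bar>det2 u (q - z)\<bar> \<le> m * cmod (q - z) \<or> \<bar>det2 v (q - z)\<bar> \<le> m * cmod (q - z)"
proof -
  define P where "P = (\<lambda>q. \<bar>det2 u (q - z)\<bar> \<le> m * cmod (q - z) \<or> \<bar>det2 v (q - z)\<bar> \<le> m * cmod (q - z))"
  obtain i s j t where *: "i < num L" "j < num L" "s \<in> {0..<1}" "t \<in> {0..<1}" "(i, s) \<noteq> (j, t)"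
    "z = curve L i s" "z = curve L j t" "u = tangent L i s" "v = tangent L j t"
    by (rule crossingE[OF L c]) blast
  have par: "params L = {0..<1}" using diagram_params[OF L] .
  have per: "curve L k (x + 1) = curve L k x" if "k < num L" for k x
    using diagram_closed[OF L that] .
  have no_triple: "(k, x) = (i, s) \<or> (k, x) = (j, t)"
    if "k < num L" "x \<in> {0..<1}" "curve L k x = z" for k x
  proof -
    have "{(k, x), (i, s), (j, t)} \<subseteq> places L" using that * by (auto simp: places_def par)
    moreover have "case_prod (curve L) (k, x) = z" "case_prod (curve L) (i, s) = z"
      "case_prod (curve L) (j, t) = z" using that * by auto
    ultimately show ?thesis using diagram_no_triple[OF L, of "(k, x)" "(i, s)" "(j, t)"] *(5) by metis
  qed
  have tan: "sgn (vector_derivative (curve L k) (at x)) \<in> {u, v}"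
    if k: "k < num L" and x: "x \<in> {0..1}" and z: "curve L k x = z" for k x
  proof (cases "x = 1")
    case True
    have "curve L k 0 = z" using per[OF k, of 0] z True by simp
    then have "(k, 0) = (i, s) \<or> (k, 0) = (j, t)" using no_triple[OF k, of 0] by simp
    then have "tangent L k 0 \<in> {u, v}" using * by auto
    then show ?thesis using period_vector_derivative[OF L k, of 0] True by (simp add: tangent_def)
  next
    case False
    then have "(k, x) = (i, s) \<or> (k, x) = (j, t)" using no_triple[OF k, of x] x z by auto
    then show ?thesis using * by (auto simp: tangent_def)
  qed
  have loc: "\<exists>\<delta> \<eta>. \<delta> > 0 \<and> \<eta> > 0 \<and> (\<forall>y. \<bar>y - x\<bar> < \<eta> \<longrightarrow> cmod (curve L k y - z) < \<delta> \<longrightarrow> P (curve L k y))"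
    if k: "k < num L" and x: "x \<in> {0..1}" for k x
  proof (cases "curve L k x = z")
    case True
    obtain \<eta> where "\<eta> > 0" "\<forall>y. \<bar>y - x\<bar> < \<eta> \<longrightarrow>
       \<bar>det2 (sgn (vector_derivative (curve L k) (at x))) (curve L k y - curve L k x)\<bar>
        \<le> m * cmod (curve L k y - curve L k x)"
      using chord_near_tangent[OF diagram_curve_deriv[OF L k] m] by blast
    then show ?thesis using tan[OF k x True] True unfolding P_def by (metis insertE singletonD zero_less_one)
  next
    case False
    have "isCont (curve L k) x"
      using diagram_curve_deriv(1)[OF L k] has_vector_derivative_continuous by blast
    moreover have "cmod (curve L k x - z) / 2 > 0" using False by simp
    ultimately obtain \<eta> where \<eta>: "\<eta> > 0"
      "\<And>y. dist y x < \<eta> \<Longrightarrow> dist (curve L k y) (curve L k x) < cmod (curve L k x - z) / 2"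
      unfolding continuous_at_eps_delta by blast
    have "\<not> cmod (curve L k y - z) < cmod (curve L k x - z) / 2" if "\<bar>y - x\<bar> < \<eta>" for y
      using \<eta>(2)[of y] that norm_triangle_ineq[of "curve L k x - curve L k y" "curve L k y - z"]
      by (auto simp: dist_norm norm_minus_commute)
    then show ?thesis using \<eta>(1) False
      by (intro exI[of _ "cmod (curve L k x - z) / 2"] exI[of _ \<eta>]) auto
  qed
  have strand: "\<exists>\<delta>>0. \<forall>y\<in>{0..1}. cmod (curve L k y - z) < \<delta> \<longrightarrow> P (curve L k y)"
    if k: "k < num L" for k
  proof -
    obtain \<delta> \<eta> where de: "\<And>x. x \<in> {0..1} \<Longrightarrow> \<delta> x > 0 \<and> \<eta> x > 0 \<and>
        (\<forall>y. \<bar>y - x\<bar> < \<eta> x \<longrightarrow> cmod (curve L k y - z) < \<delta> x \<longrightarrow> P (curve L k y))"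
      using loc[OF k] by metis
    have "compact {0..1::real}" by simp
    then obtain C where C: "C \<subseteq> {0..1::real}" "finite C" "{0..1} \<subseteq> (\<Union>x\<in>C. ball x (\<eta> x))"
    proof (rule compactE_image[where C = "{0..1}" and f = "\<lambda>x. ball x (\<eta> x)"])
      show "{0..1} \<subseteq> (\<Union>x\<in>{0..1}. ball x (\<eta> x))"
      proof
        fix x :: real assume "x \<in> {0..1}"
        then show "x \<in> (\<Union>x\<in>{0..1}. ball x (\<eta> x))" using de[of x] by (intro UN_I[of x]) auto
      qed
    qed auto
    have "C \<noteq> {}" using C(3) by auto
    have "Min (\<delta> ` C) > 0" using C \<open>C \<noteq> {}\<close> de by (subst Min_gr_iff) auto
    moreover have "P (curve L k y)" if y: "y \<in> {0..1}" "cmod (curve L k y - z) < Min (\<delta> ` C)" for y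
    proof -
      obtain x where x: "x \<in> C" "y \<in> ball x (\<eta> x)" using C(3) y(1) by blast
      have "Min (\<delta> ` C) \<le> \<delta> x" using x C(2) by simp
      then show ?thesis using de[of x] x C(1) y(2) by (force simp: dist_real_def)
    qed
    ultimately show ?thesis by blast
  qed
  then obtain \<delta> where \<delta>: "\<And>k. k < num L \<Longrightarrow> \<delta> k > 0 \<and>
      (\<forall>y\<in>{0..1}. cmod (curve L k y - z) < \<delta> k \<longrightarrow> P (curve L k y))" by metis
  have ne: "num L > 0" using *(1) by simp
  have "Min (\<delta> ` {..<num L}) > 0" using ne \<delta> by (subst Min_gr_iff) auto
  moreover have "P q" if q: "q \<in> underlying L" "cmod (q - z) < Min (\<delta> ` {..<num L})" for q
  proof -
    obtain k y where ky: "k < num L" "y \<in> {0..<1}" "q = curve L k y"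
      using q(1) par by (auto simp: underlying_def places_def)
    have "Min (\<delta> ` {..<num L}) \<le> \<delta> k" using ky(1) by simp
    from less_le_trans[OF q(2) this] have "cmod (curve L k y - z) < \<delta> k" "y \<in> {0..1}"
      using ky by auto
    then show ?thesis using \<delta>[OF ky(1)] ky(3) by blast
  qed
  ultimately show ?thesis unfolding P_def by blast
qed

text \<open>
  A curve that leaves \<open>z\<close> with a derivative in the same open sector between the tangent lines as \<open>w\<close> can be
  joined to the ray along \<open>w\<close> without meeting the diagram: all points of the joining segments are seen from \<open>z\<close>
  in directions that are bounded away from both tangents, so they lie outside the double cones.
\<close>

lemma closed_segment_avoids_underlying:
  assumes L: "oriented_link_diagram L" and c: "(z, u, v) \<in> crossings L"
    and w: "det2 u w \<noteq> 0" "det2 v w \<noteq> 0"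
    and d: "sgn (det2 u d) = sgn (det2 u w)" "sgn (det2 v d) = sgn (det2 v w)"
    and g: "(\<gamma> has_vector_derivative d) (at_right 0)" "\<gamma> 0 = z"
  shows "\<forall>\<^sub>F t in at_right (0::real). closed_segment (z + of_real t * w) (\<gamma> t) \<subseteq> - underlying L"
proof -
  have dnz: "det2 u d \<noteq> 0" "det2 v d \<noteq> 0" using d w by (auto simp: sgn_0_0)
  define \<mu> where "\<mu> = min (min (\<bar>det2 u d\<bar> / 2) (\<bar>det2 v d\<bar> / 2)) (min \<bar>det2 u w\<bar> \<bar>det2 v w\<bar>)"
  have \<mu>: "\<mu> > 0" "\<mu> \<le> \<bar>det2 u d\<bar> / 2" "\<mu> \<le> \<bar>det2 v d\<bar> / 2" "\<mu> \<le> \<bar>det2 u w\<bar>" "\<mu> \<le> \<bar>det2 v w\<bar>"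
    using w dnz unfolding \<mu>_def by (simp, (simp only: min.coboundedI1 min.coboundedI2 min.cobounded1 min.cobounded2)+)
  define M where "M = cmod d + cmod w + 1"
  have M: "M > 0" unfolding M_def by (simp add: add_nonneg_pos)
  define m where "m = \<mu> / (2 * M)"
  have m: "m > 0" "m * M < \<mu>" using \<mu>(1) M by (auto simp: m_def field_simps)
  obtain \<delta> where \<delta>: "\<delta> > 0" "\<And>q. q \<in> underlying L \<Longrightarrow> q \<noteq> z \<Longrightarrow> cmod (q - z) < \<delta> \<Longrightarrow>
     \<bar>det2 u (q - z)\<bar> \<le> m * cmod (q - z) \<or> \<bar>det2 v (q - z)\<bar> \<le> m * cmod (q - z)"
    using underlying_near_crossing[OF L c m(1)] by blast
  have lim: "((\<lambda>t. (\<gamma> t - z) /\<^sub>R t) \<longlongrightarrow> d) (at_right 0)"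
  proof -
    have "((\<lambda>t. (1 / norm (t - 0)) *\<^sub>R (\<gamma> t - (\<gamma> 0 + (t - 0) *\<^sub>R d))) \<longlongrightarrow> 0) (at_right 0)"
      using g(1) unfolding has_vector_derivative_def has_derivative_within by blast
    then have "((\<lambda>t. (\<gamma> t - z) /\<^sub>R t - d) \<longlongrightarrow> 0) (at_right 0)"
      by (rule Lim_transform_eventually)
        (auto simp: eventually_at_right_field g(2) divide_simps algebra_simps intro!: exI[of _ 1])
    then show ?thesis by (simp add: LIM_zero_iff)
  qed
  have "\<forall>\<^sub>F t in at_right 0. cmod ((\<gamma> t - z) /\<^sub>R t - d) < 1"
    using tendstoD[OF lim, of 1] by (simp add: dist_norm)
  moreover have "\<forall>\<^sub>F t in at_right 0. \<bar>det2 u ((\<gamma> t - z) /\<^sub>R t) - det2 u d\<bar> < \<bar>det2 u d\<bar> / 2"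
    using tendstoD[OF bounded_linear.tendsto[OF bounded_linear_det2 lim], of "\<bar>det2 u d\<bar> / 2"] dnz
    by (simp add: dist_real_def)
  moreover have "\<forall>\<^sub>F t in at_right 0. \<bar>det2 v ((\<gamma> t - z) /\<^sub>R t) - det2 v d\<bar> < \<bar>det2 v d\<bar> / 2"
    using tendstoD[OF bounded_linear.tendsto[OF bounded_linear_det2 lim], of "\<bar>det2 v d\<bar> / 2"] dnz
    by (simp add: dist_real_def)
  moreover have "\<forall>\<^sub>F t in at_right 0. (0::real) < t \<and> t < \<delta> / M"
    using \<delta>(1) M by (intro eventually_at_rightI[of 0 "\<delta> / M"]) auto
  ultimately show ?thesis
  proof eventually_elim
    case (elim t)
    define e where "e = (\<gamma> t - z) /\<^sub>R t"
    have \<gamma>: "\<gamma> t = z + t *\<^sub>R e" using elim by (simp add: e_def)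
    note el = elim[folded e_def]
    \<comment> \<open>a convex combination of two numbers on the same side of zero stays away from zero\<close>
    have half: "sgn a * ((1 - \<theta>) * b + \<theta> * a') \<ge> \<nu>"
      if "\<theta> \<in> {0..1}" "\<bar>a' - a\<bar> < \<bar>a\<bar> / 2" "sgn a = sgn b" "\<nu> \<le> \<bar>a\<bar> / 2" "\<nu> \<le> \<bar>b\<bar>"
      for \<theta> a a' b \<nu> :: real
    proof -
      have "sgn a * b = \<bar>b\<bar>" using that(3) by (simp add: abs_sgn mult.commute)
      moreover have "sgn a * a' \<ge> \<bar>a\<bar> / 2"
        using that(2) by (cases "a > 0"; cases "a = 0") (auto simp: sgn_if abs_if split: if_splits)
      ultimately have "sgn a * b \<ge> \<nu>" "sgn a * a' \<ge> \<nu>" using that by auto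
      then have "(1 - \<theta>) * (sgn a * b) + \<theta> * (sgn a * a') \<ge> \<nu>"
        using that(1) convex_bound_le[of "-(sgn a * b)" "-\<nu>" "-(sgn a * a')" "1 - \<theta>" \<theta>] by simp
      then show ?thesis by (simp add: algebra_simps)
    qed
    show ?case
    proof
      fix q assume "q \<in> closed_segment (z + of_real t * w) (\<gamma> t)"
      then obtain \<theta> where \<theta>: "\<theta> \<in> {0..1}" "q = (1 - \<theta>) *\<^sub>R (z + of_real t * w) + \<theta> *\<^sub>R \<gamma> t"
        by (auto simp: closed_segment_def)
      define k where "k = (1 - \<theta>) *\<^sub>R w + \<theta> *\<^sub>R e"
      have q: "q - z = t *\<^sub>R k"
        by (simp add: \<theta>(2) \<gamma> k_def algebra_simps scaleR_conv_of_real)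
      have "cmod e \<le> cmod d + 1" using norm_triangle_ineq[of "e - d" d] el(1) by simp
      then have "\<theta> * cmod e \<le> 1 * (cmod d + 1)" using \<theta>(1) by (intro mult_mono) auto
      moreover have "(1 - \<theta>) * cmod w \<le> cmod w" using \<theta>(1) by (simp add: mult_left_le_one_le)
      moreover have "cmod k \<le> (1 - \<theta>) * cmod w + \<theta> * cmod e"
        using norm_triangle_ineq[of "(1 - \<theta>) *\<^sub>R w" "\<theta> *\<^sub>R e"] \<theta>(1) by (simp add: k_def)
      ultimately have "cmod k \<le> cmod w + 1 * (cmod d + 1)" by (meson add_mono order_trans)
      then have kM: "cmod k \<le> M" unfolding M_def by simp
      have "\<mu> \<le> sgn (det2 u d) * det2 u k"
        unfolding k_def det2_add_right det2_scaleR_right using \<theta>(1) el d \<mu> by (intro half) auto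
      also have "\<dots> \<le> \<bar>det2 u k\<bar>" by (simp add: sgn_if abs_ge_self abs_ge_minus_self)
      finally have ku: "\<mu> \<le> \<bar>det2 u k\<bar>" .
      have "\<mu> \<le> sgn (det2 v d) * det2 v k"
        unfolding k_def det2_add_right det2_scaleR_right using \<theta>(1) el d \<mu> by (intro half) auto
      also have "\<dots> \<le> \<bar>det2 v k\<bar>" by (simp add: sgn_if abs_ge_self abs_ge_minus_self)
      finally have kv: "\<mu> \<le> \<bar>det2 v k\<bar>" .
      have mk: "m * cmod k < \<mu>" using kM m mult_left_mono[of "cmod k" M m] by linarith
      have "k \<noteq> 0" using ku \<mu>(1) by auto
      then have "q \<noteq> z" using q el by auto
      moreover have "cmod (q - z) < \<delta>"
      proof -
        have "cmod (q - z) \<le> t * M" using kM el by (simp add: q mult_left_mono)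
        also have "\<dots> < \<delta>" using el M by (simp add: field_simps)
        finally show ?thesis .
      qed
      moreover have "\<not> \<bar>det2 u (q - z)\<bar> \<le> m * cmod (q - z)" "\<not> \<bar>det2 v (q - z)\<bar> \<le> m * cmod (q - z)"
        using ku kv mk el by (auto simp: q det2_scaleR_right abs_mult mult.left_commute[of m])
      ultimately show "q \<in> - underlying L" using \<delta>(2)[of q] by auto
    qed
  qed
qed

lemma region_towards_eqI:
  assumes "R \<in> regions L" "\<forall>\<^sub>F t in at_right (0::real). z + of_real t * w \<in> R"
  shows "region_towards L z w = R"
  unfolding region_towards_def
proof (rule the_equality)
  show "R \<in> regions L \<and> (\<forall>\<^sub>F t in at_right (0::real). z + of_real t * w \<in> R)" using assms by blast
next
  fix S assume S: "S \<in> regions L \<and> (\<forall>\<^sub>F t in at_right (0::real). z + of_real t * w \<in> S)"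
  have "\<forall>\<^sub>F t in at_right (0::real). z + of_real t * w \<in> S \<inter> R"
    using assms(2) S by (auto elim: eventually_elim2)
  then have "S \<inter> R \<noteq> {}" using eventually_happens'[OF trivial_limit_at_right_real] by blast
  then show "S = R" using S assms(1) components_eq unfolding regions_def by blast
qed

lemma region_component: "q \<notin> underlying L \<Longrightarrow> connected_component_set (- underlying L) q \<in> regions L"
  by (simp add: regions_def componentsI)

text \<open>
  The region met first in direction \<open>w\<close> can be found along any curve that leaves into the same sector. In
  particular it exists, which makes the definite description in its definition meaningful.
\<close>

lemma region_towards_curve:
  assumes L: "oriented_link_diagram L" and c: "(z, u, v) \<in> crossings L"
    and w: "det2 u w \<noteq> 0" "det2 v w \<noteq> 0"
    and d: "sgn (det2 u d) = sgn (det2 u w)" "sgn (det2 v d) = sgn (det2 v w)"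
    and g: "(\<gamma> has_vector_derivative d) (at_right 0)" "\<gamma> 0 = z"
  shows "\<forall>\<^sub>F t in at_right (0::real). \<gamma> t \<notin> underlying L \<and>
     region_towards L z w = connected_component_set (- underlying L) (\<gamma> t)"
proof -
  define ray where "ray = (\<lambda>t::real. z + of_real t * w)"
  have "(ray has_vector_derivative w) (at_right 0)" "ray 0 = z"
    unfolding ray_def by (auto intro!: derivative_eq_intros)
  from closed_segment_avoids_underlying[OF L c w refl refl this]
  have "\<forall>\<^sub>F t in at_right (0::real). ray t \<notin> underlying L"
    by (auto simp: ray_def elim: eventually_mono)
  then obtain b where b: "b > 0" "\<And>t. 0 < t \<Longrightarrow> t < b \<Longrightarrow> ray t \<notin> underlying L"
    unfolding eventually_at_right_field by auto
  define I where "I = {0<..<b}"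
  have "connected (ray ` I)" unfolding ray_def I_def
    by (intro connected_continuous_image continuous_intros) auto
  moreover have "ray ` I \<subseteq> - underlying L" using b(2) by (auto simp: I_def)
  ultimately have same: "connected_component_set (- underlying L) (ray s) = connected_component_set (- underlying L) (ray t)"
    if "s \<in> I" "t \<in> I" for s t
    using that by (intro connected_component_eq) (auto simp: connected_component_def)
  have evI: "\<forall>\<^sub>F t in at_right (0::real). t \<in> I"
    unfolding I_def using b(1) by (rule eventually_at_right_real)
  have tow: "region_towards L z w = connected_component_set (- underlying L) (ray t)" if t: "t \<in> I" for t
  proof (rule region_towards_eqI)
    show "connected_component_set (- underlying L) (ray t) \<in> regions L"
      using t b(2) by (intro region_component) (auto simp: I_def)
    show "\<forall>\<^sub>F s in at_right 0. z + of_real s * w \<in> connected_component_set (- underlying L) (ray t)"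
      using evI
    proof eventually_elim
      case (elim s)
      have "ray s \<in> connected_component_set (- underlying L) (ray s)"
        using b(2) elim by (simp add: I_def)
      then have "ray s \<in> connected_component_set (- underlying L) (ray t)"
        unfolding same[OF elim t] .
      then show ?case by (simp only: ray_def)
    qed
  qed
  show ?thesis using closed_segment_avoids_underlying[OF L c w d g] evI
  proof eventually_elim
    case (elim t)
    have "\<gamma> t \<notin> underlying L" using elim(1) by auto
    moreover
    have "connected_component (- underlying L) (ray t) (\<gamma> t)"
      unfolding connected_component_def using elim(1)
      by (intro exI[of _ "closed_segment (ray t) (\<gamma> t)"]) (auto simp: ray_def)
    then have "connected_component_set (- underlying L) (\<gamma> t) = connected_component_set (- underlying L) (ray t)"
      by (intro connected_component_eq) simp
    ultimately show ?case using tow[OF elim(2)] by simp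
  qed
qed

section \<open>Corners, indexed by sides of the strands\<close>

text \<open>
  Directions into the four regions at a crossing, indexed by the side of the upper strand and the side
  of the lower strand on which the region lies, \<open>True\<close> being the left side. Each is an angle bisector
  of the lines spanned by the two tangents, so it is transverse to both strands. Whether \<open>u + v\<close>, which
  points into the out region, is to the left of the upper strand depends on the sign of the crossing.
\<close>

definition corner_direction :: "complex \<Rightarrow> complex \<Rightarrow> bool \<Rightarrow> bool \<Rightarrow> complex" where
  "corner_direction u v l m =
     (if l = m then (if l then \<i> * (u + v) else - \<i> * (u + v))
      else if l = (det2 u v > 0) then u + v else - (u + v))"

definition corner :: "strands \<Rightarrow> crossing \<Rightarrow> bool \<Rightarrow> bool \<Rightarrow> complex set" where
  "corner L = (\<lambda>(z, u, v) l m. region_towards L z (corner_direction u v l m))"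

definition side :: "bool \<Rightarrow> real" where "side l = (if l then 1 else - 1)"

lemma corner_direction_sides:
  assumes "cmod u = 1" "cmod v = 1" "det2 u v \<noteq> 0"
  shows "sgn (det2 u (corner_direction u v l m)) = side l"
    and "sgn (det2 v (corner_direction u v l m)) = side m"
proof -
  define p where "p = Re u * Re v + Im u * Im v"
  have u: "(Re u)\<^sup>2 + (Im u)\<^sup>2 = 1" and v: "(Re v)\<^sup>2 + (Im v)\<^sup>2 = 1"
    using assms by (auto simp: cmod_def)
  have "(det2 u v)\<^sup>2 + p\<^sup>2 = ((Re u)\<^sup>2 + (Im u)\<^sup>2) * ((Re v)\<^sup>2 + (Im v)\<^sup>2)"
    by (simp add: det2_def p_def power2_eq_square algebra_simps)
  then have "(det2 u v)\<^sup>2 + p\<^sup>2 = 1" using u v by simp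
  moreover have "(det2 u v)\<^sup>2 > 0" using assms(3) by simp
  ultimately have "p\<^sup>2 < 1" by linarith
  then have p: "1 + p > 0" by (smt (verit) power2_eq_square mult_minus_left mult_le_cancel_right1 one_le_power power2_minus)
  have d1: "det2 u (u + v) = det2 u v" and d2: "det2 v (u + v) = - det2 u v"
    and d1': "det2 u (- u - v) = - det2 u v" and d2': "det2 v (- u - v) = det2 u v"
    by (auto simp: det2_def algebra_simps)
  have "det2 u (\<i> * (u + v)) = ((Re u)\<^sup>2 + (Im u)\<^sup>2) + p" "det2 v (\<i> * (u + v)) = ((Re v)\<^sup>2 + (Im v)\<^sup>2) + p"
    by (auto simp: det2_def p_def power2_eq_square algebra_simps)
  then have d3: "det2 u (\<i> * (u + v)) = 1 + p" "det2 v (\<i> * (u + v)) = 1 + p" using u v by auto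
  show "sgn (det2 u (corner_direction u v l m)) = side l"
    and "sgn (det2 v (corner_direction u v l m)) = side m"
    using p assms(3) d1 d2 d1' d2' d3
    by (auto simp: corner_direction_def side_def det2_minus_right sgn_if)
qed

lemma corner_curve:
  assumes L: "oriented_link_diagram L" and c: "(z, u, v) \<in> crossings L"
    and d: "sgn (det2 u d) = side l" "sgn (det2 v d) = side m"
    and g: "(\<gamma> has_vector_derivative d) (at_right 0)" "\<gamma> 0 = z"
  shows "\<forall>\<^sub>F t in at_right (0::real). \<gamma> t \<notin> underlying L \<and>
     corner L (z, u, v) l m = connected_component_set (- underlying L) (\<gamma> t)"
  unfolding corner_def prod.case
proof (rule region_towards_curve[OF L c _ _ _ _ g])
  note s = corner_direction_sides[OF crossing_tangents[OF L c], of l m]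
  have "side l \<noteq> 0" "side m \<noteq> 0" by (auto simp: side_def)
  then show "det2 u (corner_direction u v l m) \<noteq> 0" "det2 v (corner_direction u v l m) \<noteq> 0"
    using s by auto
qed (use d corner_direction_sides[OF crossing_tangents[OF L c], of l m] in auto)

definition signed :: "bool \<Rightarrow> 'a::ab_group_add \<Rightarrow> 'a" where
  "signed b x = (if b then x else - x)"

text \<open>
  In terms of sides, the region whose color is the first argument of \<open>\<phi>\<close> is to the right of the upper and
  to the left of the lower strand: this is the in region of a positive crossing and the out region of
  a negative one.
\<close>

definition crossing_weight ::
    "('x \<Rightarrow> 'x \<Rightarrow> 'x \<Rightarrow> 'a::ab_group_add) \<Rightarrow> strands \<Rightarrow> (complex set \<Rightarrow> 'x) \<Rightarrow> crossing \<Rightarrow> 'a" where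
  "crossing_weight \<phi> L f c =
     signed (case c of (z, u, v) \<Rightarrow> det2 u v > 0)
       (\<phi> (f (corner L c False True)) (f (corner L c True True)) (f (corner L c False False)))"

lemma BW_corners: "BW \<phi> (dual_graph L) f = (\<Sum>c\<in>crossings L. crossing_weight \<phi> L f c)"
  unfolding BW_def
  by (intro sum.cong)
    (auto simp: dual_graph_def crossing_weight_def corner_def corner_direction_def signed_def)

text \<open>
  Both cases in the definition of a coloring become the same equation, since in and out exchange their
  sides when the sign of the crossing changes.
\<close>

lemma coloring_corners:
  "coloring star dot (dual_graph L) f \<longleftrightarrow>
    (\<forall>c\<in>crossings L. f (corner L c True False) =
       star (f (corner L c False True)) (dot (f (corner L c True True)) (f (corner L c False False))))"
  unfolding coloring_def dual_graph_def
  by (auto simp: corner_def corner_direction_def split: if_splits)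

section \<open>Transport of a picture by a chart\<close>

text \<open>
  The factor is the determinant of \<open>A\<close>.
\<close>

lemma det2_linear_image:
  assumes "linear A"
  shows "det2 (A a) (A b) = det2 (A 1) (A \<i>) * det2 a b"
proof -
  have "A x = Re x *\<^sub>R A 1 + Im x *\<^sub>R A \<i>" for x
  proof -
    have "x = Re x *\<^sub>R 1 + Im x *\<^sub>R \<i>" by (simp add: complex_eq_iff)
    then have "A x = A (Re x *\<^sub>R 1 + Im x *\<^sub>R \<i>)" by (rule arg_cong)
    also have "\<dots> = Re x *\<^sub>R A 1 + Im x *\<^sub>R A \<i>"
      unfolding linear_add[OF assms] linear_cmul[OF assms] ..
    finally show ?thesis .
  qed
  from this[of a] this[of b] show ?thesis
    by (simp only: det2_def plus_complex.simps scaleR_complex.simps) (simp add: algebra_simps)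
qed

lemma sgn_det2_sgn:
  assumes "u \<noteq> 0"
  shows "sgn (det2 (sgn u) w) = sgn (det2 u w)"
  using assms by (simp add: sgn_div_norm[of u] det2_scaleR_left sgn_mult)

lemma open_sq: "open sq"
proof -
  have eq: "sq = box (Complex (-1) (-1)) (Complex 1 1)"
    by (auto simp: sq_def box_complex_eq abs_less_iff)
  show ?thesis unfolding eq by (rule open_box)
qed

lemma compact_csq: "compact csq"
proof -
  have eq: "csq = cbox (Complex (-1) (-1)) (Complex 1 1)"
    by (auto simp: csq_def cbox_complex_eq abs_le_iff)
  show ?thesis unfolding eq by (rule compact_cbox)
qed

lemma sq_subset_csq: "sq \<subseteq> csq"
  by (auto simp: sq_def csq_def)

text \<open>
  A link diagram that looks like the picture \<open>T\<close> inside the disc \<open>U\<close>. Points of the square serve as names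
  for regions of the diagram: \<open>face q\<close> below is the region that contains the image of \<open>q\<close>.
\<close>

locale disc_picture =
  fixes L T :: strands and h :: "complex \<Rightarrow> complex" and U :: "complex set"
  assumes diagram: "oriented_link_diagram L"
    and looks: "looks_like L h U T"
    and params: "params T = {-1<..<1}"
    and inside: "\<And>k s. k < num T \<Longrightarrow> s \<in> {-1<..<1} \<Longrightarrow> curve T k s \<in> sq"
    and ends: "endpoints T \<subseteq> csq"
begin

abbreviation hT :: strands where "hT \<equiv> T\<lparr>curve := (\<lambda>k s. h (curve T k s))\<rparr>"

lemma chart: "chart h"
  and U_eq: "U = h ` sq"
  and trace_inside: "{p \<in> oriented_trace L. fst p \<in> U} = oriented_trace hT"
  and crossings_inside: "{c \<in> crossings L. fst c \<in> U} = crossings hT"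
  and boundary: "underlying L \<inter> h ` (csq - sq) = h ` endpoints T"
  using looks unfolding looks_like_def Let_def by simp_all

lemma inj: "inj_on h csq" and cont: "continuous_on csq h"
  using chart by (auto simp: chart_def)

lemma h_eq_iff: "a \<in> csq \<Longrightarrow> b \<in> csq \<Longrightarrow> h a = h b \<longleftrightarrow> a = b"
  using inj by (auto dest: inj_onD)

abbreviation Dh :: "complex \<Rightarrow> complex \<Rightarrow> complex" where
  "Dh p \<equiv> frechet_derivative h (at p)"

lemma Dh:
  assumes "p \<in> sq"
  shows "(h has_derivative Dh p) (at p)" and "det2 (Dh p 1) (Dh p \<i>) > 0"
proof -
  from chart[unfolded chart_def, THEN conjunct2, THEN conjunct2]
  obtain h' :: "complex \<Rightarrow> complex \<Rightarrow>\<^sub>L complex" where "continuous_on sq h' \<and>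
     (\<forall>z\<in>sq. (h has_derivative blinfun_apply (h' z)) (at z) \<and>
        det2 (blinfun_apply (h' z) 1) (blinfun_apply (h' z) \<i>) > 0)" ..
  from this[THEN conjunct2, rule_format, OF assms]
  have *: "(h has_derivative blinfun_apply (h' p)) (at p)"
      "det2 (blinfun_apply (h' p) 1) (blinfun_apply (h' p) \<i>) > 0" by simp_all
  have "Dh p = blinfun_apply (h' p)" using frechet_derivative_at[OF *(1)] by simp
  then show "(h has_derivative Dh p) (at p)" "det2 (Dh p 1) (Dh p \<i>) > 0" using * by simp_all
qed

text \<open>
  Charts preserve the orientation, so they preserve sides and the signs of crossings.
\<close>

lemma sgn_det2_Dh:
  assumes "p \<in> sq"
  shows "sgn (det2 (Dh p a) (Dh p b)) = sgn (det2 a b)"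
proof -
  have "det2 (Dh p a) (Dh p b) = det2 (Dh p 1) (Dh p \<i>) * det2 a b"
    by (rule det2_linear_image[OF has_derivative_linear[OF Dh(1)[OF assms]]])
  then show ?thesis using Dh(2)[OF assms] by (simp add: sgn_mult)
qed

lemma Dh_nonzero: "p \<in> sq \<Longrightarrow> a \<noteq> 0 \<Longrightarrow> Dh p a \<noteq> 0"
proof
  assume p: "p \<in> sq" and a: "a \<noteq> 0" and 0: "Dh p a = 0"
  have "sgn (det2 a (\<i> * a)) = 0" using sgn_det2_Dh[OF p, of a "\<i> * a"] 0 by simp
  then have "Re a * Re a + Im a * Im a = 0" by (simp add: sgn_0_0 det2_def)
  then show False using a by (simp add: complex_eq_iff add_nonneg_eq_0_iff)
qed

lemma Dh_curve:
  assumes "(\<gamma> has_vector_derivative d) (at t)" "\<gamma> t = p" "p \<in> sq"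
  shows "((\<lambda>t. h (\<gamma> t)) has_vector_derivative Dh p d) (at t)"
proof -
  have "(h has_derivative Dh p) (at (\<gamma> t) within \<gamma> ` UNIV)"
    using Dh(1)[OF assms(3)] assms(2) by (auto intro: has_derivative_at_withinI)
  from vector_derivative_diff_chain_within[OF assms(1) this] show ?thesis by (simp add: o_def)
qed

lemma h_avoids:
  assumes q: "q \<in> csq" "q \<notin> underlying T" "q \<notin> endpoints T"
  shows "h q \<notin> underlying L"
proof
  assume hq: "h q \<in> underlying L"
  show False
  proof (cases "q \<in> sq")
    case True
    obtain i s where "h q = curve L i s" "(i, s) \<in> places L"
      using hq by (auto simp: underlying_def)
    moreover have "h q \<in> U" using True by (simp add: U_eq)
    ultimately have "(h q, tangent L i s) \<in> {p \<in> oriented_trace L. fst p \<in> U}"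
      by (auto simp: oriented_trace_def)
    then obtain k x where kx: "k < num T" "x \<in> {-1<..<1}" "h q = h (curve T k x)"
      unfolding trace_inside by (auto simp: oriented_trace_def places_def params)
    then have "q = curve T k x"
      using inside[OF kx(1,2)] sq_subset_csq q(1) h_eq_iff[of q "curve T k x"] by auto
    then show False using q(2) kx by (auto simp: underlying_def places_def params)
  next
    case False
    then have "h q \<in> h ` endpoints T" using hq q(1) boundary by blast
    then obtain e where "e \<in> endpoints T" "h q = h e" by blast
    then show False using q ends h_eq_iff[of q e] by auto
  qed
qed

definition face :: "complex \<Rightarrow> complex set" where
  "face q = connected_component_set (- underlying L) (h q)"

lemma face_region:
  assumes "q \<in> csq" "q \<notin> underlying T" "q \<notin> endpoints T"
  shows "face q \<in> regions L" "h q \<in> face q"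
  using h_avoids[OF assms] by (auto simp: face_def intro: region_component)

lemma face_constant:
  assumes S: "connected S" "S \<subseteq> csq - underlying T - endpoints T" and q: "q \<in> S" "q' \<in> S"
  shows "face q = face q'"
  unfolding face_def
proof (rule connected_component_eq)
  have "connected (h ` S)"
    using S cont by (intro connected_continuous_image) (auto elim: continuous_on_subset)
  moreover have "h ` S \<subseteq> - underlying L" using S(2) h_avoids by blast
  ultimately show "h q \<in> connected_component_set (- underlying L) (h q')"
    using q unfolding connected_component_def mem_Collect_eq by blast
qed

text \<open>
  The chart maps the ray from \<open>p\<close> in direction \<open>d\<close> to a curve with derivative \<open>Dh p d\<close>, to which the
  description of corners by curves applies. Thus corners can be computed in the picture.
\<close>

lemma corner_face:
  assumes p: "p \<in> sq" and c: "(h p, sgn (Dh p a), sgn (Dh p b)) \<in> crossings L"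
    and d: "sgn (det2 a d) = side l" "sgn (det2 b d) = side m"
  shows "\<forall>\<^sub>F t in at_right (0::real). corner L (h p, sgn (Dh p a), sgn (Dh p b)) l m = face (p + t *\<^sub>R d)"
proof -
  have "side l \<noteq> 0" "side m \<noteq> 0" by (simp_all add: side_def)
  then have "det2 a d \<noteq> 0" "det2 b d \<noteq> 0" using d by auto
  then have "a \<noteq> 0" "b \<noteq> 0" by auto
  then have nz: "Dh p a \<noteq> 0" "Dh p b \<noteq> 0" using Dh_nonzero[OF p] by simp_all
  have "((\<lambda>t. p + t *\<^sub>R d) has_vector_derivative d) (at 0)"
    by (auto intro!: derivative_eq_intros)
  then have "((\<lambda>t. h (p + t *\<^sub>R d)) has_vector_derivative Dh p d) (at 0)"
    using p by (intro Dh_curve) simp_all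
  then have der: "((\<lambda>t. h (p + t *\<^sub>R d)) has_vector_derivative Dh p d) (at_right 0)"
    by (rule has_vector_derivative_at_within)
  have "sgn (det2 (sgn (Dh p a)) (Dh p d)) = side l" "sgn (det2 (sgn (Dh p b)) (Dh p d)) = side m"
    unfolding sgn_det2_sgn[OF nz(1)] sgn_det2_sgn[OF nz(2)] sgn_det2_Dh[OF p] by (fact d)+
  from corner_curve[OF diagram c this der] show ?thesis
    unfolding face_def by (rule eventually_mono) auto
qed

end

section \<open>Pictures made of graphs\<close>

text \<open>
  In the second and third move all strands are graphs \<open>x = g(y)\<close>, so that the faces of the picture are
  governed by the sides of the graphs on which points lie.
\<close>

definition graph_picture :: "(real \<Rightarrow> real) list \<Rightarrow> (nat \<Rightarrow> real) \<Rightarrow> (nat \<Rightarrow> real) \<Rightarrow> strands" where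
  "graph_picture gs \<epsilon> \<eta> = picture (map (\<lambda>g s. Complex (g s) s) gs) \<epsilon> (\<lambda>k s. \<eta> k)"

definition off_graphs :: "(real \<Rightarrow> real) list \<Rightarrow> complex \<Rightarrow> bool" where
  "off_graphs gs q \<longleftrightarrow> (\<forall>g\<in>set gs. Re q \<noteq> g (Im q))"

text \<open>
  The entries are \<open>True\<close> to the geometric left of the graphs. This is also the left side with respect to the
  orientation exactly for the strands that run upward.
\<close>

definition pattern :: "(real \<Rightarrow> real) list \<Rightarrow> complex \<Rightarrow> bool list" where
  "pattern gs q = map (\<lambda>g. Re q < g (Im q)) gs"

text \<open>
  Unordered pairs of strands that meet at ordinate \<open>y\<close>; which of them is the upper one is decided separately.
\<close>

definition graph_crossings :: "(real \<Rightarrow> real) list \<Rightarrow> (nat \<times> nat \<times> real) set" where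
  "graph_crossings gs = {(i, j, y). i < j \<and> j < length gs \<and> \<bar>y\<bar> < 1 \<and> (gs ! i) y = (gs ! j) y}"

definition cell :: "(real \<Rightarrow> real) list \<Rightarrow> real set \<Rightarrow> bool list \<Rightarrow> complex set" where
  "cell gs I s = {q. \<bar>Re q\<bar> < 1 \<and> Im q \<in> I \<and> off_graphs gs q \<and> pattern gs q = s}"

lemma continuous_on_Max_insert:
  fixes f :: "'k \<Rightarrow> real \<Rightarrow> real"
  assumes "finite K" "\<And>k. k \<in> K \<Longrightarrow> continuous_on A (f k)"
  shows "continuous_on A (\<lambda>y. Max (insert c ((\<lambda>k. f k y) ` K)))"
  using assms
proof (induction K rule: finite_induct)
  case (insert x F)
  have "Max (insert c ((\<lambda>k. f k y) ` insert x F)) = max (f x y) (Max (insert c ((\<lambda>k. f k y) ` F)))" for y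
    using insert.hyps(1) by (simp add: insert_commute[of c])
  then show ?case using insert by (auto intro!: continuous_on_max)
qed simp

text \<open>
  The region is the image of a rectangle, each horizontal slice being parametrized affinely.
\<close>

lemma connected_between_graphs:
  fixes lo up :: "real \<Rightarrow> real"
  assumes "convex J" "continuous_on J lo" "continuous_on J up" "\<And>y. y \<in> J \<Longrightarrow> lo y < up y"
  shows "connected {q. Im q \<in> J \<and> lo (Im q) < Re q \<and> Re q < up (Im q)}"
proof -
  define \<Phi> where "\<Phi> = (\<lambda>(\<theta>::real, y). Complex (lo y + \<theta> * (up y - lo y)) y)"
  have "connected ({0<..<1::real} \<times> J)"
    using assms(1) by (intro connected_Times) (auto intro: convex_connected)
  moreover have "continuous_on ({0<..<1::real} \<times> J) \<Phi>"
    unfolding \<Phi>_def case_prod_beta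
    by (intro continuous_on_Complex continuous_intros
        continuous_on_compose2[OF assms(2)] continuous_on_compose2[OF assms(3)]) auto
  ultimately have "connected (\<Phi> ` ({0<..<1} \<times> J))" by (rule connected_continuous_image[rotated])
  also have "\<Phi> ` ({0<..<1} \<times> J) = {q. Im q \<in> J \<and> lo (Im q) < Re q \<and> Re q < up (Im q)}"
  proof (intro equalityI subsetI)
    fix q assume "q \<in> \<Phi> ` ({0<..<1} \<times> J)"
    then obtain \<theta> y where y: "0 < \<theta>" "\<theta> < 1" "y \<in> J" "q = Complex (lo y + \<theta> * (up y - lo y)) y"
      by (auto simp: \<Phi>_def)
    have "\<theta> * (up y - lo y) < 1 * (up y - lo y)" "0 < \<theta> * (up y - lo y)"
      using y assms(4)[OF y(3)] by (auto intro!: mult_strict_right_mono simp del: mult_1)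
    then show "q \<in> {q. Im q \<in> J \<and> lo (Im q) < Re q \<and> Re q < up (Im q)}" using y by simp
  next
    fix q assume q: "q \<in> {q. Im q \<in> J \<and> lo (Im q) < Re q \<and> Re q < up (Im q)}"
    define \<theta> where "\<theta> = (Re q - lo (Im q)) / (up (Im q) - lo (Im q))"
    have "0 < \<theta>" "\<theta> < 1" "q = \<Phi> (\<theta>, Im q)"
      using q by (auto simp: \<theta>_def \<Phi>_def complex_eq_iff)
    then show "q \<in> \<Phi> ` ({0<..<1} \<times> J)" using q by auto
  qed
  finally show ?thesis .
qed

text \<open>
  The points with prescribed sides form the region between the maximum of the graphs on their left and
  the minimum of the graphs on their right, over those \<open>y\<close> for which the former is less than the latter. The
  convexity hypothesis makes the set of these \<open>y\<close> an interval. The strip \<open>\<bar>Re q\<bar> < 1\<close> contributes the constant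
  bounds \<open>-1\<close> and \<open>1\<close>.
\<close>

lemma connected_cell:
  assumes I: "convex I" "I \<subseteq> {-1..1}" and s: "length s = length gs"
    and cont: "\<And>g. g \<in> set gs \<Longrightarrow> continuous_on I g"
    and bound: "\<And>g y. g \<in> set gs \<Longrightarrow> y \<in> I \<Longrightarrow> \<bar>g y\<bar> < 1"
    and conv: "\<And>i j. i < length gs \<Longrightarrow> j < length gs \<Longrightarrow> \<not> s ! i \<Longrightarrow> s ! j \<Longrightarrow>
        convex {y \<in> I. (gs ! i) y < (gs ! j) y}"
  shows "connected (cell gs I s)"
proof -
  let ?n = "length gs"
  define N where "N = {k. k < ?n \<and> \<not> s ! k}"
  define P where "P = {k. k < ?n \<and> s ! k}"
  define lo where "lo = (\<lambda>y. Max (insert (-1) ((\<lambda>k. (gs ! k) y) ` N)))"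
  define up where "up = (\<lambda>y. - Max (insert (-1) ((\<lambda>k. - (gs ! k) y) ` P)))"
  define J where "J = {y \<in> I. lo y < up y}"
  have fin: "finite N" "finite P" by (auto simp: N_def P_def)
  have lo: "lo y < x \<longleftrightarrow> -1 < x \<and> (\<forall>k\<in>N. (gs ! k) y < x)" for x y
    unfolding lo_def using fin by (subst Max_less_iff) auto
  have up: "x < up y \<longleftrightarrow> x < 1 \<and> (\<forall>k\<in>P. x < (gs ! k) y)" for x y
  proof -
    have "x < up y \<longleftrightarrow> Max (insert (-1) ((\<lambda>k. - (gs ! k) y) ` P)) < - x"
      unfolding up_def by linarith
    also have "\<dots> \<longleftrightarrow> x < 1 \<and> (\<forall>k\<in>P. x < (gs ! k) y)"
      using fin by (subst Max_less_iff) auto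
    finally show ?thesis .
  qed
  have "J = I \<inter> (\<Inter>i\<in>N. \<Inter>j\<in>P. {y \<in> I. (gs ! i) y < (gs ! j) y})"
  proof -
    have "lo y < up y \<longleftrightarrow> (\<forall>i\<in>N. \<forall>j\<in>P. (gs ! i) y < (gs ! j) y)" if y: "y \<in> I" for y
    proof -
      have "-1 < (gs ! k) y" "(gs ! k) y < 1" if "k < ?n" for k
        using bound[of "gs ! k" y] that y by (auto simp: abs_less_iff)
      then have "-1 < up y" "\<forall>i\<in>N. (gs ! i) y < 1" by (auto simp: up P_def N_def)
      then show ?thesis unfolding lo up by auto
    qed
    then show ?thesis by (auto simp: J_def)
  qed
  moreover have "convex {y \<in> I. (gs ! i) y < (gs ! j) y}" if "i \<in> N" "j \<in> P" for i j
    using conv that by (auto simp: N_def P_def)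
  ultimately have "convex J" using I(1) by (auto intro!: convex_Int convex_INT)
  moreover have "continuous_on I lo"
    unfolding lo_def using fin cont by (intro continuous_on_Max_insert) (auto simp: N_def)
  moreover have "continuous_on I up"
    unfolding up_def using fin cont
    by (intro continuous_on_minus continuous_on_Max_insert) (auto simp: P_def intro!: continuous_on_minus)
  moreover have "J \<subseteq> I" by (auto simp: J_def)
  ultimately have "connected {q. Im q \<in> J \<and> lo (Im q) < Re q \<and> Re q < up (Im q)}"
    by (intro connected_between_graphs) (auto simp: J_def intro: continuous_on_subset)
  also have "{q. Im q \<in> J \<and> lo (Im q) < Re q \<and> Re q < up (Im q)} = cell gs I s"
  proof (intro set_eqI)
    fix q
    have off: "off_graphs gs q \<and> pattern gs q = s \<longleftrightarrow>
        (\<forall>k<?n. if s ! k then Re q < (gs ! k) (Im q) else (gs ! k) (Im q) < Re q)"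
      using s unfolding off_graphs_def pattern_def list_eq_iff_nth_eq all_set_conv_all_nth
      by (auto split: if_splits) (metis linorder_neqE_linordered_idom order_less_asym)+
    have "q \<in> cell gs I s \<longleftrightarrow> Im q \<in> I \<and> lo (Im q) < Re q \<and> Re q < up (Im q)"
      unfolding cell_def mem_Collect_eq off lo up abs_less_iff by (auto simp: N_def P_def split: if_splits)
    then show "q \<in> {q. Im q \<in> J \<and> lo (Im q) < Re q \<and> Re q < up (Im q)} \<longleftrightarrow> q \<in> cell gs I s"
      by (auto simp: J_def)
  qed
  finally show ?thesis .
qed

lemma eventually_sign_right:
  fixes F :: "real \<Rightarrow> real"
  assumes "(F has_real_derivative \<sigma>) (at 0)" "F 0 = 0" "\<sigma> \<noteq> 0"
  shows "\<forall>\<^sub>F t in at_right 0. F t \<noteq> 0 \<and> (F t > 0 \<longleftrightarrow> \<sigma> > 0)"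
proof (cases "\<sigma> > 0")
  case True
  then obtain d where "d > 0" "\<forall>h>0. h < d \<longrightarrow> F 0 < F (0 + h)"
    using DERIV_pos_inc_right[OF assms(1)] by blast
  then show ?thesis using True assms(2)
    unfolding eventually_at_right_field by (intro exI[of _ d]) force
next
  case False
  then obtain d where "d > 0" "\<forall>h>0. h < d \<longrightarrow> F 0 > F (0 + h)"
    using DERIV_neg_dec_right[OF assms(1)] assms(3) by force
  then show ?thesis using False assms(2)
    unfolding eventually_at_right_field by (intro exI[of _ d]) force
qed

definition upper :: "(nat \<Rightarrow> real) \<Rightarrow> nat \<Rightarrow> nat \<Rightarrow> nat" where
  "upper \<eta> i j = (if \<eta> j < \<eta> i then i else j)"

definition lower :: "(nat \<Rightarrow> real) \<Rightarrow> nat \<Rightarrow> nat \<Rightarrow> nat" where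
  "lower \<eta> i j = (if \<eta> j < \<eta> i then j else i)"

text \<open>
  Let \<open>C\<close> assign colors to patterns of sides. The four corners at a crossing of \<open>u\<close> and \<open>l\<close> have the pattern of
  the crossing point itself except at \<open>u\<close> and \<open>l\<close>, where it is prescribed by the sides \<open>b\<close> and \<open>c\<close> relative to
  the orientations.
\<close>

definition corner_color ::
    "(nat \<Rightarrow> real) \<Rightarrow> (bool list \<Rightarrow> 'x) \<Rightarrow> bool list \<Rightarrow> nat \<Rightarrow> nat \<Rightarrow> bool \<Rightarrow> bool \<Rightarrow> 'x" where
  "corner_color \<epsilon> C P u l b c = C (P[u := (b = (\<epsilon> u = 1)), l := (c = (\<epsilon> l = 1))])"

definition pair_weight where
  "pair_weight \<phi> \<epsilon> \<eta> C P i j = (let K = corner_color \<epsilon> C P (upper \<eta> i j) (lower \<eta> i j) in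
     \<phi> (K False True) (K True True) (K False False))"

definition pair_relation where
  "pair_relation star dot \<epsilon> \<eta> C P i j \<longleftrightarrow>
     (let K = corner_color \<epsilon> C P (upper \<eta> i j) (lower \<eta> i j) in
       K True False = star (K False True) (dot (K True True) (K False False)))"

text \<open>
  The last assumption says that different crossings of the picture have different ordinates; in particular
  there are no triple points.
\<close>

locale graph_disc =
  fixes L :: strands and h :: "complex \<Rightarrow> complex" and U :: "complex set"
    and gs :: "(real \<Rightarrow> real) list" and dg :: "nat \<Rightarrow> real \<Rightarrow> real" and \<epsilon> \<eta> :: "nat \<Rightarrow> real"
  assumes diagram: "oriented_link_diagram L"
    and looks: "looks_like L h U (graph_picture gs \<epsilon> \<eta>)"
    and deriv: "\<And>k y. k < length gs \<Longrightarrow> (gs ! k has_real_derivative dg k y) (at y)"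
    and bound: "\<And>g y. g \<in> set gs \<Longrightarrow> \<bar>y\<bar> \<le> 1 \<Longrightarrow> \<bar>g y\<bar> < 1"
    and orient: "\<And>k. k < length gs \<Longrightarrow> \<epsilon> k \<in> {1, -1}"
    and heights: "inj_on \<eta> {..<length gs}"
    and levels: "inj_on (\<lambda>(i, j, y). y) (graph_crossings gs)"
begin

abbreviation T where "T \<equiv> graph_picture gs \<epsilon> \<eta>"

lemma num_T: "num T = length gs" and params_T: "params T = {-1<..<1}" and height_T: "height T k s = \<eta> k"
  by (simp_all add: graph_picture_def picture_def)

lemma curve_T: "k < length gs \<Longrightarrow> curve T k s = Complex ((gs ! k) (\<epsilon> k * s)) (\<epsilon> k * s)"
  by (simp add: graph_picture_def picture_def)

lemma orient_abs: "k < length gs \<Longrightarrow> \<bar>\<epsilon> k * s\<bar> = \<bar>s\<bar>" and orient_sq: "k < length gs \<Longrightarrow> \<epsilon> k * (\<epsilon> k * s) = s"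
  using orient[of k] by auto

sublocale disc_picture L T h U
proof
  show "curve T k s \<in> sq" if "k < num T" "s \<in> {-1<..<1}" for k s
  proof -
    have "k < length gs" "\<bar>s\<bar> < 1" using that by (auto simp: num_T abs_less_iff)
    then show ?thesis
      using bound[of "gs ! k" "\<epsilon> k * s"] orient_abs[of k s] by (simp add: curve_T sq_def)
  qed
  show "endpoints T \<subseteq> csq"
  proof
    fix e assume "e \<in> endpoints T"
    then obtain k s where k: "k < length gs" and "s \<in> {-1, 1}" and e: "e = curve T k s"
      unfolding endpoints_def num_T by blast
    then have "\<bar>s\<bar> = 1" by auto
    then show "e \<in> csq"
      using k e bound[of "gs ! k" "\<epsilon> k * s"] orient_abs[of k s] by (simp add: curve_T csq_def)
  qed
qed (use diagram looks params_T in auto)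

lemma off_graphs_avoids: "off_graphs gs q \<Longrightarrow> q \<notin> underlying T" "off_graphs gs q \<Longrightarrow> q \<notin> endpoints T"
  by (auto simp: off_graphs_def underlying_def endpoints_def places_def num_T curve_T)

lemma cell_face:
  assumes "connected (cell gs I s)" "I \<subseteq> {-1..1}" "q \<in> cell gs I s" "q' \<in> cell gs I s"
  shows "face q = face q'"
  using assms(2) by (intro face_constant[OF assms(1) _ assms(3,4)])
    (auto simp: cell_def csq_def abs_le_iff off_graphs_avoids dest!: subsetD)

definition picture_tangent :: "nat \<Rightarrow> real \<Rightarrow> complex" where
  "picture_tangent k y = \<epsilon> k *\<^sub>R Complex (dg k y) 1"

definition crossing_at :: "nat \<Rightarrow> nat \<Rightarrow> real \<Rightarrow> crossing" where
  "crossing_at u l y = (let p = Complex ((gs ! u) y) y in (h p, sgn (Dh p (picture_tangent u y)), sgn (Dh p (picture_tangent l y))))"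

lemma curve_in_sq: "k < length gs \<Longrightarrow> \<bar>y\<bar> < 1 \<Longrightarrow> Complex ((gs ! k) y) y \<in> sq"
  using bound[of "gs ! k" y] by (simp add: sq_def)

lemma tangent_hT:
  assumes "k < length gs" "\<bar>s\<bar> < 1"
  shows "tangent hT k s = sgn (Dh (curve T k s) (picture_tangent k (\<epsilon> k * s)))"
proof -
  have g: "(gs ! k has_vector_derivative dg k (\<epsilon> k * s)) (at (\<epsilon> k * s))"
    using deriv[OF assms(1)] by (simp add: has_real_derivative_iff_has_vector_derivative)
  have l: "((\<lambda>s. \<epsilon> k * s) has_vector_derivative \<epsilon> k) (at s)"
    by (auto intro!: derivative_eq_intros)
  have "((\<lambda>s. (gs ! k) (\<epsilon> k * s)) has_vector_derivative (\<epsilon> k * dg k (\<epsilon> k * s))) (at s)"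
    using vector_diff_chain_at[OF l g] by (simp add: o_def)
  then have "((\<lambda>s. Complex ((gs ! k) (\<epsilon> k * s)) (\<epsilon> k * s)) has_vector_derivative
      Complex (\<epsilon> k * dg k (\<epsilon> k * s)) (\<epsilon> k)) (at s)"
    using l by (simp add: has_vector_derivative_complex_iff has_real_derivative_iff_has_vector_derivative)
  then have "(curve T k has_vector_derivative picture_tangent k (\<epsilon> k * s)) (at s)"
  proof -
    have "curve T k = (\<lambda>s. Complex ((gs ! k) (\<epsilon> k * s)) (\<epsilon> k * s))" using curve_T[OF assms(1)] by auto
    moreover have "picture_tangent k (\<epsilon> k * s) = Complex (\<epsilon> k * dg k (\<epsilon> k * s)) (\<epsilon> k)"
      by (simp add: picture_tangent_def complex_eq_iff)
    ultimately show ?thesis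
      using \<open>((\<lambda>s. Complex _ _) has_vector_derivative _) (at s)\<close> by simp
  qed
  then have "((\<lambda>s. h (curve T k s)) has_vector_derivative Dh (curve T k s) (picture_tangent k (\<epsilon> k * s))) (at s)"
    by (rule Dh_curve) (use assms inside[of k s] num_T in \<open>auto simp: abs_less_iff\<close>)
  then show ?thesis unfolding tangent_def by (simp add: vector_derivative_at)
qed

lemma crossings_hT:
  "crossings hT = {crossing_at u l y | u l y. u < length gs \<and> l < length gs \<and> u \<noteq> l \<and>
     \<bar>y\<bar> < 1 \<and> (gs ! u) y = (gs ! l) y \<and> \<eta> l < \<eta> u}" (is "_ = ?R")
proof (intro equalityI subsetI)
  fix c assume "c \<in> crossings hT"
  then obtain u s l t where c: "c = (h (curve T u s), tangent hT u s, tangent hT l t)"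
    and *: "u < length gs" "l < length gs" "\<bar>s\<bar> < 1" "\<bar>t\<bar> < 1" "(u, s) \<noteq> (l, t)"
      "h (curve T u s) = h (curve T l t)" "\<eta> l < \<eta> u"
    by (auto simp: crossings_def places_def num_T params_T height_T)
  have "curve T u s = curve T l t"
  proof -
    have "curve T u s \<in> csq" "curve T l t \<in> csq"
      using * inside[of u s] inside[of l t] sq_subset_csq by (auto simp: num_T abs_less_iff)
    then show ?thesis using *(6) h_eq_iff by blast
  qed
  then have y: "\<epsilon> u * s = \<epsilon> l * t" and "(gs ! u) (\<epsilon> u * s) = (gs ! l) (\<epsilon> l * t)"
    using * by (auto simp: curve_T)
  moreover have "c = crossing_at u l (\<epsilon> u * s)"
    using \<open>curve T u s = curve T l t\<close> y
    by (simp add: c tangent_hT * crossing_at_def Let_def) (simp add: curve_T * y)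
  moreover have "\<bar>\<epsilon> u * s\<bar> < 1" using *(3) orient_abs[OF *(1)] by simp
  ultimately show "c \<in> ?R" using * by fastforce
next
  fix c assume "c \<in> ?R"
  then obtain u l y where c: "c = crossing_at u l y" and *: "u < length gs" "l < length gs" "u \<noteq> l"
     "\<bar>y\<bar> < 1" "(gs ! u) y = (gs ! l) y" "\<eta> l < \<eta> u" by blast
  define s where "s = \<epsilon> u * y"
  define t where "t = \<epsilon> l * y"
  have y: "\<epsilon> u * s = y" "\<epsilon> l * t = y" using orient_sq * by (simp_all add: s_def t_def)
  have st: "\<bar>s\<bar> < 1" "\<bar>t\<bar> < 1" using orient_abs * by (simp_all add: s_def t_def)
  have e: "curve T u s = Complex ((gs ! u) y) y" "curve T l t = Complex ((gs ! u) y) y"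
    using * y by (simp_all add: curve_T)
  have "c = (curve hT u s, tangent hT u s, tangent hT l t)"
    using e y by (simp add: c crossing_at_def Let_def tangent_hT * st)
  moreover have "(u, s) \<in> places hT" "(l, t) \<in> places hT"
    using * st by (auto simp: places_def num_T params_T abs_less_iff)
  moreover have "curve hT u s = curve hT l t" "height hT u s > height hT l t"
    using e * by (simp_all add: height_T)
  ultimately show "c \<in> crossings hT" using *(3) unfolding crossings_def by blast
qed

lemma crossings_inside_graph:
  "{c \<in> crossings L. fst c \<in> U} = (\<lambda>(i, j, y). crossing_at (upper \<eta> i j) (lower \<eta> i j) y) ` graph_crossings gs"
proof -
  have "crossings hT = (\<lambda>(i, j, y). crossing_at (upper \<eta> i j) (lower \<eta> i j) y) ` graph_crossings gs" (is "_ = ?R")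
  proof (intro equalityI subsetI)
    fix c assume "c \<in> crossings hT"
    then obtain u l y where c: "c = crossing_at u l y" and *: "u < length gs" "l < length gs" "u \<noteq> l"
       "\<bar>y\<bar> < 1" "(gs ! u) y = (gs ! l) y" "\<eta> l < \<eta> u" unfolding crossings_hT by blast
    show "c \<in> ?R"
    proof (cases "u < l")
      case True
      then have "(u, l, y) \<in> graph_crossings gs" using * by (simp add: graph_crossings_def)
      then show ?thesis using * c by (force simp: upper_def lower_def)
    next
      case False
      then have "(l, u, y) \<in> graph_crossings gs" using * by (simp add: graph_crossings_def)
      then show ?thesis using * c by (force simp: upper_def lower_def)
    qed
  next
    fix c assume "c \<in> ?R"
    then obtain i j y where c: "c = crossing_at (upper \<eta> i j) (lower \<eta> i j) y"
      and *: "i < j" "j < length gs" "\<bar>y\<bar> < 1" "(gs ! i) y = (gs ! j) y"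
      by (auto simp: graph_crossings_def)
    have "\<eta> i \<noteq> \<eta> j" using heights * by (auto dest: inj_onD)
    then show "c \<in> crossings hT"
      unfolding crossings_hT c mem_Collect_eq using *
      by (intro exI[of _ "upper \<eta> i j"] exI[of _ "lower \<eta> i j"] exI[of _ y]) (auto simp: upper_def lower_def)
  qed
  then show ?thesis by (simp add: crossings_inside)
qed

lemma sum_crossings_inside:
  "(\<Sum>c\<in>{c \<in> crossings L. fst c \<in> U}. F c) =
   (\<Sum>(i, j, y)\<in>graph_crossings gs. F (crossing_at (upper \<eta> i j) (lower \<eta> i j) y))"
proof -
  have "inj_on (\<lambda>(i, j, y). crossing_at (upper \<eta> i j) (lower \<eta> i j) y) (graph_crossings gs)"
  proof (rule inj_onI)
    fix a b
    assume a: "a \<in> graph_crossings gs" and b: "b \<in> graph_crossings gs"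
      and eq: "(\<lambda>(i, j, y). crossing_at (upper \<eta> i j) (lower \<eta> i j) y) a =
        (\<lambda>(i, j, y). crossing_at (upper \<eta> i j) (lower \<eta> i j) y) b"
    obtain i j y i' j' y' where ab: "a = (i, j, y)" "b = (i', j', y')" using prod_cases3 by metis
    note * = a[unfolded ab] b[unfolded ab] eq[unfolded ab prod.case]
    have "upper \<eta> i j < length gs" "upper \<eta> i' j' < length gs" "\<bar>y\<bar> < 1" "\<bar>y'\<bar> < 1"
      using *(1,2) by (auto simp: graph_crossings_def upper_def)
    then have "Complex ((gs ! upper \<eta> i j) y) y \<in> csq" "Complex ((gs ! upper \<eta> i' j') y') y' \<in> csq"
      using curve_in_sq sq_subset_csq by blast+
    then have "y = y'" using *(3) h_eq_iff by (auto simp: crossing_at_def Let_def)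
    then show "a = b" using inj_onD[OF levels _ a b] by (simp add: ab)
  qed
  then show ?thesis
    unfolding crossings_inside_graph by (subst sum.reindex) (auto simp: case_prod_unfold)
qed

lemma crossing_at_in_crossings:
  assumes "(i, j, y) \<in> graph_crossings gs"
  shows "crossing_at (upper \<eta> i j) (lower \<eta> i j) y \<in> crossings L"
  using assms crossings_inside_graph by force

lemma det2_picture_tangent: "det2 (picture_tangent k y) d = \<epsilon> k * (dg k y * Im d - Re d)"
  by (simp add: picture_tangent_def det2_def algebra_simps)

text \<open>
  Strands that are tangent in the picture would have tangent images, but crossings of a link diagram are
  transverse.
\<close>

lemma slopes_differ:
  assumes "(i, j, y) \<in> graph_crossings gs"
  shows "dg (upper \<eta> i j) y \<noteq> dg (lower \<eta> i j) y"
proof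
  assume eq: "dg (upper \<eta> i j) y = dg (lower \<eta> i j) y"
  let ?u = "upper \<eta> i j" and ?l = "lower \<eta> i j"
  have ij: "?u < length gs" "\<bar>y\<bar> < 1"
    using assms by (auto simp: graph_crossings_def upper_def lower_def)
  define p where "p = Complex ((gs ! ?u) y) y"
  have p: "p \<in> sq" using curve_in_sq ij by (simp add: p_def)
  have v0: "Dh p (picture_tangent ?u y) \<noteq> 0" 
    using crossing_tangents[OF diagram crossing_at_in_crossings[OF assms, unfolded crossing_at_def Let_def]]
    by (auto simp: p_def)
  have "sgn (det2 (sgn (Dh p (picture_tangent ?u y))) (sgn (Dh p (picture_tangent ?l y)))) \<noteq> 0"
    using crossing_tangents(3)[OF diagram crossing_at_in_crossings[OF assms, unfolded crossing_at_def Let_def]]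
    by (simp add: p_def sgn_0_0)
  then have "det2 (Dh p (picture_tangent ?u y)) (Dh p (picture_tangent ?l y)) \<noteq> 0"
    by (auto simp: sgn_div_norm det2_scaleR_left det2_scaleR_right sgn_0_0)
  then have "det2 (picture_tangent ?u y) (picture_tangent ?l y) \<noteq> 0"
    using sgn_det2_Dh[OF p, of "picture_tangent ?u y" "picture_tangent ?l y"] by (auto simp: sgn_0_0)
  then show False using eq by (simp add: det2_picture_tangent) (simp add: picture_tangent_def)
qed

lemma crossing_at_sign:
  assumes "(i, j, y) \<in> graph_crossings gs"
  defines "u \<equiv> upper \<eta> i j" and "l \<equiv> lower \<eta> i j"
  shows "(case crossing_at u l y of (z, u, v) \<Rightarrow> det2 u v > 0) \<longleftrightarrow> \<epsilon> u * \<epsilon> l * (dg u y - dg l y) > 0"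
proof -
  have ij: "u < length gs" "l < length gs" "\<bar>y\<bar> < 1"
    using assms by (auto simp: graph_crossings_def upper_def lower_def)
  define p where "p = Complex ((gs ! u) y) y"
  have p: "p \<in> sq" using curve_in_sq ij by (simp add: p_def)
  have "picture_tangent u y \<noteq> 0" "picture_tangent l y \<noteq> 0" using orient[OF ij(1)] orient[OF ij(2)] by (auto simp: picture_tangent_def complex_eq_iff)
  then have "Dh p (picture_tangent u y) \<noteq> 0" "Dh p (picture_tangent l y) \<noteq> 0" using Dh_nonzero[OF p] by auto
  then have "sgn (det2 (sgn (Dh p (picture_tangent u y))) (sgn (Dh p (picture_tangent l y)))) = sgn (det2 (Dh p (picture_tangent u y)) (Dh p (picture_tangent l y)))"
    by (simp add: sgn_div_norm[of "Dh p _"] det2_scaleR_left det2_scaleR_right sgn_mult)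
  also have "\<dots> = sgn (det2 (picture_tangent u y) (picture_tangent l y))" by (rule sgn_det2_Dh[OF p])
  also have "det2 (picture_tangent u y) (picture_tangent l y) = \<epsilon> u * \<epsilon> l * (dg u y - dg l y)"
    unfolding det2_picture_tangent by (simp add: picture_tangent_def algebra_simps)
  finally show ?thesis
    unfolding crossing_at_def Let_def prod.case p_def[symmetric] by (metis sgn_greater)
qed

text \<open>
  A short step from the crossing in direction \<open>d\<close> changes the sides relative to the two crossing strands to
  the prescribed ones, and leaves those relative to the other strands as they are. Such a \<open>d\<close> exists since the
  two slopes differ.
\<close>

lemma corner_value:
  assumes x: "(i, j, y) \<in> graph_crossings gs"
    and C: "\<And>q. q \<in> sq \<Longrightarrow> off_graphs gs q \<Longrightarrow> f (face q) = C (pattern gs q)"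
  defines "u \<equiv> upper \<eta> i j" and "l \<equiv> lower \<eta> i j"
  shows "f (corner L (crossing_at u l y) b c) = corner_color \<epsilon> C (pattern gs (Complex ((gs ! i) y) y)) u l b c"
proof -
  let ?n = "length gs"
  have ij: "u < ?n" "l < ?n" "u \<noteq> l" "\<bar>y\<bar> < 1" "(gs ! u) y = (gs ! l) y" "(gs ! i) y = (gs ! u) y"
    using x by (auto simp: graph_crossings_def upper_def lower_def u_def l_def)
  have third: "(gs ! k) y \<noteq> (gs ! u) y" if k: "k < ?n" "k \<noteq> u" "k \<noteq> l" for k
  proof
    assume eq: "(gs ! k) y = (gs ! u) y"
    have m: "(min k u, max k u, y) \<in> graph_crossings gs"
      using eq ij k by (auto simp: graph_crossings_def min_def max_def)
    have "(min k u, max k u, y) = (i, j, y)" by (rule inj_onD[OF levels _ m x]) simp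
    then have "{min k u, max k u} = {i, j}" by simp
    moreover have "{i, j} = {u, l}" by (auto simp: u_def l_def upper_def lower_def)
    moreover have "k \<in> {min k u, max k u}" by (simp add: min_def)
    ultimately show False using k by simp
  qed
  define p where "p = Complex ((gs ! u) y) y"
  have p: "p \<in> sq" using curve_in_sq ij by (simp add: p_def)
  have rp [simp]: "Re p = (gs ! u) y" "Im p = y" by (simp_all add: p_def)
  have slopes: "dg u y \<noteq> dg l y" using slopes_differ[OF x] by (simp add: u_def l_def)
  \<comment> \<open>\<open>d\<close> is chosen so that \<open>g(y) - x\<close> has derivative \<open>\<sigma>\<close> for the upper and \<open>\<tau>\<close> for the lower strand\<close>
  define \<sigma> where "\<sigma> = \<epsilon> u * side b"
  define \<tau> where "\<tau> = \<epsilon> l * side c"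
  define dy where "dy = (\<sigma> - \<tau>) / (dg u y - dg l y)"
  define d where "d = Complex (dg u y * dy - \<sigma>) dy"
  have du: "dg u y * Im d - Re d = \<sigma>" by (simp add: d_def)
  have "(dg u y - dg l y) * dy = \<sigma> - \<tau>" using slopes by (simp add: dy_def)
  then have dl: "dg l y * Im d - Re d = \<tau>" by (simp add: d_def algebra_simps)
  have eps: "\<epsilon> u * \<epsilon> u = 1" "\<epsilon> l * \<epsilon> l = 1" using orient[OF ij(1)] orient[OF ij(2)] by auto
  have \<sigma>: "\<sigma> \<noteq> 0" "\<sigma> > 0 \<longleftrightarrow> b = (\<epsilon> u = 1)" and \<tau>: "\<tau> \<noteq> 0" "\<tau> > 0 \<longleftrightarrow> c = (\<epsilon> l = 1)"
    using orient[OF ij(1)] orient[OF ij(2)] by (auto simp: \<sigma>_def \<tau>_def side_def)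
  have "det2 (picture_tangent u y) d = side b" "det2 (picture_tangent l y) d = side c"
    unfolding det2_picture_tangent du dl \<sigma>_def \<tau>_def using eps by (simp_all add: mult.assoc[symmetric])
  then have s: "sgn (det2 (picture_tangent u y) d) = side b" "sgn (det2 (picture_tangent l y) d) = side c"
    by (simp_all add: side_def)
  have cr: "crossing_at u l y = (h p, sgn (Dh p (picture_tangent u y)), sgn (Dh p (picture_tangent l y)))"
    by (simp add: crossing_at_def Let_def p_def)
  have "(h p, sgn (Dh p (picture_tangent u y)), sgn (Dh p (picture_tangent l y))) \<in> crossings L"
    using crossing_at_in_crossings[OF x] unfolding u_def[symmetric] l_def[symmetric] cr .
  from corner_face[OF p this s]
  have "\<forall>\<^sub>F t in at_right (0::real). corner L (crossing_at u l y) b c = face (p + t *\<^sub>R d)"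
    unfolding cr .
  moreover have "\<forall>\<^sub>F t in at_right (0::real). p + t *\<^sub>R d \<in> sq"
  proof -
    have "((\<lambda>t. p + t *\<^sub>R d) \<longlongrightarrow> p + 0 *\<^sub>R d) (at_right (0::real))" by (intro tendsto_intros)
    then show ?thesis using topological_tendstoD[OF _ open_sq] p by simp
  qed
  moreover have "\<forall>\<^sub>F t in at_right (0::real). \<forall>k\<in>{..<?n}.
      (gs ! k) (Im (p + t *\<^sub>R d)) - Re (p + t *\<^sub>R d) \<noteq> 0 \<and>
      ((gs ! k) (Im (p + t *\<^sub>R d)) - Re (p + t *\<^sub>R d) > 0 \<longleftrightarrow>
        (pattern gs p)[u := (b = (\<epsilon> u = 1)), l := (c = (\<epsilon> l = 1))] ! k)"
  proof (rule eventually_ball_finite, simp, rule ballI)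
    fix k assume "k \<in> {..<?n}"
    then have k: "k < ?n" by simp
    define F where "F = (\<lambda>t. (gs ! k) (Im (p + t *\<^sub>R d)) - Re (p + t *\<^sub>R d))"
    have "((\<lambda>t. (gs ! k) (y + t * Im d)) has_real_derivative dg k y * Im d) (at 0)"
      by (rule DERIV_chain2[where g = "\<lambda>t. y + t * Im d"])
        (use deriv[OF k, of y] in \<open>auto intro!: derivative_eq_intros\<close>)
    then have F: "(F has_real_derivative dg k y * Im d - Re d) (at 0)"
      unfolding F_def by (auto intro!: derivative_eq_intros)
    have F0: "F 0 = (gs ! k) y - (gs ! u) y" by (simp add: F_def)
    have "\<forall>\<^sub>F t in at_right 0. F t \<noteq> 0 \<and>
        (F t > 0 \<longleftrightarrow> (pattern gs p)[u := (b = (\<epsilon> u = 1)), l := (c = (\<epsilon> l = 1))] ! k)"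
    proof (cases "k = u \<or> k = l")
      case True
      then show ?thesis
      proof
        assume "k = u"
        then show ?thesis using eventually_sign_right[OF F] du F0 \<sigma> ij by (simp add: pattern_def)
      next
        assume "k = l"
        then show ?thesis using eventually_sign_right[OF F] dl F0 \<tau> ij by (simp add: pattern_def)
      qed
    next
      case False
      have "(F \<longlongrightarrow> F 0) (at_right 0)"
        using DERIV_isCont[OF F] by (auto simp: isCont_def intro: filterlim_at_split[THEN iffD1, THEN conjunct2])
      moreover have "F 0 \<noteq> 0" using third k False F0 by auto
      ultimately have "\<forall>\<^sub>F t in at_right 0. F t \<noteq> 0 \<and> (F t > 0 \<longleftrightarrow> F 0 > 0)"
        using order_tendstoD[of F "F 0" "at_right 0" 0]
        by (cases "F 0 > 0") (auto elim!: eventually_mono)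
      then show ?thesis using False k by (simp add: pattern_def F0)
    qed
    then show "\<forall>\<^sub>F t in at_right 0. (gs ! k) (Im (p + t *\<^sub>R d)) - Re (p + t *\<^sub>R d) \<noteq> 0 \<and>
      ((gs ! k) (Im (p + t *\<^sub>R d)) - Re (p + t *\<^sub>R d) > 0 \<longleftrightarrow>
        (pattern gs p)[u := (b = (\<epsilon> u = 1)), l := (c = (\<epsilon> l = 1))] ! k)"
      unfolding F_def .
  qed
  ultimately have "\<forall>\<^sub>F t in at_right (0::real). f (corner L (crossing_at u l y) b c) =
      C ((pattern gs p)[u := (b = (\<epsilon> u = 1)), l := (c = (\<epsilon> l = 1))])"
  proof eventually_elim
    case (elim t)
    have "off_graphs gs (p + t *\<^sub>R d)"
      unfolding off_graphs_def all_set_conv_all_nth using elim(3) by auto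
    moreover have "pattern gs (p + t *\<^sub>R d) = (pattern gs p)[u := (b = (\<epsilon> u = 1)), l := (c = (\<epsilon> l = 1))]"
      by (rule nth_equalityI) (use elim(3) in \<open>auto simp: pattern_def\<close>)
    ultimately show ?case using C[OF elim(2)] elim(1) by simp
  qed
  then show ?thesis
    using eventually_happens'[OF trivial_limit_at_right_real] ij(6)
    by (auto simp: corner_color_def p_def)
qed

text \<open>
  With strand \<open>i\<close> above \<open>j\<close> the crossing has the sign of \<open>\<epsilon> i * \<epsilon> j * (dg i y - dg j y)\<close>; exchanging the two
  strands changes this sign.
\<close>

definition graph_weight ::
    "('x \<Rightarrow> 'x \<Rightarrow> 'x \<Rightarrow> 'a::ab_group_add) \<Rightarrow> (bool list \<Rightarrow> 'x) \<Rightarrow> nat \<times> nat \<times> real \<Rightarrow> 'a" where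
  "graph_weight \<phi> C = (\<lambda>(i, j, y).
     signed ((\<epsilon> i * \<epsilon> j * (dg i y - dg j y) > 0) = (\<eta> j < \<eta> i))
       (pair_weight \<phi> \<epsilon> \<eta> C (pattern gs (Complex ((gs ! i) y) y)) i j))"

lemma inside_weight:
  assumes C: "\<And>q. q \<in> sq \<Longrightarrow> off_graphs gs q \<Longrightarrow> f (face q) = C (pattern gs q)"
  shows "(\<Sum>c\<in>{c \<in> crossings L. fst c \<in> U}. crossing_weight \<phi> L f c) =
    (\<Sum>x\<in>graph_crossings gs. graph_weight \<phi> C x)"
  unfolding sum_crossings_inside
proof (rule sum.cong[OF refl], clarify)
  fix i j y assume x: "(i, j, y) \<in> graph_crossings gs"
  have val: "f (corner L (crossing_at (upper \<eta> i j) (lower \<eta> i j) y) b c) =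
      corner_color \<epsilon> C (pattern gs (Complex ((gs ! i) y) y)) (upper \<eta> i j) (lower \<eta> i j) b c" for b c
    by (rule corner_value[OF x]) (rule C)
  have ij: "i < length gs" "j < length gs" using x by (auto simp: graph_crossings_def)
  have "dg i y \<noteq> dg j y" using slopes_differ[OF x] by (auto simp: upper_def lower_def split: if_splits)
  moreover have "\<epsilon> i \<noteq> 0" "\<epsilon> j \<noteq> 0" using orient[OF ij(1)] orient[OF ij(2)] by auto
  ultimately have nz: "\<epsilon> i * \<epsilon> j * (dg i y - dg j y) \<noteq> 0" by simp
  have "b = - a \<Longrightarrow> a \<noteq> 0 \<Longrightarrow> b > 0 \<longleftrightarrow> \<not> a > 0" for a b :: real by auto
  from this[OF _ nz, of "\<epsilon> j * \<epsilon> i * (dg j y - dg i y)"]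
  have "\<epsilon> j * \<epsilon> i * (dg j y - dg i y) > 0 \<longleftrightarrow> \<not> \<epsilon> i * \<epsilon> j * (dg i y - dg j y) > 0"
    by (simp add: algebra_simps)
  then have "\<epsilon> (upper \<eta> i j) * \<epsilon> (lower \<eta> i j) * (dg (upper \<eta> i j) y - dg (lower \<eta> i j) y) > 0 \<longleftrightarrow>
      (\<epsilon> i * \<epsilon> j * (dg i y - dg j y) > 0) = (\<eta> j < \<eta> i)"
    unfolding upper_def lower_def by (cases "\<eta> j < \<eta> i") simp_all
  then show "crossing_weight \<phi> L f (crossing_at (upper \<eta> i j) (lower \<eta> i j) y) = graph_weight \<phi> C (i, j, y)"
    unfolding crossing_weight_def crossing_at_sign[OF x] val
    by (simp add: graph_weight_def pair_weight_def Let_def)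
qed

lemma graph_coloring:
  assumes C: "\<And>q. q \<in> sq \<Longrightarrow> off_graphs gs q \<Longrightarrow> f (face q) = C (pattern gs q)"
    and col: "coloring star dot (dual_graph L) f" and x: "(i, j, y) \<in> graph_crossings gs"
  shows "pair_relation star dot \<epsilon> \<eta> C (pattern gs (Complex ((gs ! i) y) y)) i j"
proof -
  have val: "f (corner L (crossing_at (upper \<eta> i j) (lower \<eta> i j) y) b c) =
      corner_color \<epsilon> C (pattern gs (Complex ((gs ! i) y) y)) (upper \<eta> i j) (lower \<eta> i j) b c" for b c
    by (rule corner_value[OF x]) (rule C)
  show ?thesis
    using col[unfolded coloring_corners, rule_format, OF crossing_at_in_crossings[OF x]]
    unfolding pair_relation_def Let_def val .
qed

lemma same_pattern_face:
  assumes "\<And>i j. i < length gs \<Longrightarrow> j < length gs \<Longrightarrow> \<not> pattern gs q ! i \<Longrightarrow> pattern gs q ! j \<Longrightarrow>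
        convex {y \<in> I. (gs ! i) y < (gs ! j) y}"
    and "convex I" "I \<subseteq> {-1..1}" "Im q \<in> I" "Im q' \<in> I" "\<bar>Re q\<bar> < 1" "\<bar>Re q'\<bar> < 1"
    and "off_graphs gs q" "off_graphs gs q'" "pattern gs q' = pattern gs q"
  shows "face q = face q'"
proof (rule cell_face)
  show "connected (cell gs I (pattern gs q))"
  proof (rule connected_cell)
    fix g assume "g \<in> set gs"
    then obtain k where "k < length gs" "g = gs ! k" by (auto simp: in_set_conv_nth)
    then show "continuous_on I g"
      using deriv[of k] by (intro DERIV_continuous_on[where D = "dg k"]) (simp add: has_field_derivative_at_within)
  next
    fix g y assume "g \<in> set gs" "y \<in> I"
    moreover from this have "\<bar>y\<bar> \<le> 1" using subsetD[OF assms(3)] by (auto simp: abs_le_iff)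
    ultimately show "\<bar>g y\<bar> < 1" using bound by blast
  qed (fact assms(1,2,3) | simp add: pattern_def)+
  show "I \<subseteq> {-1..1}" by (fact assms(3))
  show "q \<in> cell gs I (pattern gs q)" "q' \<in> cell gs I (pattern gs q)"
    unfolding cell_def mem_Collect_eq using assms(4-10) by simp_all
qed

end

section \<open>Algebraic identities\<close>

lemma (in quasigroup) ldiv_unique: "f y z = x \<Longrightarrow> ldiv f y x = z"
  unfolding ldiv_def using bij_is_inj[OF bij_left[of y]] by (auto dest: injD)

text \<open>
  By cancellation, \<open>b\<close> is the quotient that occurs in the first vanishing condition on the weight. The
  hypothesis is the relation at a crossing whose in and out regions coincide.
\<close>

lemma (in boltzmann_weight) weight_loop:
  assumes "x = x \<star> (a \<odot> b)"
  shows "\<phi> x a b = 0"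
proof -
  have "ldiv (\<star>) x x = a \<odot> b" using assms by (intro star.ldiv_unique) simp
  then have "ldiv (\<odot>) a (ldiv (\<star>) x x) = b" by (intro dot.ldiv_unique) simp
  then show ?thesis using weight_left[of x a] by simp
qed

text \<open>
  The regions before and after a third Reidemeister move together realize all eight combinations of
  sides of the three strands; \<open>c h m l\<close> is the color to the sides \<open>h\<close>, \<open>m\<close>, \<open>l\<close> of the highest, middle and lowest one.
  A crossing of two strands is a face of the cube, the third coordinate being the side of the remaining
  strand. The cocycle condition for the colors of the vertices \<open>FTT\<close>, \<open>TTT\<close>, \<open>FFT\<close>, \<open>FFF\<close> is a relation between the six
  faces; the relations at the crossings express the other four colors by these.
\<close>

lemma (in boltzmann_weight) cube_identity:
  fixes c :: "bool \<Rightarrow> bool \<Rightarrow> bool \<Rightarrow> 'x"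
  assumes hm: "\<And>s. c True False s = c False True s \<star> (c True True s \<odot> c False False s)"
    and hl: "\<And>s. c True s False = c False s True \<star> (c True s True \<odot> c False s False)"
    and ml: "\<And>s. c s True False = c s False True \<star> (c s True True \<odot> c s False False)"
  defines "Whm \<equiv> \<lambda>s. \<phi> (c False True s) (c True True s) (c False False s)"
    and "Whl \<equiv> \<lambda>s. \<phi> (c False s True) (c True s True) (c False s False)"
    and "Wml \<equiv> \<lambda>s. \<phi> (c s False True) (c s True True) (c s False False)"
  shows "(Whm True - Whm False) + (Wml True - Wml False) = Whl True - Whl False"
proof -
  let ?x = "c False True True" and ?a = "c True True True" and ?b = "c False False True"
    and ?y = "c False False False"
  have X1: "c True False True = ?x \<star> (?a \<odot> ?b)" by (rule hm)
  have B0: "c False True False = ?b \<star> (?x \<odot> ?y)" by (rule ml)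
  have B1: "c True False False = ?b \<star> (c True False True \<odot> ?y)" by (rule hl)
  have X0: "c True True False = ?x \<star> (?a \<odot> c False True False)" by (rule hl)
  have "Whm True + Whl False + Wml True = Wml False + Whl True + Whm False"
    unfolding Whm_def Whl_def Wml_def
    using weight_cocycle[of ?x ?a ?b ?y] unfolding X1[symmetric] B0[symmetric]
    unfolding B1[symmetric] X0[symmetric] .
  then show ?thesis by (simp add: algebra_simps)
qed

lemma signed_signed: "signed a (signed b x) = signed (a = b) x"
  by (simp add: signed_def)

lemma signed_add: "signed a (x + y) = signed a x + signed a y"
  by (simp add: signed_def)

lemma signed_diff: "signed a (x - y) = signed a x - signed a y"
  by (simp add: signed_def)

text \<open>
  All oriented versions of the third move at once. The left side is the sum before, the right side the
  sum after the move, over the crossings of the strands 0, 1, 2 of the standard picture, and the pattern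
  at the crossing of two strands tells the side of the third one.
  
  In coordinates relative to the orientations, the difference for strands \<open>i\<close>, \<open>j\<close> is the difference of two
  opposite faces of the cube, multiplied by the sign of the crossing and by the orientation of the
  third strand. Up to the order of heights, the product of these two signs is the product of all three
  orientations, hence common to the three pairs of faces. What remains is the cube identity with its
  roles permuted according to the order of heights.
\<close>

lemma (in boltzmann_weight) triangle_identity:
  fixes C :: "bool list \<Rightarrow> 'x" and \<epsilon> \<eta> :: "nat \<Rightarrow> real"
  assumes ord: "inj_on \<eta> {..<3}"
    and r01: "\<And>t. pair_relation (\<star>) (\<odot>) \<epsilon> \<eta> C [False, False, t] 0 1"
    and r02: "\<And>t. pair_relation (\<star>) (\<odot>) \<epsilon> \<eta> C [False, t, False] 0 2"
    and r12: "\<And>t. pair_relation (\<star>) (\<odot>) \<epsilon> \<eta> C [t, False, False] 1 2"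
    and eps: "\<forall>k<3. \<epsilon> k \<in> {1, -1}"
  defines "S \<equiv> \<lambda>i j. signed ((\<epsilon> i * \<epsilon> j > 0) = (\<eta> j < \<eta> i))"
  shows "S 0 1 (pair_weight \<phi> \<epsilon> \<eta> C [False, False, False] 0 1) +
         S 0 2 (pair_weight \<phi> \<epsilon> \<eta> C [False, True, False] 0 2) +
         S 1 2 (pair_weight \<phi> \<epsilon> \<eta> C [False, False, False] 1 2) =
         S 0 1 (pair_weight \<phi> \<epsilon> \<eta> C [False, False, True] 0 1) +
         S 0 2 (pair_weight \<phi> \<epsilon> \<eta> C [False, False, False] 0 2) +
         S 1 2 (pair_weight \<phi> \<epsilon> \<eta> C [True, False, False] 1 2)"
proof -
  define e where "e k \<longleftrightarrow> \<epsilon> k = 1" for k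
  define o01 where "o01 \<longleftrightarrow> \<eta> 1 < \<eta> 0"
  define o02 where "o02 \<longleftrightarrow> \<eta> 2 < \<eta> 0"
  define o12 where "o12 \<longleftrightarrow> \<eta> 2 < \<eta> 1"
  have "\<eta> 0 \<noteq> \<eta> 1" "\<eta> 0 \<noteq> \<eta> 2" "\<eta> 1 \<noteq> \<eta> 2"
    using ord by (auto dest!: inj_onD[of \<eta> "{..<3}"])
  then have orders: "(o01 \<and> o02) \<or> (\<not> o01 \<and> \<not> o02) \<or> (o01 \<and> \<not> o02 \<and> \<not> o12) \<or> (\<not> o01 \<and> o02 \<and> o12)"
    unfolding o01_def o02_def o12_def by linarith
  have es: "\<epsilon> i * \<epsilon> j > 0 \<longleftrightarrow> e i = e j" if "i < 3" "j < 3" for i j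
    using eps[rule_format, OF that(1)] eps[rule_format, OF that(2)] by (auto simp: e_def)
  \<comment> \<open>\<open>K\<close> is \<open>C\<close> in coordinates relative to the orientations, \<open>True\<close> meaning left\<close>
  define K where "K x y z = C [x = e 0, y = e 1, z = e 2]" for x y z
  define W01 where "W01 t = \<phi> (if o01 then K False True t else K True False t) (K True True t) (K False False t)" for t
  define W02 where "W02 t = \<phi> (if o02 then K False t True else K True t False) (K True t True) (K False t False)" for t
  define W12 where "W12 t = \<phi> (if o12 then K t False True else K t True False) (K t True True) (K t False False)" for t
  have cc: "corner_color \<epsilon> C [False, False, t = e 2] 0 1 b c = K b c t"
    "corner_color \<epsilon> C [False, False, t = e 2] 1 0 b c = K c b t"
    "corner_color \<epsilon> C [False, t = e 1, False] 0 2 b c = K b t c"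
    "corner_color \<epsilon> C [False, t = e 1, False] 2 0 b c = K c t b"
    "corner_color \<epsilon> C [t = e 0, False, False] 1 2 b c = K t b c"
    "corner_color \<epsilon> C [t = e 0, False, False] 2 1 b c = K t c b" for t b c
    by (simp_all add: corner_color_def K_def e_def numeral_2_eq_2)
  have ul: "upper \<eta> 0 1 = (if o01 then 0 else 1)" "lower \<eta> 0 1 = (if o01 then 1 else 0)"
    "upper \<eta> 0 2 = (if o02 then 0 else 2)" "lower \<eta> 0 2 = (if o02 then 2 else 0)"
    "upper \<eta> 1 2 = (if o12 then 1 else 2)" "lower \<eta> 1 2 = (if o12 then 2 else 1)"
    by (simp_all add: upper_def lower_def o01_def o02_def o12_def)
  have pw01: "pair_weight \<phi> \<epsilon> \<eta> C [False, False, t = e 2] 0 1 = W01 t" for t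
    unfolding pair_weight_def Let_def ul W01_def by (cases o01) (simp_all only: cc if_True if_False)
  have pw02: "pair_weight \<phi> \<epsilon> \<eta> C [False, t = e 1, False] 0 2 = W02 t" for t
    unfolding pair_weight_def Let_def ul W02_def by (cases o02) (simp_all only: cc if_True if_False)
  have pw12: "pair_weight \<phi> \<epsilon> \<eta> C [t = e 0, False, False] 1 2 = W12 t" for t
    unfolding pair_weight_def Let_def ul W12_def by (cases o12) (simp_all only: cc if_True if_False)
  have twice: "((t = b) = b) = t" for t b :: bool by blast
  have pw: "pair_weight \<phi> \<epsilon> \<eta> C [False, False, t] 0 1 = W01 (t = e 2)"
    "pair_weight \<phi> \<epsilon> \<eta> C [False, t, False] 0 2 = W02 (t = e 1)"
    "pair_weight \<phi> \<epsilon> \<eta> C [t, False, False] 1 2 = W12 (t = e 0)" for t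
    unfolding pw01[symmetric] pw02[symmetric] pw12[symmetric] twice by (rule refl)+
  have c01: "if o01 then K True False t = K False True t \<star> (K True True t \<odot> K False False t)
      else K False True t = K True False t \<star> (K True True t \<odot> K False False t)" for t
    using r01[of "t = e 2"] unfolding pair_relation_def Let_def ul
    by (cases o01) (simp_all only: cc if_True if_False simp_thms)
  have c02: "if o02 then K True t False = K False t True \<star> (K True t True \<odot> K False t False)
      else K False t True = K True t False \<star> (K True t True \<odot> K False t False)" for t
    using r02[of "t = e 1"] unfolding pair_relation_def Let_def ul
    by (cases o02) (simp_all only: cc if_True if_False simp_thms)
  have c12: "if o12 then K t True False = K t False True \<star> (K t True True \<odot> K t False False)
      else K t False True = K t True False \<star> (K t True True \<odot> K t False False)" for t
    using r12[of "t = e 0"] unfolding pair_relation_def Let_def ul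
    by (cases o12) (simp_all only: cc if_True if_False simp_thms)
  define D01 where "D01 = W01 True - W01 False"
  define D02 where "D02 = W02 True - W02 False"
  define D12 where "D12 = W12 True - W12 False"
  note defs = D01_def D02_def D12_def W01_def W02_def W12_def
  have core: "signed o01 D01 + signed o12 D12 = signed o02 D02"
  proof (cases o01; cases o02; cases o12)
    assume o: "o01" "o02" "o12"
    show ?thesis
      using cube_identity[of "\<lambda>h m l. K h m l",
          OF c01[unfolded if_P[OF o(1)]]
             c02[unfolded if_P[OF o(2)]]
             c12[unfolded if_P[OF o(3)]]] o
      by (simp add: defs signed_def algebra_simps)
  next
    assume o: "o01" "o02" "\<not> o12"
    show ?thesis
      using cube_identity[of "\<lambda>h m l. K h l m",
          OF c02[unfolded if_P[OF o(2)]]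
             c01[unfolded if_P[OF o(1)]]
             c12[unfolded if_not_P[OF o(3)]]] o
      by (simp add: defs signed_def algebra_simps)
  next
    assume o: "o01" "\<not> o02" "\<not> o12"
    show ?thesis
      using cube_identity[of "\<lambda>h m l. K m l h",
          OF c02[unfolded if_not_P[OF o(2)]]
             c12[unfolded if_not_P[OF o(3)]]
             c01[unfolded if_P[OF o(1)]]] o
      by (simp add: defs signed_def algebra_simps)
  next
    assume o: "\<not> o01" "o02" "o12"
    show ?thesis
      using cube_identity[of "\<lambda>h m l. K m h l",
          OF c01[unfolded if_not_P[OF o(1)]]
             c12[unfolded if_P[OF o(3)]]
             c02[unfolded if_P[OF o(2)]]] o
      by (simp add: defs signed_def algebra_simps)
  next
    assume o: "\<not> o01" "\<not> o02" "o12"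
    show ?thesis
      using cube_identity[of "\<lambda>h m l. K l h m",
          OF c12[unfolded if_P[OF o(3)]]
             c01[unfolded if_not_P[OF o(1)]]
             c02[unfolded if_not_P[OF o(2)]]] o
      by (simp add: defs signed_def algebra_simps)
  next
    assume o: "\<not> o01" "\<not> o02" "\<not> o12"
    show ?thesis
      using cube_identity[of "\<lambda>h m l. K l m h",
          OF c12[unfolded if_not_P[OF o(3)]]
             c02[unfolded if_not_P[OF o(2)]]
             c01[unfolded if_not_P[OF o(1)]]] o
      by (simp add: defs signed_def algebra_simps)
  qed (use orders in auto)
  have raw: "W (True = b) - W (False = b) = signed b (W True - W False)" for W :: "bool \<Rightarrow> 'a" and b
    by (cases b) (simp_all add: signed_def)
  \<comment> \<open>the product of the three orientations\<close>
  define E where "E \<longleftrightarrow> ((e 0 = e 1) = e 2)"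
  have S: "S 0 1 = signed ((e 0 = e 1) = o01)" "S 0 2 = signed ((e 0 = e 2) = o02)"
      "S 1 2 = signed ((e 1 = e 2) = o12)"
    by (simp_all add: S_def es o01_def o02_def o12_def)
  have "signed ((e 0 = e 1) = o01) (signed (e 2) D01) + signed ((e 1 = e 2) = o12) (signed (e 0) D12)
      = signed ((e 0 = e 2) = o02) (signed (e 1) D02)"
  proof -
    have "signed E (signed o01 D01) + signed E (signed o12 D12) = signed E (signed o02 D02)"
      unfolding signed_add[symmetric] core ..
    moreover have "(((e 0 = e 1) = o01) = e 2) = (E = o01)" "(((e 1 = e 2) = o12) = e 0) = (E = o12)"
      "(((e 0 = e 2) = o02) = e 1) = (E = o02)" by (auto simp: E_def)
    ultimately show ?thesis unfolding signed_signed by simp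
  qed
  then have "signed ((e 0 = e 1) = o01) (W01 (True = e 2) - W01 (False = e 2)) +
      signed ((e 1 = e 2) = o12) (W12 (True = e 0) - W12 (False = e 0))
      = signed ((e 0 = e 2) = o02) (W02 (True = e 1) - W02 (False = e 1))"
    unfolding raw D01_def D02_def D12_def .
  moreover have "x' + z + y' = x + z' + y" if "(x - x') + (y - y') = z - z'" for x x' y y' z z' :: 'a
    using that by (simp add: algebra_simps)
  ultimately show ?thesis unfolding S pw signed_diff by blast
qed

section \<open>Outside and on the boundary of the disc\<close>

lemma BW_split:
  fixes \<phi> :: "'x \<Rightarrow> 'x \<Rightarrow> 'x \<Rightarrow> 'b::ab_group_add"
  assumes "oriented_link_diagram L"
  shows "BW \<phi> (dual_graph L) f =
    (\<Sum>c\<in>{c \<in> crossings L. fst c \<notin> U}. crossing_weight \<phi> L f c) +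
    (\<Sum>c\<in>{c \<in> crossings L. fst c \<in> U}. crossing_weight \<phi> L f c)"
proof -
  have "crossings L = {c \<in> crossings L. fst c \<notin> U} \<union> {c \<in> crossings L. fst c \<in> U}" by auto
  then have "sum F (crossings L) = sum F {c \<in> crossings L. fst c \<notin> U} + sum F {c \<in> crossings L. fst c \<in> U}"
    for F :: "crossing \<Rightarrow> 'b"
    using diagram_finite[OF assms] by (subst \<open>crossings L = _\<close>, intro sum.union_disjoint) auto
  then show ?thesis unfolding BW_corners .
qed

text \<open>
  The crossings outside the disc are common to both diagrams. Since they are not on its boundary either,
  short rays from them stay outside the disc, where the colorings agree.
\<close>

lemma outside_weights_agree:
  assumes L: "oriented_link_diagram L" and L': "oriented_link_diagram L'"
    and same: "same_outside U L L'" and looks: "looks_like L h U T"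
    and agree: "agree_outside U (dual_graph L) f (dual_graph L') f'"
  shows "(\<Sum>c\<in>{c \<in> crossings L. fst c \<notin> U}. crossing_weight \<phi> L f c) =
    (\<Sum>c\<in>{c \<in> crossings L'. fst c \<notin> U}. crossing_weight \<phi> L' f' c)"
proof (rule sum.cong)
  show eq: "{c \<in> crossings L. fst c \<notin> U} = {c \<in> crossings L'. fst c \<notin> U}"
    using same by (simp add: same_outside_def)
  fix c assume c': "c \<in> {c \<in> crossings L'. fst c \<notin> U}"
  obtain z u v where c: "c = (z, u, v)" by (rule prod_cases3)
  have "c \<in> {c \<in> crossings L. fst c \<notin> U}" unfolding eq by (rule c')
  then have cr: "(z, u, v) \<in> crossings L" "(z, u, v) \<in> crossings L'" and z: "z \<notin> U"
    using c' by (simp_all add: c)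
  have "U = h ` sq" "z \<notin> h ` (csq - sq)" "chart h"
    using looks cr(1) unfolding looks_like_def by auto
  then have "z \<notin> h ` csq" using z by blast
  have "compact (h ` csq)"
    using \<open>chart h\<close> compact_csq by (auto simp: chart_def intro: compact_continuous_image)
  then have open_out: "open (- h ` csq)" by (simp add: compact_imp_closed open_Compl)
  have "f (corner L (z, u, v) l m) = f' (corner L' (z, u, v) l m)" for l m
  proof -
    define w where "w = corner_direction u v l m"
    define ray where "ray = (\<lambda>t::real. z + of_real t * w)"
    have ray: "(ray has_vector_derivative w) (at_right 0)" "ray 0 = z"
      unfolding ray_def by (auto intro!: derivative_eq_intros)
    note w = corner_direction_sides[OF crossing_tangents[OF L cr(1)], of l m, folded w_def]
    have "(ray \<longlongrightarrow> z) (at_right 0)"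
      using has_vector_derivative_continuous[OF ray(1)] ray(2) by (simp add: continuous_within)
    then have "\<forall>\<^sub>F t in at_right 0. ray t \<in> - h ` csq"
      by (rule topological_tendstoD[OF _ open_out]) (use \<open>z \<notin> h ` csq\<close> in simp)
    with corner_curve[OF L cr(1) w ray] corner_curve[OF L' cr(2) w ray]
    have "\<forall>\<^sub>F t in at_right (0::real). f (corner L (z, u, v) l m) = f' (corner L' (z, u, v) l m)"
    proof eventually_elim
      case (elim t)
      have "ray t \<notin> U" using elim(3) \<open>U = h ` sq\<close> sq_subset_csq by blast
      moreover have "ray t \<in> corner L (z, u, v) l m" "corner L (z, u, v) l m \<in> regions L"
        using elim(1) region_component by auto
      moreover have "ray t \<in> corner L' (z, u, v) l m" "corner L' (z, u, v) l m \<in> regions L'"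
        using elim(2) region_component by auto
      ultimately show ?case
        using agree unfolding agree_outside_def dual_graph_def by simp
    qed
    then show ?thesis using eventually_happens'[OF trivial_limit_at_right_real] by blast
  qed
  then show "crossing_weight \<phi> L f c = crossing_weight \<phi> L' f' c"
    by (simp add: crossing_weight_def c)
qed

text \<open>
  Boundary points of the disc that are off both diagrams are outside the open disc \<open>U\<close>. They transport
  colors between the two diagrams.
\<close>

lemma boundary_faces_agree:
  assumes D: "disc_picture L T h U" and D': "disc_picture L' T' h' U"
    and agree: "agree_outside U (dual_graph L) f (dual_graph L') f'"
    and h: "\<forall>z\<in>csq - sq. h z = h' z" and q: "q \<in> csq - sq"
    and "q \<notin> underlying T" "q \<notin> endpoints T" "q \<notin> underlying T'" "q \<notin> endpoints T'"
  shows "f (disc_picture.face L h q) = f' (disc_picture.face L' h' q)"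
proof -
  interpret D: disc_picture L T h U by (rule D)
  interpret D': disc_picture L' T' h' U by (rule D')
  have "h q = h' q" using h q by blast
  have "h q \<notin> U"
    using q D.h_eq_iff sq_subset_csq unfolding D.U_eq by (auto dest!: subsetD)
  moreover have "D.face q \<in> regions L" "h q \<in> D.face q"
    using D.face_region[of q] assms(6,7) q by simp_all
  moreover have "D'.face q \<in> regions L'" "h q \<in> D'.face q"
    unfolding \<open>h q = h' q\<close> using D'.face_region[of q] assms(8,9) q by simp_all
  ultimately show ?thesis
    using agree unfolding agree_outside_def dual_graph_def by simp
qed

section \<open>The first move\<close>

lemma kink_factor: "4 * s^3 - s = s * (4 * s\<^sup>2 - 1)" for s :: real
  by (simp add: power3_eq_cube power2_eq_square algebra_simps)

lemma kink_eq_iff: "kink s = kink t \<longleftrightarrow> s = t \<or> (s\<^sup>2 = 1/4 \<and> t = - s)"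
proof
  assume "kink s = kink t"
  then have sq: "s\<^sup>2 = t\<^sup>2" and cu: "4 * s^3 - s = 4 * t^3 - t" by (auto simp: kink_def)
  have "s * (4 * s\<^sup>2 - 1) = t * (4 * s\<^sup>2 - 1)"
    using cu unfolding kink_factor[of s] kink_factor[of t] sq[symmetric] .
  then have "(s - t) * (4 * s\<^sup>2 - 1) = 0" by (simp add: algebra_simps)
  moreover have "s = t \<or> s = - t" using sq by (simp add: power2_eq_iff)
  ultimately show "s = t \<or> (s\<^sup>2 = 1/4 \<and> t = - s)" by auto
next
  assume "s = t \<or> (s\<^sup>2 = 1/4 \<and> t = - s)"
  then show "kink s = kink t"
  proof
    assume a: "s\<^sup>2 = 1/4 \<and> t = - s"
    have "4 * s^3 = s" using kink_factor[of s] a by simp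
    then show ?thesis using a by (simp add: kink_def)
  qed simp
qed

text \<open>
  The nodal cubic in implicit form, used to see that paths avoid it.
\<close>

lemma kink_cubic: "(Im (kink s))\<^sup>2 = 16/9 * (Re (kink s) + 1/4) * (Re (kink s))\<^sup>2"
  by (simp add: kink_def power3_eq_cube power2_eq_square field_simps)

lemma kink_zero: "s\<^sup>2 = 1/4 \<Longrightarrow> kink s = 0"
proof -
  assume s: "s\<^sup>2 = 1/4"
  then show ?thesis using kink_factor[of s] by (simp add: kink_def complex_eq_iff)
qed

lemma kink_deriv: "(kink has_vector_derivative Complex (2 * s) (4 * s\<^sup>2 - 1/3)) (at s)"
  unfolding kink_def
  by (simp add: has_vector_derivative_complex_iff)
    (auto intro!: derivative_eq_intros simp: power2_eq_square)

lemma kink_disc: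
  assumes "oriented_link_diagram L" "looks_like L h U (picture [kink] \<epsilon> ht)" "\<epsilon> 0 \<in> {1, -1}"
  shows "disc_picture L (picture [kink] \<epsilon> ht) h U"
proof
  have in_csq: "kink x \<in> csq" if "\<bar>x\<bar> \<le> 1" for x
  proof -
    have "x\<^sup>2 \<le> 1" using that by (simp add: abs_square_le_1)
    then have "\<bar>4 * x\<^sup>2 - 1\<bar> \<le> 3" using zero_le_power2[of x] by linarith
    then have "\<bar>x\<bar> * \<bar>4 * x\<^sup>2 - 1\<bar> \<le> 1 * 3" using that by (intro mult_mono) auto
    then have "\<bar>x * (4 * x\<^sup>2 - 1)\<bar> \<le> 3" by (simp add: abs_mult)
    moreover have "- 1 \<le> x\<^sup>2 - 1/4" using zero_le_power2[of x] by linarith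
    ultimately show ?thesis using \<open>x\<^sup>2 \<le> 1\<close>
      by (simp add: kink_def csq_def kink_factor abs_le_iff)
  qed
  have in_sq: "kink x \<in> sq" if "\<bar>x\<bar> < 1" for x
  proof -
    have "x\<^sup>2 < 1" using that by (simp add: abs_square_less_1)
    then have "\<bar>4 * x\<^sup>2 - 1\<bar> \<le> 3" using zero_le_power2[of x] by linarith
    then have "\<bar>x\<bar> * \<bar>4 * x\<^sup>2 - 1\<bar> \<le> \<bar>x\<bar> * 3" by (intro mult_left_mono) auto
    then have "\<bar>x * (4 * x\<^sup>2 - 1)\<bar> < 3" using that by (simp add: abs_mult)
    moreover have "- 1 < x\<^sup>2 - 1/4" using zero_le_power2[of x] by linarith
    ultimately show ?thesis using \<open>x\<^sup>2 < 1\<close>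
      by (simp add: kink_def sq_def kink_factor abs_less_iff)
  qed
  have e: "\<bar>\<epsilon> 0 * s\<bar> = \<bar>s\<bar>" for s using assms(3) by auto
  show "curve (picture [kink] \<epsilon> ht) k s \<in> sq"
    if "k < num (picture [kink] \<epsilon> ht)" "s \<in> {-1<..<1}" for k s
    using that in_sq[of "\<epsilon> 0 * s"] by (simp add: picture_def e abs_less_iff)
  show "endpoints (picture [kink] \<epsilon> ht) \<subseteq> csq"
  proof
    fix x assume "x \<in> endpoints (picture [kink] \<epsilon> ht)"
    then obtain s where "s \<in> {-1, 1}" "x = kink (\<epsilon> 0 * s)"
      by (auto simp: endpoints_def picture_def)
    then show "x \<in> csq" using in_csq[of "\<epsilon> 0 * s"] e[of s] by auto
  qed
qed (use assms in \<open>simp_all add: picture_def\<close>)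

lemma off_kink:
  assumes "(Im q)\<^sup>2 \<noteq> 16/9 * (Re q + 1/4) * (Re q)\<^sup>2"
  shows "q \<notin> underlying (picture [kink] \<epsilon> ht)" "q \<notin> endpoints (picture [kink] \<epsilon> ht)"
  using assms kink_cubic by (auto simp: underlying_def endpoints_def places_def picture_def)

text \<open>
  The regions above and below the crossing are the same: a rectangular path from one to the other leads
  around the loop on its closed side \<open>x < -1/4\<close>.
\<close>

lemma kink_faces:
  assumes D: "disc_picture L (picture [kink] \<epsilon> ht) h U" and t: "0 < t" "t < 1/2"
  shows "disc_picture.face L h (Complex 0 t) = disc_picture.face L h (Complex 0 (- t))"
proof -
  interpret disc_picture L "picture [kink] \<epsilon> ht" h U by (rule D)
  have join: "face (\<gamma> a) = face (\<gamma> b)"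
    if "continuous_on {min a b..max a b} \<gamma>"
      and "\<And>s. s \<in> {min a b..max a b} \<Longrightarrow> \<gamma> s \<in> csq \<and> (Im (\<gamma> s))\<^sup>2 \<noteq> 16/9 * (Re (\<gamma> s) + 1/4) * (Re (\<gamma> s))\<^sup>2"
    for \<gamma> :: "real \<Rightarrow> complex" and a b
  proof (rule face_constant)
    show "connected (\<gamma> ` {min a b..max a b})" using that(1) by (intro connected_continuous_image) auto
    show "\<gamma> ` {min a b..max a b} \<subseteq> csq - underlying (picture [kink] \<epsilon> ht) - endpoints (picture [kink] \<epsilon> ht)"
      using that(2) off_kink by blast
  qed auto
  have hor: "face (Complex 0 y) = face (Complex (-1/2) y)" if "y\<^sup>2 = 1/4" for y
  proof (rule join[of 0 "-1/2" "\<lambda>s. Complex s y"])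
    fix s :: real assume "s \<in> {min 0 (-1/2)..max 0 (-1/2)}"
    then have s: "-1/2 \<le> s" "s \<le> 0" by auto
    then have "s\<^sup>2 \<le> (1/2)\<^sup>2" unfolding abs_le_square_iff[symmetric] by auto
    moreover have "(s + 1/4) * s\<^sup>2 \<le> 1/4 * s\<^sup>2" using s by (intro mult_right_mono) auto
    ultimately have "(s + 1/4) * s\<^sup>2 \<le> 1/4 * (1/2)\<^sup>2" by linarith
    then have "16/9 * ((s + 1/4) * s\<^sup>2) < 1/4" by (simp add: power2_eq_square)
    then have "(Im (Complex s y))\<^sup>2 \<noteq> 16/9 * (Re (Complex s y) + 1/4) * (Re (Complex s y))\<^sup>2"
      using that by (simp only: complex.sel mult.assoc)
    moreover have "\<bar>y\<bar> \<le> 1" using that by (simp add: abs_square_le_1[symmetric])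
    ultimately show "Complex s y \<in> csq \<and> (Im (Complex s y))\<^sup>2 \<noteq> 16/9 * (Re (Complex s y) + 1/4) * (Re (Complex s y))\<^sup>2"
      using s by (auto simp: csq_def)
  qed (auto intro!: continuous_intros)
  have ver: "face (Complex (-1/2) (1/2)) = face (Complex (-1/2) (-1/2))"
  proof (rule join[of "1/2" "-1/2" "\<lambda>s. Complex (-1/2) s"])
    fix s :: real assume "s \<in> {min (1/2) (-1/2)..max (1/2) (-1/2)}"
    moreover have "s\<^sup>2 \<noteq> - (1/9)" using zero_le_power2[of s] by linarith
    ultimately show "Complex (-1/2) s \<in> csq \<and> (Im (Complex (-1/2) s))\<^sup>2 \<noteq>
        16/9 * (Re (Complex (-1/2) s) + 1/4) * (Re (Complex (-1/2) s))\<^sup>2"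
      by (auto simp: csq_def power2_eq_square)
  qed (auto intro!: continuous_intros)
  have axis: "face (Complex 0 a) = face (Complex 0 b)" if "a * b > 0" "\<bar>a\<bar> \<le> 1" "\<bar>b\<bar> \<le> 1" for a b
  proof (rule join[of a b "\<lambda>s. Complex 0 s"])
    fix s :: real assume "s \<in> {min a b..max a b}"
    then have "s \<noteq> 0" "\<bar>s\<bar> \<le> 1" using that by (auto simp: zero_less_mult_iff min_def max_def split: if_splits)
    then show "Complex 0 s \<in> csq \<and> (Im (Complex 0 s))\<^sup>2 \<noteq> 16/9 * (Re (Complex 0 s) + 1/4) * (Re (Complex 0 s))\<^sup>2"
      by (simp add: csq_def)
  qed (auto intro!: continuous_intros)
  have "face (Complex 0 t) = face (Complex 0 (1/2))" using t by (intro axis) auto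
  also have "\<dots> = face (Complex (-1/2) (1/2))" by (rule hor) (simp add: power2_eq_square)
  also have "\<dots> = face (Complex (-1/2) (-1/2))" by (rule ver)
  also have "\<dots> = face (Complex 0 (-1/2))" by (rule hor[symmetric]) (simp add: power2_eq_square)
  also have "\<dots> = face (Complex 0 (- t))" using t by (intro axis) (auto simp: mult_neg_neg)
  finally show ?thesis .
qed

text \<open>
  The tangents at the crossing are \<open>(1, 2/3)\<close> and \<open>(-1, 2/3)\<close> up to order and a common sign, so the in and out regions are
  above and below it and coincide. Hence the relation at the crossing has the form that makes the
  weight vanish.
\<close>

lemma (in boltzmann_weight) kink_weight_zero:
  assumes L: "oriented_link_diagram L" and looks: "looks_like L h U (picture [kink] \<epsilon> ht)"
    and eps: "\<epsilon> 0 \<in> {1, -1}" and col: "coloring (\<star>) (\<odot>) (dual_graph L) f"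
  shows "(\<Sum>c\<in>{c \<in> crossings L. fst c \<in> U}. crossing_weight \<phi> L f c) = 0"
proof (rule sum.neutral, rule ballI)
  interpret disc_picture L "picture [kink] \<epsilon> ht" h U by (rule kink_disc[OF L looks eps])
  fix c assume c: "c \<in> {c \<in> crossings L. fst c \<in> U}"
  then have cL: "c \<in> crossings L" by simp
  from c have "c \<in> crossings hT" unfolding crossings_inside .
  then obtain s t where c: "c = (h (kink (\<epsilon> 0 * s)), tangent hT 0 s, tangent hT 0 t)"
    and st: "s \<in> {-1<..<1}" "t \<in> {-1<..<1}" "s \<noteq> t" "h (kink (\<epsilon> 0 * s)) = h (kink (\<epsilon> 0 * t))"
    by (auto simp: crossings_def places_def picture_def)
  have "kink (\<epsilon> 0 * s) \<in> csq" "kink (\<epsilon> 0 * t) \<in> csq"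
    using inside[of 0 s] inside[of 0 t] st sq_subset_csq by (auto simp: picture_def)
  then have "kink (\<epsilon> 0 * s) = kink (\<epsilon> 0 * t)" using st(4) h_eq_iff by blast
  then have s: "s\<^sup>2 = 1/4" "t = - s" using st(3) eps by (auto simp: kink_eq_iff)
  have eps2: "(\<epsilon> 0)\<^sup>2 = 1" using eps by auto
  have tan: "tangent hT 0 x = sgn (Dh 0 (Complex (2 * x) (\<epsilon> 0 * (2/3))))" if x: "x\<^sup>2 = 1/4" for x
  proof -
    have ex: "(\<epsilon> 0 * x)\<^sup>2 = 1/4" using x eps2 by (simp add: power_mult_distrib)
    have "((\<lambda>x. \<epsilon> 0 * x) has_vector_derivative \<epsilon> 0) (at x)" by (auto intro!: derivative_eq_intros)
    from vector_diff_chain_at[OF this kink_deriv]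
    have "((\<lambda>x. kink (\<epsilon> 0 * x)) has_vector_derivative
        \<epsilon> 0 *\<^sub>R Complex (2 * (\<epsilon> 0 * x)) (4 * (\<epsilon> 0 * x)\<^sup>2 - 1/3)) (at x)" by (simp add: o_def)
    also have "\<epsilon> 0 *\<^sub>R Complex (2 * (\<epsilon> 0 * x)) (4 * (\<epsilon> 0 * x)\<^sup>2 - 1/3) = Complex (2 * x) (\<epsilon> 0 * (2/3))"
      unfolding ex using eps by (auto simp: complex_eq_iff)
    finally have "((\<lambda>x. h (kink (\<epsilon> 0 * x))) has_vector_derivative Dh 0 (Complex (2 * x) (\<epsilon> 0 * (2/3)))) (at x)"
      by (rule Dh_curve) (simp_all add: kink_zero[OF ex] sq_def)
    then show ?thesis by (simp add: tangent_def picture_def vector_derivative_at)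
  qed
  define a where "a = Complex (2 * s) (\<epsilon> 0 * (2/3))"
  define b where "b = Complex (- 2 * s) (\<epsilon> 0 * (2/3))"
  have "(\<epsilon> 0 * s)\<^sup>2 = 1/4" using s eps2 by (simp add: power_mult_distrib)
  then have c0: "c = (h 0, sgn (Dh 0 a), sgn (Dh 0 b))"
    using tan[of s] tan[of t] s by (simp add: c a_def b_def kink_zero)
  have s0: "s \<noteq> 0" using s by auto
  define m where "m \<longleftrightarrow> s > 0"
  have m: "sgn s = side m" using s0 by (simp add: m_def side_def)
  have nm: "side (\<not> m) = - side m" by (simp add: side_def)
  have d: "det2 a \<i> = 2 * s" "det2 b \<i> = - 2 * s" by (simp_all add: a_def b_def det2_def)
  have zero: "0 \<in> sq" by (simp add: sq_def)
  have "\<forall>\<^sub>F t in at_right 0. corner L c m (\<not> m) = face (0 + t *\<^sub>R \<i>)"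
    unfolding c0 by (rule corner_face[OF zero cL[unfolded c0]]) (simp_all add: d m[symmetric] nm sgn_mult sgn_minus)
  moreover have "\<forall>\<^sub>F t in at_right 0. corner L c (\<not> m) m = face (0 + t *\<^sub>R (- \<i>))"
    unfolding c0 by (rule corner_face[OF zero cL[unfolded c0]])
      (simp_all add: d m[symmetric] nm sgn_mult sgn_minus det2_minus_right)
  moreover have "\<forall>\<^sub>F t in at_right 0. (0::real) < t \<and> t < 1/2"
    by (intro eventually_at_rightI[of 0 "1/2"]) auto
  ultimately have "\<forall>\<^sub>F t in at_right (0::real). corner L c m (\<not> m) = corner L c (\<not> m) m"
  proof eventually_elim
    case (elim t)
    have "t *\<^sub>R \<i> = Complex 0 t" "t *\<^sub>R (- \<i>) = Complex 0 (- t)" by (simp_all add: complex_eq_iff)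
    then show ?case using elim kink_faces[OF disc_picture_axioms, of t] by simp
  qed
  then have "corner L c m (\<not> m) = corner L c (\<not> m) m"
    using eventually_happens'[OF trivial_limit_at_right_real] by blast
  then have "corner L c True False = corner L c False True" by (cases m) simp_all
  then have "f (corner L c False True) = f (corner L c False True) \<star> (f (corner L c True True) \<odot> f (corner L c False False))"
    using col cL unfolding coloring_corners by metis
  from weight_loop[OF this] show "crossing_weight \<phi> L f c = 0"
    by (simp add: crossing_weight_def signed_def)
qed

lemma vertical_arc_weight_zero:
  assumes L: "oriented_link_diagram L"
    and looks: "looks_like L h U (picture [\<lambda>s. Complex (3/4) s] \<epsilon> ht)" and eps: "\<epsilon> 0 \<in> {1, -1}"
  shows "(\<Sum>c\<in>{c \<in> crossings L. fst c \<in> U}. crossing_weight \<phi> L f c) = 0"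
proof -
  have e: "\<bar>\<epsilon> 0 * s\<bar> = \<bar>s\<bar>" for s using eps by auto
  interpret disc_picture L "picture [\<lambda>s. Complex (3/4) s] \<epsilon> ht" h U
  proof
    show "curve (picture [\<lambda>s. Complex (3/4) s] \<epsilon> ht) k s \<in> sq"
      if "k < num (picture [\<lambda>s. Complex (3/4) s] \<epsilon> ht)" "s \<in> {-1<..<1}" for k s
    proof -
      have "\<bar>s\<bar> < 1" "k = 0" using that by (auto simp: picture_def abs_less_iff)
      then show ?thesis by (simp add: picture_def e sq_def)
    qed
    show "endpoints (picture [\<lambda>s. Complex (3/4) s] \<epsilon> ht) \<subseteq> csq"
      using e[of 1] e[of "-1"] by (auto simp: endpoints_def picture_def csq_def)
  qed (use L looks in \<open>simp_all add: picture_def\<close>)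
  have "crossings hT = {}"
  proof (rule equals0I)
    fix c assume "c \<in> crossings hT"
    then obtain s t where st: "s \<in> {-1<..<1}" "t \<in> {-1<..<1}" "s \<noteq> t"
      "h (Complex (3/4) (\<epsilon> 0 * s)) = h (Complex (3/4) (\<epsilon> 0 * t))"
      by (auto simp: crossings_def places_def picture_def)
    have "Complex (3/4) (\<epsilon> 0 * x) \<in> csq" if "x \<in> {-1<..<1}" for x
    proof -
      have "\<bar>x\<bar> \<le> 1" using that by (auto simp: abs_le_iff)
      then show ?thesis by (simp add: csq_def e)
    qed
    then have "Complex (3/4) (\<epsilon> 0 * s) = Complex (3/4) (\<epsilon> 0 * t)" using st h_eq_iff by blast
    then show False using st(3) eps by auto
  qed
  then show ?thesis unfolding crossings_inside by simp
qed

section \<open>The second move\<close>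

definition bigon_graphs :: "(real \<Rightarrow> real) list" where
  "bigon_graphs = [\<lambda>s. 1/4 - s\<^sup>2 / 2, \<lambda>s. s\<^sup>2 / 2 - 1/4]"

definition parallel_graphs :: "(real \<Rightarrow> real) list" where
  "parallel_graphs = [\<lambda>s. - 1/4, \<lambda>s. 1/4]"

lemma bigon_parallel_length: "length bigon_graphs = 2" "length parallel_graphs = 2"
  by (simp_all add: bigon_graphs_def parallel_graphs_def)

lemma bigon_crossings: "graph_crossings bigon_graphs = {(0, 1, sqrt (1/2)), (0, 1, - sqrt (1/2))}"
proof (rule set_eqI, clarify)
  fix i j :: nat and y :: real
  have "y\<^sup>2 = 1/2 \<longleftrightarrow> \<bar>y\<bar> = sqrt (1/2)"
    by (metis real_sqrt_abs real_sqrt_eq_iff)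
  moreover have "y\<^sup>2 = 1/2 \<Longrightarrow> \<bar>y\<bar> < 1" by (simp add: abs_square_less_1[symmetric])
  moreover have "i < j \<and> j < 2 \<longleftrightarrow> i = 0 \<and> j = 1" by auto
  ultimately show "(i, j, y) \<in> graph_crossings bigon_graphs \<longleftrightarrow>
      (i, j, y) \<in> {(0, 1, sqrt (1/2)), (0, 1, - sqrt (1/2))}"
    unfolding graph_crossings_def bigon_graphs_def by (auto simp: abs_if split: if_splits)
qed

lemma bigon_disc:
  assumes "oriented_link_diagram L" "looks_like L h U (graph_picture bigon_graphs \<epsilon> \<eta>)"
    and "\<forall>k<2. \<epsilon> k \<in> {1, -1}" "inj_on \<eta> {..<2}"
  shows "graph_disc L h U bigon_graphs (\<lambda>k y. [- y, y] ! k) \<epsilon> \<eta>"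
proof
  show "(bigon_graphs ! k has_real_derivative [- y, y] ! k) (at y)" if "k < length bigon_graphs" for k y
    using that unfolding bigon_parallel_length less_2_cases_iff
    by (auto simp: bigon_graphs_def intro!: derivative_eq_intros)
  show "\<bar>g y\<bar> < 1" if "g \<in> set bigon_graphs" "\<bar>y\<bar> \<le> 1" for g y
  proof -
    have "y\<^sup>2 \<le> 1" using that(2) by (simp add: abs_square_le_1)
    then have "\<bar>1/4 - y\<^sup>2 / 2\<bar> < 1" "\<bar>y\<^sup>2 / 2 - 1/4\<bar> < 1" using zero_le_power2[of y] by linarith+
    then show ?thesis using that(1) by (auto simp: bigon_graphs_def)
  qed
  show "inj_on (\<lambda>(i, j, y). y) (graph_crossings bigon_graphs)"
    unfolding bigon_crossings by (auto simp: inj_on_def)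
qed (use assms in \<open>simp_all add: bigon_parallel_length\<close>)

lemma parallel_disc:
  assumes "oriented_link_diagram L" "looks_like L h U (graph_picture parallel_graphs \<epsilon> \<eta>)"
    and "\<forall>k<2. \<epsilon> k \<in> {1, -1}" "inj_on \<eta> {..<2}"
  shows "graph_disc L h U parallel_graphs (\<lambda>k y. 0) \<epsilon> \<eta>" and "graph_crossings parallel_graphs = {}"
proof -
  show none: "graph_crossings parallel_graphs = {}"
    by (auto simp: graph_crossings_def parallel_graphs_def less_Suc_eq)
  show "graph_disc L h U parallel_graphs (\<lambda>k y. 0) \<epsilon> \<eta>"
  proof
    show "(parallel_graphs ! k has_real_derivative 0) (at y)" if "k < length parallel_graphs" for k y
      using that unfolding bigon_parallel_length less_2_cases_iff by (auto simp: parallel_graphs_def)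
    show "inj_on (\<lambda>(i, j, y). y) (graph_crossings parallel_graphs)" unfolding none by simp
    show "\<bar>g y\<bar> < 1" if "g \<in> set parallel_graphs" "\<bar>y\<bar> \<le> 1" for g y
      using that by (auto simp: parallel_graphs_def)
  qed (use assms in \<open>simp_all add: bigon_parallel_length\<close>)
qed

text \<open>
  The two crossings have opposite signs, and the same colors at their corners. The faces above and below
  the bigon are different pieces of one pattern of sides; they have the same color because both touch
  the boundary of the disc at points that the middle strip of the other picture connects.
\<close>

lemma bigon_weight_zero:
  fixes f :: "complex set \<Rightarrow> 'x" and \<phi> :: "'x \<Rightarrow> 'x \<Rightarrow> 'x \<Rightarrow> 'b::ab_group_add"
  assumes L: "oriented_link_diagram L" and L': "oriented_link_diagram L'"
    and looks: "looks_like L h U (graph_picture bigon_graphs \<epsilon> \<eta>)"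
    and looks': "looks_like L' h' U (graph_picture parallel_graphs \<epsilon> \<eta>)"
    and eps: "\<forall>k<2. \<epsilon> k \<in> {1, -1}" and ord: "inj_on \<eta> {..<2}"
    and bd: "\<forall>z\<in>csq - sq. h z = h' z"
    and agree: "agree_outside U (dual_graph L) f (dual_graph L') f'"
  shows "(\<Sum>c\<in>{c \<in> crossings L. fst c \<in> U}. crossing_weight \<phi> L f c) = 0"
proof -
  interpret D: graph_disc L h U bigon_graphs "\<lambda>k y. [- y, y] ! k" \<epsilon> \<eta>
    by (rule bigon_disc[OF L looks eps ord])
  interpret D': graph_disc L' h' U parallel_graphs "\<lambda>k y. 0" \<epsilon> \<eta>
    by (rule parallel_disc[OF L' looks' eps ord])
  have off: "off_graphs bigon_graphs q \<longleftrightarrow> Re q \<noteq> 1/4 - (Im q)\<^sup>2 / 2 \<and> Re q \<noteq> (Im q)\<^sup>2 / 2 - 1/4" for q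
    by (auto simp: off_graphs_def bigon_graphs_def)
  have pat: "pattern bigon_graphs q = [Re q < 1/4 - (Im q)\<^sup>2 / 2, Re q < (Im q)\<^sup>2 / 2 - 1/4]" for q
    by (simp add: pattern_def bigon_graphs_def)
  have top_bottom: "f (D.face (Complex 0 1)) = f (D.face (Complex 0 (-1)))"
  proof -
    have b: "f (D.face q) = f' (D'.face q)" if "q = Complex 0 1 \<or> q = Complex 0 (-1)" for q
    proof (rule boundary_faces_agree[OF D.disc_picture_axioms D'.disc_picture_axioms agree bd])
      have "off_graphs bigon_graphs q" "off_graphs parallel_graphs q"
        using that by (auto simp: off_graphs_def bigon_graphs_def parallel_graphs_def)
      then show "q \<notin> underlying D.T" "q \<notin> endpoints D.T" "q \<notin> underlying D'.T" "q \<notin> endpoints D'.T"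
        using D.off_graphs_avoids D'.off_graphs_avoids by blast+
    qed (use that in \<open>auto simp: csq_def sq_def\<close>)
    have "D'.face (Complex 0 1) = D'.face (Complex 0 (-1))"
    proof (rule D'.same_pattern_face[where I = "{-1..1}"])
      fix i j assume "i < length parallel_graphs" "j < length parallel_graphs"
        "\<not> pattern parallel_graphs (Complex 0 1) ! i" "pattern parallel_graphs (Complex 0 1) ! j"
      then have "i = 0 \<and> j = 1"
        by (auto simp: parallel_graphs_def pattern_def less_Suc_eq)
      then have "{y \<in> {-1..1}. (parallel_graphs ! i) y < (parallel_graphs ! j) y} = {-1..1}"
        by (auto simp: parallel_graphs_def)
      then show "convex {y \<in> {-1..1}. (parallel_graphs ! i) y < (parallel_graphs ! j) y}" by simp
    qed (auto simp: parallel_graphs_def pattern_def off_graphs_def)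
    then show ?thesis using b by simp
  qed
  define C where "C s = (if s = [True, True] then f (D.face (Complex (-3/4) 0))
      else if s = [False, False] then f (D.face (Complex (3/4) 0))
      else if s = [True, False] then f (D.face 0) else f (D.face (Complex 0 1)))" for s
  have C: "f (D.face q) = C (pattern bigon_graphs q)" if q: "q \<in> sq" "off_graphs bigon_graphs q" for q
  proof -
    have join: "D.face q = D.face q'"
      if I: "convex I" "I \<subseteq> {-1..1}" "Im q \<in> I" "Im q' \<in> I" and q': "\<bar>Re q'\<bar> < 1" "off_graphs bigon_graphs q'"
        "pattern bigon_graphs q' = pattern bigon_graphs q"
        \<comment> \<open>only these two patterns compare one graph with the other\<close>
        and c0: "pattern bigon_graphs q = [True, False] \<Longrightarrow> convex {y \<in> I. y\<^sup>2 < 1/2}"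
        and c1: "pattern bigon_graphs q = [False, True] \<Longrightarrow> convex {y \<in> I. y\<^sup>2 > 1/2}"
      for q' I
    proof (rule D.same_pattern_face[OF _ I q(1)[unfolded sq_def, simplified, THEN conjunct1] q'(1) q(2) q'(2,3)])
      fix i j assume ij: "i < length bigon_graphs" "j < length bigon_graphs"
        "\<not> pattern bigon_graphs q ! i" "pattern bigon_graphs q ! j"
      then have "(i = 1 \<and> j = 0 \<and> pattern bigon_graphs q = [True, False]) \<or>
          (i = 0 \<and> j = 1 \<and> pattern bigon_graphs q = [False, True])"
        by (auto simp: bigon_graphs_def pattern_def less_Suc_eq)
      then show "convex {y \<in> I. (bigon_graphs ! i) y < (bigon_graphs ! j) y}"
      proof
        assume a: "i = 1 \<and> j = 0 \<and> pattern bigon_graphs q = [True, False]"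
        have "{y \<in> I. (bigon_graphs ! i) y < (bigon_graphs ! j) y} = {y \<in> I. y\<^sup>2 < 1/2}"
          using a by (auto simp: bigon_graphs_def)
        then show ?thesis using c0 a by simp
      next
        assume a: "i = 0 \<and> j = 1 \<and> pattern bigon_graphs q = [False, True]"
        have "{y \<in> I. (bigon_graphs ! i) y < (bigon_graphs ! j) y} = {y \<in> I. y\<^sup>2 > 1/2}"
          using a by (auto simp: bigon_graphs_def)
        then show ?thesis using c1 a by simp
      qed
    qed
    have y: "Im q \<in> {-1..1}" using q(1) by (auto simp: sq_def)
    consider "pattern bigon_graphs q = [True, True]" | "pattern bigon_graphs q = [False, False]"
      | "pattern bigon_graphs q = [True, False]" | "pattern bigon_graphs q = [False, True]"
      unfolding pat by auto
    then show ?thesis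
    proof cases
      case 1
      have "D.face q = D.face (Complex (-3/4) 0)"
        by (rule join[of "{-1..1}"]) (use 1 y in \<open>auto simp: off pat\<close>)
      then show ?thesis using 1 by (simp add: C_def)
    next
      case 2
      have "D.face q = D.face (Complex (3/4) 0)"
        by (rule join[of "{-1..1}"]) (use 2 y in \<open>auto simp: off pat\<close>)
      then show ?thesis using 2 by (simp add: C_def)
    next
      case 3
      have sq_lt: "y\<^sup>2 < 1/2 \<longleftrightarrow> \<bar>y\<bar> < sqrt (1/2)" for y :: real
        by (metis real_sqrt_abs real_sqrt_less_iff)
      have "{y \<in> {-1..1}. y\<^sup>2 < 1/2} = {-1..1} \<inter> {- sqrt (1/2)<..<sqrt (1/2)}"
        unfolding sq_lt abs_less_iff by auto
      then have "convex {y \<in> {-1..1::real}. y\<^sup>2 < 1/2}" by (simp add: convex_Int)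
      then have "D.face q = D.face 0"
        by (intro join[of "{-1..1}"]) (use 3 y in \<open>auto simp: off pat\<close>)
      then show ?thesis using 3 by (simp add: C_def)
    next
      case 4
      have sq_gt: "1/2 < y\<^sup>2 \<longleftrightarrow> sqrt (1/2) < \<bar>y\<bar>" for y :: real
        by (metis real_sqrt_abs real_sqrt_less_iff)
      have "f (D.face q) = f (D.face (Complex 0 1))"
      proof (cases "Im q \<ge> 0")
        case True
        have "{y \<in> {0..1}. 1/2 < y\<^sup>2} = {0..1} \<inter> {sqrt (1/2)<..}" unfolding sq_gt by auto
        then have "convex {y \<in> {0..1::real}. 1/2 < y\<^sup>2}" by (simp add: convex_Int)
        then have "D.face q = D.face (Complex 0 1)"
          by (intro join[of "{0..1}"]) (use 4 y True in \<open>auto simp: off pat\<close>)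
        then show ?thesis by simp
      next
        case False
        have "{y \<in> {-1..0}. 1/2 < y\<^sup>2} = {-1..0} \<inter> {..<- sqrt (1/2)}" unfolding sq_gt by auto
        then have "convex {y \<in> {-1..0::real}. 1/2 < y\<^sup>2}" by (simp add: convex_Int)
        then have "D.face q = D.face (Complex 0 (-1))"
          by (intro join[of "{-1..0}"]) (use 4 y False in \<open>auto simp: off pat\<close>)
        then show ?thesis using top_bottom by simp
      qed
      then show ?thesis using 4 by (simp add: C_def)
    qed
  qed
  let ?r = "sqrt (1/2) :: real"
  have at: "pattern bigon_graphs (Complex ((bigon_graphs ! 0) y) y) = [False, False]" if "y\<^sup>2 = 1/2" for y
    using that unfolding pat by (simp add: bigon_graphs_def)
  have r: "?r > 0" "?r\<^sup>2 = 1/2" "(- ?r)\<^sup>2 = 1/2" by simp_all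
  have eps01: "\<epsilon> 0 * \<epsilon> 1 \<in> {1, -1}" using eps[rule_format, of 0] eps[rule_format, of 1] by auto
  have "a \<in> {1, -1} \<Longrightarrow> r > 0 \<Longrightarrow> (a * (- r - r) > 0) \<longleftrightarrow> \<not> (a * (r + r) > 0)" for a r :: real
    by auto
  from this[OF eps01 r(1)]
  have "D.graph_weight \<phi> C (0, 1, ?r) + D.graph_weight \<phi> C (0, 1, - ?r) = 0"
    unfolding D.graph_weight_def prod.case at[OF r(2)] at[OF r(3)] by (simp add: signed_def)
  moreover have "(0, 1, ?r) \<noteq> (0, 1, - ?r)" using r(1) by auto
  moreover have "(\<Sum>c\<in>{c \<in> crossings L. fst c \<in> U}. crossing_weight \<phi> L f c) =
      (\<Sum>x\<in>graph_crossings bigon_graphs. D.graph_weight \<phi> C x)"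
    by (rule D.inside_weight) (rule C)
  ultimately show ?thesis unfolding bigon_crossings by simp
qed

lemma parallel_weight_zero:
  assumes "oriented_link_diagram L" "looks_like L h U (graph_picture parallel_graphs \<epsilon> \<eta>)"
    and "\<forall>k<2. \<epsilon> k \<in> {1, -1}" "inj_on \<eta> {..<2}"
  shows "(\<Sum>c\<in>{c \<in> crossings L. fst c \<in> U}. crossing_weight \<phi> L f c) = 0"
proof -
  interpret D: graph_disc L h U parallel_graphs "\<lambda>k y. 0" \<epsilon> \<eta>
    by (rule parallel_disc[OF assms])
  show ?thesis unfolding D.crossings_inside_graph parallel_disc(2)[OF assms] by simp
qed

section \<open>The third move\<close>

text \<open>
  The picture before the third move is the case \<open>\<kappa> = 1\<close>, the one after it the case \<open>\<kappa> = -1\<close>.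
\<close>

definition triangle_graphs :: "real \<Rightarrow> (real \<Rightarrow> real) list" where
  "triangle_graphs \<kappa> = [\<lambda>s. s/2, \<lambda>s. \<kappa> * (1 - s\<^sup>2) / 4, \<lambda>s. - s/2]"

definition triangle_slopes :: "real \<Rightarrow> nat \<Rightarrow> real \<Rightarrow> real" where
  "triangle_slopes \<kappa> k y = [1/2, - \<kappa> * y / 2, - 1/2] ! k"

lemma triangle_length: "length (triangle_graphs \<kappa>) = 3"
  by (simp add: triangle_graphs_def)

text \<open>
  On \<open>[-1,1]\<close> the difference of the arc and the first line has the factor \<open>r - y\<close> and a positive cofactor,
  where \<open>r\<close> is the positive root of \<open>y\<^sup>2 + 2 y = 1\<close>; the other line is the mirror image of the first one.
  Thus the comparison of any two graphs cuts out a half-line, so that all patterns of sides belong to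
  connected faces.
\<close>

lemma arc_meets_line:
  fixes y :: real
  assumes "\<bar>y\<bar> \<le> 1" defines "r \<equiv> sqrt 2 - 1"
  shows "y / 2 < (1 - y\<^sup>2) / 4 \<longleftrightarrow> y < r" and "(1 - y\<^sup>2) / 4 < y / 2 \<longleftrightarrow> r < y"
    and "- y / 2 < (1 - y\<^sup>2) / 4 \<longleftrightarrow> - r < y" and "(1 - y\<^sup>2) / 4 < - y / 2 \<longleftrightarrow> y < - r"
proof -
  have r: "r > 0" "r\<^sup>2 = 1 - 2 * r" by (simp_all add: r_def power2_eq_square algebra_simps)
  have main: "(1 - x\<^sup>2) / 4 - x / 2 = (r - x) * (x + r + 2) / 4" for x
    using r(2) by (simp add: power2_eq_square field_simps)
  have pos: "x + r + 2 > 0" if "\<bar>x\<bar> \<le> 1" for x using that r(1) by linarith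
  have lt: "x / 2 < (1 - x\<^sup>2) / 4 \<longleftrightarrow> x < r" and gt: "(1 - x\<^sup>2) / 4 < x / 2 \<longleftrightarrow> r < x" if "\<bar>x\<bar> \<le> 1" for x
  proof -
    have "x / 2 < (1 - x\<^sup>2) / 4 \<longleftrightarrow> 0 < (r - x) * (x + r + 2) / 4" using main[of x] by linarith
    then show "x / 2 < (1 - x\<^sup>2) / 4 \<longleftrightarrow> x < r" using pos[OF that] by (simp add: zero_less_mult_iff)
    have "(1 - x\<^sup>2) / 4 < x / 2 \<longleftrightarrow> (r - x) * (x + r + 2) / 4 < 0" using main[of x] by linarith
    then show "(1 - x\<^sup>2) / 4 < x / 2 \<longleftrightarrow> r < x" using pos[OF that] by (simp add: mult_less_0_iff)
  qed
  show "y / 2 < (1 - y\<^sup>2) / 4 \<longleftrightarrow> y < r" "(1 - y\<^sup>2) / 4 < y / 2 \<longleftrightarrow> r < y"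
    using lt[OF assms(1)] gt[OF assms(1)] by blast+
  have "\<bar>- y\<bar> \<le> 1" using assms(1) by simp
  from lt[OF this] gt[OF this]
  show "- y / 2 < (1 - y\<^sup>2) / 4 \<longleftrightarrow> - r < y" "(1 - y\<^sup>2) / 4 < - y / 2 \<longleftrightarrow> y < - r"
    by auto
qed

lemma triangle_order:
  fixes y :: real
  assumes "\<bar>y\<bar> \<le> 1" "\<kappa> \<in> {1, -1}" defines "r \<equiv> \<kappa> * (sqrt 2 - 1)"
  shows "y / 2 < \<kappa> * (1 - y\<^sup>2) / 4 \<longleftrightarrow> y < r" and "\<kappa> * (1 - y\<^sup>2) / 4 < y / 2 \<longleftrightarrow> r < y"
    and "- y / 2 < \<kappa> * (1 - y\<^sup>2) / 4 \<longleftrightarrow> - r < y" and "\<kappa> * (1 - y\<^sup>2) / 4 < - y / 2 \<longleftrightarrow> y < - r"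
proof -
  define X where "X = (1 - y\<^sup>2) / 4"
  note a = arc_meets_line[OF assms(1), folded X_def]
  have \<kappa>X: "\<kappa> * (1 - y\<^sup>2) / 4 = \<kappa> * X" by (simp add: X_def)
  have flip: "y / 2 < - X \<longleftrightarrow> X < - y / 2" "- X < y / 2 \<longleftrightarrow> - y / 2 < X"
    "- y / 2 < - X \<longleftrightarrow> X < y / 2" "- X < - y / 2 \<longleftrightarrow> y / 2 < X" by arith+
  consider "\<kappa> = 1" | "\<kappa> = - 1" using assms(2) by blast
  then have "(y / 2 < \<kappa> * X \<longleftrightarrow> y < r) \<and> (\<kappa> * X < y / 2 \<longleftrightarrow> r < y) \<and>
      (- y / 2 < \<kappa> * X \<longleftrightarrow> - r < y) \<and> (\<kappa> * X < - y / 2 \<longleftrightarrow> y < - r)"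
  proof cases
    case 1 then show ?thesis unfolding r_def 1 mult_1_left using a by blast
  next
    case 2 then show ?thesis unfolding r_def 2 mult_minus1 flip minus_minus using a by blast
  qed
  then show "y / 2 < \<kappa> * (1 - y\<^sup>2) / 4 \<longleftrightarrow> y < r" "\<kappa> * (1 - y\<^sup>2) / 4 < y / 2 \<longleftrightarrow> r < y"
    "- y / 2 < \<kappa> * (1 - y\<^sup>2) / 4 \<longleftrightarrow> - r < y" "\<kappa> * (1 - y\<^sup>2) / 4 < - y / 2 \<longleftrightarrow> y < - r"
    unfolding \<kappa>X by blast+
qed

lemma triangle_crossings:
  assumes "\<kappa> \<in> {1, -1}" defines "r \<equiv> \<kappa> * (sqrt 2 - 1)"
  shows "graph_crossings (triangle_graphs \<kappa>) = {(0, 1, r), (0, 2, 0), (1, 2, - r)}"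
proof (rule set_eqI, clarify)
  fix i j :: nat and y :: real
  have pairs: "i < j \<and> j < 3 \<longleftrightarrow> (i = 0 \<and> j = 1) \<or> (i = 0 \<and> j = 2) \<or> (i = 1 \<and> j = 2)" by auto
  have "sqrt 2 < 2" by (rule real_less_lsqrt) simp_all
  then have r1: "\<bar>r\<bar> < 1" using assms(1) by (auto simp: r_def)
  have e01: "y / 2 = \<kappa> * (1 - y\<^sup>2) / 4 \<longleftrightarrow> y = r" and e12: "\<kappa> * (1 - y\<^sup>2) / 4 = - y / 2 \<longleftrightarrow> y = - r"
    if "\<bar>y\<bar> < 1"
    using triangle_order[OF less_imp_le[OF that] assms(1), folded r_def] by linarith+
  show "(i, j, y) \<in> graph_crossings (triangle_graphs \<kappa>) \<longleftrightarrow> (i, j, y) \<in> {(0, 1, r), (0, 2, 0), (1, 2, - r)}"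
  proof (cases "\<bar>y\<bar> < 1")
    case True
    have "(i, j, y) \<in> graph_crossings (triangle_graphs \<kappa>) \<longleftrightarrow>
       (i = 0 \<and> j = 1 \<and> y / 2 = \<kappa> * (1 - y\<^sup>2) / 4) \<or> (i = 0 \<and> j = 2 \<and> y / 2 = - y / 2) \<or>
       (i = 1 \<and> j = 2 \<and> \<kappa> * (1 - y\<^sup>2) / 4 = - y / 2)"
      unfolding graph_crossings_def mem_Collect_eq prod.case triangle_length conj_assoc[symmetric] pairs
      using True by (auto simp: triangle_graphs_def)
    then show ?thesis unfolding e01[OF True] e12[OF True] by auto
  next
    case False
    then have "y \<noteq> r" "y \<noteq> - r" "y \<noteq> 0" using r1 by auto
    then show ?thesis using False by (simp add: graph_crossings_def)
  qed
qed

lemma triangle_disc: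
  assumes L: "oriented_link_diagram L" and "looks_like L h U (graph_picture (triangle_graphs \<kappa>) \<epsilon> \<eta>)"
    and "\<forall>k<3. \<epsilon> k \<in> {1, -1}" "inj_on \<eta> {..<3}" and \<kappa>: "\<kappa> \<in> {1, -1}"
  shows "graph_disc L h U (triangle_graphs \<kappa>) (triangle_slopes \<kappa>) \<epsilon> \<eta>"
proof
  show "(triangle_graphs \<kappa> ! k has_real_derivative triangle_slopes \<kappa> k y) (at y)"
    if "k < length (triangle_graphs \<kappa>)" for k y
  proof -
    have "k = 0 \<or> k = 1 \<or> k = 2" using that unfolding triangle_length by linarith
    then show ?thesis
      by (elim disjE) (auto simp: triangle_graphs_def triangle_slopes_def intro!: derivative_eq_intros)
  qed
  show "\<bar>g y\<bar> < 1" if "g \<in> set (triangle_graphs \<kappa>)" "\<bar>y\<bar> \<le> 1" for g y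
  proof -
    have "y\<^sup>2 \<le> 1" using that(2) by (simp add: abs_square_le_1)
    moreover have "- y\<^sup>2 < 3" using zero_le_power2[of y] by linarith
    ultimately have "\<bar>(1 - y\<^sup>2) / 4\<bar> < 1" by (simp add: abs_less_iff)
    moreover have "\<bar>\<kappa> * (1 - y\<^sup>2) / 4\<bar> = \<bar>(1 - y\<^sup>2) / 4\<bar>" using \<kappa> by auto
    moreover have "\<bar>y / 2\<bar> < 1" using that(2) by linarith
    ultimately show ?thesis using that(1) by (auto simp: triangle_graphs_def)
  qed
  show "inj_on (\<lambda>(i, j, y). y) (graph_crossings (triangle_graphs \<kappa>))"
    unfolding triangle_crossings[OF \<kappa>] using \<kappa> by (auto simp: inj_on_def)
qed (use assms in \<open>simp_all add: triangle_length\<close>)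

lemma triangle_pattern:
  "pattern (triangle_graphs \<kappa>) q = [Re q < Im q / 2, Re q < \<kappa> * (1 - (Im q)\<^sup>2) / 4, Re q < - Im q / 2]"
  by (simp add: pattern_def triangle_graphs_def)

lemma triangle_off:
  "off_graphs (triangle_graphs \<kappa>) q \<longleftrightarrow>
    Re q \<noteq> Im q / 2 \<and> Re q \<noteq> \<kappa> * (1 - (Im q)\<^sup>2) / 4 \<and> Re q \<noteq> - Im q / 2"
  by (simp add: off_graphs_def triangle_graphs_def)

text \<open>
  Of the eight patterns, each picture lacks the one of the central triangle of the other picture.
\<close>

lemma triangle_absent_pattern:
  assumes "\<bar>Im q\<bar> \<le> 1"
  shows "pattern (triangle_graphs 1) q \<noteq> [True, False, True]"
    and "off_graphs (triangle_graphs (-1)) q \<Longrightarrow> pattern (triangle_graphs (-1)) q \<noteq> [False, True, False]"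
proof -
  have "(Im q)\<^sup>2 \<le> 1" using assms by (simp add: abs_square_le_1)
  then show "pattern (triangle_graphs 1) q \<noteq> [True, False, True]"
    and "off_graphs (triangle_graphs (-1)) q \<Longrightarrow> pattern (triangle_graphs (-1)) q \<noteq> [False, True, False]"
    unfolding triangle_pattern by auto
qed

lemma triangle_face:
  assumes "graph_disc L h U (triangle_graphs \<kappa>) (triangle_slopes \<kappa>) \<epsilon> \<eta>" and \<kappa>: "\<kappa> \<in> {1, -1}"
    and "q \<in> sq" "off_graphs (triangle_graphs \<kappa>) q" "q' \<in> csq" "\<bar>Re q'\<bar> < 1" "off_graphs (triangle_graphs \<kappa>) q'"
    and "pattern (triangle_graphs \<kappa>) q' = pattern (triangle_graphs \<kappa>) q"
  shows "disc_picture.face L h q = disc_picture.face L h q'"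
proof -
  interpret graph_disc L h U "triangle_graphs \<kappa>" "triangle_slopes \<kappa>" \<epsilon> \<eta> by (rule assms(1))
  let ?r = "\<kappa> * (sqrt 2 - 1)"
  show ?thesis
  proof (rule same_pattern_face[where I = "{-1..1}"])
    fix i j assume ij: "i < length (triangle_graphs \<kappa>)" "j < length (triangle_graphs \<kappa>)"
    have 0: "\<bar>y\<bar> \<le> 1" if "y \<in> {-1..1}" for y :: real using that by auto
    note o = triangle_order[OF 0 \<kappa>]
    have cut: "convex {y \<in> {-1..1::real}. P y}" if "\<And>y. y \<in> {-1..1} \<Longrightarrow> P y \<longleftrightarrow> y \<in> H" "convex H" for P H
    proof -
      have "{y \<in> {-1..1}. P y} = {-1..1} \<inter> H" using that(1) by auto
      then show ?thesis using that(2) by (simp add: convex_Int)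
    qed
    have "i = 0 \<or> i = 1 \<or> i = 2" "j = 0 \<or> j = 1 \<or> j = 2" using ij unfolding triangle_length by linarith+
    then consider "i = j" | "i = 0 \<and> j = 1" | "i = 1 \<and> j = 0" | "i = 2 \<and> j = 1" | "i = 1 \<and> j = 2"
      | "i = 0 \<and> j = 2" | "i = 2 \<and> j = 0" by auto
    then show "convex {y \<in> {-1..1}. (triangle_graphs \<kappa> ! i) y < (triangle_graphs \<kappa> ! j) y}"
    proof cases
      case 2 show ?thesis by (rule cut[of _ "{..<?r}"]) (use o(1) 2 in \<open>simp_all add: triangle_graphs_def\<close>)
    next
      case 3 show ?thesis by (rule cut[of _ "{?r<..}"]) (use o(2) 3 in \<open>simp_all add: triangle_graphs_def\<close>)
    next
      case 4 show ?thesis by (rule cut[of _ "{- ?r<..}"]) (use o(3) 4 in \<open>simp_all add: triangle_graphs_def\<close>)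
    next
      case 5 show ?thesis by (rule cut[of _ "{..<- ?r}"]) (use o(4) 5 in \<open>simp_all add: triangle_graphs_def\<close>)
    next
      case 6 show ?thesis by (rule cut[of _ "{..<0}"]) (use 6 in \<open>auto simp: triangle_graphs_def\<close>)
    next
      case 7 show ?thesis by (rule cut[of _ "{0<..}"]) (use 7 in \<open>auto simp: triangle_graphs_def\<close>)
    qed simp
  qed (use assms(3-8) in \<open>auto simp: sq_def csq_def\<close>)
qed

text \<open>
  The crossing of two strands occurs on different sides of the third one in the two pictures, which is the
  only dependence on \<open>\<kappa>\<close>; all three differences of slopes are positive in both of them.
\<close>

lemma triangle_picture_weight:
  fixes \<phi> :: "'x \<Rightarrow> 'x \<Rightarrow> 'x \<Rightarrow> 'b::ab_group_add"
  assumes D: "graph_disc L h U (triangle_graphs \<kappa>) (triangle_slopes \<kappa>) \<epsilon> \<eta>" and \<kappa>: "\<kappa> \<in> {1, -1}"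
    and C: "\<forall>q\<in>sq. off_graphs (triangle_graphs \<kappa>) q \<longrightarrow>
      f (disc_picture.face L h q) = C (pattern (triangle_graphs \<kappa>) q)"
    and col: "coloring star dot (dual_graph L) f"
  defines "S \<equiv> \<lambda>i j. signed ((\<epsilon> i * \<epsilon> j > 0) = (\<eta> j < \<eta> i))"
  shows "(\<Sum>c\<in>{c \<in> crossings L. fst c \<in> U}. crossing_weight \<phi> L f c) =
      S 0 1 (pair_weight \<phi> \<epsilon> \<eta> C [False, False, \<kappa> < 0] 0 1) +
      S 0 2 (pair_weight \<phi> \<epsilon> \<eta> C [False, \<kappa> > 0, False] 0 2) +
      S 1 2 (pair_weight \<phi> \<epsilon> \<eta> C [\<kappa> < 0, False, False] 1 2)"
    and "pair_relation star dot \<epsilon> \<eta> C [False, False, \<kappa> < 0] 0 1"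
    and "pair_relation star dot \<epsilon> \<eta> C [False, \<kappa> > 0, False] 0 2"
    and "pair_relation star dot \<epsilon> \<eta> C [\<kappa> < 0, False, False] 1 2"
proof -
  interpret graph_disc L h U "triangle_graphs \<kappa>" "triangle_slopes \<kappa>" \<epsilon> \<eta> by (rule D)
  define r where "r = \<kappa> * (sqrt 2 - 1)"
  have "(sqrt 2 - 1)\<^sup>2 = 1 - 2 * (sqrt 2 - 1)" "sqrt 2 - 1 > (0::real)"
    by (simp_all add: power2_eq_square algebra_simps)
  then have r: "\<kappa> * (1 - r\<^sup>2) / 4 = r / 2" "r > 0 \<longleftrightarrow> \<kappa> > 0" "r \<noteq> 0" "\<kappa> * r > 0"
    using \<kappa> by (auto simp: r_def power_mult_distrib)
  have rsign: "r < 0 \<longleftrightarrow> \<kappa> < 0" using r(2,3) \<kappa> by auto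
  note cr = triangle_crossings[OF \<kappa>, folded r_def]
  have p01: "pattern (triangle_graphs \<kappa>) (Complex ((triangle_graphs \<kappa> ! 0) r) r) = [False, False, \<kappa> < 0]"
    unfolding triangle_pattern rsign[symmetric] by (simp add: triangle_graphs_def r(1)[simplified])
  have p02: "pattern (triangle_graphs \<kappa>) (Complex ((triangle_graphs \<kappa> ! 0) 0) 0) = [False, \<kappa> > 0, False]"
    unfolding triangle_pattern by (simp add: triangle_graphs_def)
  have p12: "pattern (triangle_graphs \<kappa>) (Complex ((triangle_graphs \<kappa> ! 1) (- r)) (- r)) = [\<kappa> < 0, False, False]"
    unfolding triangle_pattern rsign[symmetric] by (simp add: triangle_graphs_def r(1)[simplified])
  have rel: "pair_relation star dot \<epsilon> \<eta> C
      (pattern (triangle_graphs \<kappa>) (Complex ((triangle_graphs \<kappa> ! i) y) y)) i j"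
    if "(i, j, y) \<in> graph_crossings (triangle_graphs \<kappa>)" for i j y
    using C[rule_format] col that by (rule graph_coloring)
  show "pair_relation star dot \<epsilon> \<eta> C [False, False, \<kappa> < 0] 0 1"
    using rel[of 0 1 r] unfolding cr p01 by simp
  show "pair_relation star dot \<epsilon> \<eta> C [False, \<kappa> > 0, False] 0 2"
    using rel[of 0 2 0] unfolding cr p02 by simp
  show "pair_relation star dot \<epsilon> \<eta> C [\<kappa> < 0, False, False] 1 2"
    using rel[of 1 2 "- r"] unfolding cr p12 by simp
  have slopes: "triangle_slopes \<kappa> 0 r - triangle_slopes \<kappa> 1 r > 0"
    "triangle_slopes \<kappa> 0 0 - triangle_slopes \<kappa> 2 0 > 0"
    "triangle_slopes \<kappa> 1 (- r) - triangle_slopes \<kappa> 2 (- r) > 0"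
    using r(4) by (simp_all add: triangle_slopes_def)
  have w: "graph_weight \<phi> C (0, 1, r) = S 0 1 (pair_weight \<phi> \<epsilon> \<eta> C [False, False, \<kappa> < 0] 0 1)"
    "graph_weight \<phi> C (0, 2, 0) = S 0 2 (pair_weight \<phi> \<epsilon> \<eta> C [False, \<kappa> > 0, False] 0 2)"
    "graph_weight \<phi> C (1, 2, - r) = S 1 2 (pair_weight \<phi> \<epsilon> \<eta> C [\<kappa> < 0, False, False] 1 2)"
    unfolding graph_weight_def prod.case p01 p02 p12 S_def
    using slopes by (simp_all add: zero_less_mult_iff)
  show "(\<Sum>c\<in>{c \<in> crossings L. fst c \<in> U}. crossing_weight \<phi> L f c) =
      S 0 1 (pair_weight \<phi> \<epsilon> \<eta> C [False, False, \<kappa> < 0] 0 1) +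
      S 0 2 (pair_weight \<phi> \<epsilon> \<eta> C [False, \<kappa> > 0, False] 0 2) +
      S 1 2 (pair_weight \<phi> \<epsilon> \<eta> C [\<kappa> < 0, False, False] 1 2)"
  proof -
    have "(\<Sum>c\<in>{c \<in> crossings L. fst c \<in> U}. crossing_weight \<phi> L f c) =
      (\<Sum>x\<in>graph_crossings (triangle_graphs \<kappa>). graph_weight \<phi> C x)"
      by (rule inside_weight) (rule C[rule_format])
    also have "\<dots> = graph_weight \<phi> C (0, 1, r) + graph_weight \<phi> C (0, 2, 0) + graph_weight \<phi> C (1, 2, - r)"
      unfolding cr by (simp add: add.assoc)
    finally show ?thesis unfolding w .
  qed
qed

text \<open>
  Boundary points of the square in the six faces other than the central triangle, one for each pattern.
\<close>

definition outer_point :: "bool list \<Rightarrow> complex" where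
  "outer_point s =
     (if s = [True, True, True] then Complex (-3/4) 1
      else if s = [True, True, False] then Complex (-1/4) 1
      else if s = [True, False, False] then Complex (1/4) 1
      else if s = [False, False, False] then Complex (3/4) 1
      else if s = [False, True, True] then Complex (-1/4) (-1)
      else Complex (1/4) (-1))"

lemma outer_point:
  "outer_point s \<in> csq - sq" "\<bar>Re (outer_point s)\<bar> < 1" "off_graphs (triangle_graphs \<kappa>) (outer_point s)"
  and outer_point_pattern: "length s = 3 \<Longrightarrow> s \<noteq> [False, True, False] \<Longrightarrow> s \<noteq> [True, False, True] \<Longrightarrow>
    pattern (triangle_graphs \<kappa>) (outer_point s) = s"
proof -
  show "outer_point s \<in> csq - sq" "\<bar>Re (outer_point s)\<bar> < 1" "off_graphs (triangle_graphs \<kappa>) (outer_point s)"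
    by (simp_all add: outer_point_def csq_def sq_def triangle_off)
  assume s: "length s = 3" "s \<noteq> [False, True, False]" "s \<noteq> [True, False, True]"
  then obtain a b c where "s = [a, b, c]"
    by (auto simp: length_Suc_conv numeral_3_eq_3)
  then show "pattern (triangle_graphs \<kappa>) (outer_point s) = s"
    using s by (cases a; cases b; cases c) (simp_all add: outer_point_def triangle_pattern)
qed

text \<open>
  Six patterns have the same color before and after the move, as their faces reach the boundary. The other two
  are those of the central triangles, each of which occurs in one of the pictures only. So a single
  function \<open>C\<close> of patterns describes both colorings, and it satisfies the relations at all six crossings.
\<close>

lemma (in boltzmann_weight) triangle_weights_agree:
  assumes L: "oriented_link_diagram L" and L': "oriented_link_diagram L'"
    and looks: "looks_like L h U (graph_picture (triangle_graphs 1) \<epsilon> \<eta>)"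
    and looks': "looks_like L' h' U (graph_picture (triangle_graphs (-1)) \<epsilon> \<eta>)"
    and eps: "\<forall>k<3. \<epsilon> k \<in> {1, -1}" and ord: "inj_on \<eta> {..<3}"
    and bd: "\<forall>z\<in>csq - sq. h z = h' z"
    and col: "coloring (\<star>) (\<odot>) (dual_graph L) f" and col': "coloring (\<star>) (\<odot>) (dual_graph L') f'"
    and agree: "agree_outside U (dual_graph L) f (dual_graph L') f'"
  shows "(\<Sum>c\<in>{c \<in> crossings L. fst c \<in> U}. crossing_weight \<phi> L f c) =
         (\<Sum>c\<in>{c \<in> crossings L'. fst c \<in> U}. crossing_weight \<phi> L' f' c)"
proof -
  have DD: "graph_disc L h U (triangle_graphs 1) (triangle_slopes 1) \<epsilon> \<eta>"
    by (rule triangle_disc[OF L looks eps ord]) simp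
  have DD': "graph_disc L' h' U (triangle_graphs (-1)) (triangle_slopes (-1)) \<epsilon> \<eta>"
    by (rule triangle_disc[OF L' looks' eps ord]) simp
  interpret D: graph_disc L h U "triangle_graphs 1" "triangle_slopes 1" \<epsilon> \<eta> by (rule DD)
  interpret D': graph_disc L' h' U "triangle_graphs (-1)" "triangle_slopes (-1)" \<epsilon> \<eta> by (rule DD')
  have outer: "f (D.face (outer_point s)) = f' (D'.face (outer_point s))" for s
    by (rule boundary_faces_agree[OF D.disc_picture_axioms D'.disc_picture_axioms agree bd])
      (use outer_point D.off_graphs_avoids D'.off_graphs_avoids in blast)+
  define C where "C s = (if s = [False, True, False] then f (D.face (Complex (1/8) 0))
     else if s = [True, False, True] then f' (D'.face (Complex (-1/8) 0))
     else f (D.face (outer_point s)))" for s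
  have len: "length (pattern (triangle_graphs \<kappa>) q) = 3" for \<kappa> q by (simp add: triangle_pattern)
  have C: "f (D.face q) = C (pattern (triangle_graphs 1) q)"
    if q: "q \<in> sq" "off_graphs (triangle_graphs 1) q" for q
  proof (cases "pattern (triangle_graphs 1) q = [False, True, False]")
    case True
    have "D.face q = D.face (Complex (1/8) 0)"
      by (rule triangle_face[OF DD _ q]) (simp_all add: True csq_def triangle_off, simp add: triangle_pattern)
    then show ?thesis by (simp add: C_def True)
  next
    case False
    have ne: "pattern (triangle_graphs 1) q \<noteq> [True, False, True]"
      by (rule triangle_absent_pattern(1)) (use q in \<open>simp add: sq_def\<close>)
    have "D.face q = D.face (outer_point (pattern (triangle_graphs 1) q))"
      by (rule triangle_face[OF DD _ q _ outer_point(2,3) outer_point_pattern[OF len False ne]])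
        (use outer_point(1) in auto)
    then show ?thesis using False ne by (simp add: C_def)
  qed
  have C': "f' (D'.face q) = C (pattern (triangle_graphs (-1)) q)"
    if q: "q \<in> sq" "off_graphs (triangle_graphs (-1)) q" for q
  proof (cases "pattern (triangle_graphs (-1)) q = [True, False, True]")
    case True
    have "D'.face q = D'.face (Complex (-1/8) 0)"
      by (rule triangle_face[OF DD' _ q]) (simp_all add: True csq_def triangle_off, simp add: triangle_pattern)
    then show ?thesis by (simp add: C_def True)
  next
    case False
    have ne: "pattern (triangle_graphs (-1)) q \<noteq> [False, True, False]"
      by (rule triangle_absent_pattern(2)) (use q in \<open>auto simp: sq_def\<close>)
    have "D'.face q = D'.face (outer_point (pattern (triangle_graphs (-1)) q))"
      by (rule triangle_face[OF DD' _ q _ outer_point(2,3) outer_point_pattern[OF len ne False]])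
        (use outer_point(1) in auto)
    then show ?thesis using False ne outer by (simp add: C_def)
  qed
  have one: "(1::real) \<in> {1, -1}" "(- 1::real) \<in> {1, -1}" by simp_all
  have "\<forall>q\<in>sq. off_graphs (triangle_graphs 1) q \<longrightarrow> f (D.face q) = C (pattern (triangle_graphs 1) q)"
    using C by blast
  note side = triangle_picture_weight[OF DD one(1) this col]
  have "\<forall>q\<in>sq. off_graphs (triangle_graphs (-1)) q \<longrightarrow> f' (D'.face q) = C (pattern (triangle_graphs (-1)) q)"
    using C' by blast
  note side' = triangle_picture_weight[OF DD' one(2) this col']
  have rel: "pair_relation (\<star>) (\<odot>) \<epsilon> \<eta> C [False, False, t] 0 1" "pair_relation (\<star>) (\<odot>) \<epsilon> \<eta> C [False, t, False] 0 2"
    "pair_relation (\<star>) (\<odot>) \<epsilon> \<eta> C [t, False, False] 1 2" for t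
    using side(2-4) side'(2-4) by (cases t; simp)+
  show ?thesis unfolding side(1) side'(1)
    using triangle_identity[OF ord rel eps] by simp
qed

section \<open>Invariance of the Boltzmann sum\<close>

lemma (in boltzmann_weight) standard_move_weights_agree:
  assumes L: "oriented_link_diagram L" and L': "oriented_link_diagram L'"
    and move: "standard_move T T'"
    and looks: "looks_like L h U T" and looks': "looks_like L' h' U T'"
    and bd: "\<forall>z\<in>csq - sq. h z = h' z"
    and col: "coloring (\<star>) (\<odot>) (dual_graph L) f" and col': "coloring (\<star>) (\<odot>) (dual_graph L') f'"
    and agree: "agree_outside U (dual_graph L) f (dual_graph L') f'"
  shows "(\<Sum>c\<in>{c \<in> crossings L. fst c \<in> U}. crossing_weight \<phi> L f c) =
         (\<Sum>c\<in>{c \<in> crossings L'. fst c \<in> U}. crossing_weight \<phi> L' f' c)"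
  using move
proof cases
  case (R1 \<epsilon> \<sigma>)
  show ?thesis
    unfolding kink_weight_zero[OF L looks[unfolded R1(1)] R1(3) col]
      vertical_arc_weight_zero[OF L' looks'[unfolded R1(2)] R1(3)] ..
next
  case (R2 \<epsilon> \<eta>)
  have T: "T = graph_picture bigon_graphs \<epsilon> \<eta>" and T': "T' = graph_picture parallel_graphs \<epsilon> \<eta>"
    unfolding R2 by (simp_all add: graph_picture_def bigon_graphs_def parallel_graphs_def)
  show ?thesis
    unfolding bigon_weight_zero[OF L L' looks[unfolded T] looks'[unfolded T'] R2(3,4) bd agree]
      parallel_weight_zero[OF L' looks'[unfolded T'] R2(3,4)] ..
next
  case (R3 \<epsilon> \<eta>)
  have neg: "(\<lambda>s::real. Complex ((s\<^sup>2 - 1) / 4) s) = (\<lambda>s. Complex (- 1 * (1 - s\<^sup>2) / 4) s)"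
    by (simp add: fun_eq_iff field_simps)
  have T: "T = graph_picture (triangle_graphs 1) \<epsilon> \<eta>"
    unfolding R3 by (simp add: graph_picture_def triangle_graphs_def)
  have T': "T' = graph_picture (triangle_graphs (-1)) \<epsilon> \<eta>"
    unfolding R3 neg by (simp add: graph_picture_def triangle_graphs_def)
  show ?thesis
    by (rule triangle_weights_agree[OF L L' looks[unfolded T] looks'[unfolded T'] R3(3,4) bd col col' agree])
qed

lemma agree_outside_sym: "agree_outside U D f D' f' \<Longrightarrow> agree_outside U D' f' D f"
  unfolding agree_outside_def by metis

theorem proposition1:
  fixes star dot :: "'x \<Rightarrow> 'x \<Rightarrow> 'x"
    and \<phi> :: "'x \<Rightarrow> 'x \<Rightarrow> 'x \<Rightarrow> 'a::ab_group_add"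
    and L :: strands
    and U :: "complex set"
    and D D' :: "(crossing, complex set) dual_graph_diagram"
    and f f' :: "complex set \<Rightarrow> 'x"
  assumes "biquasile star dot"
    and "boltzmann_weight star dot \<phi>"
    and "oriented_link_diagram L"
    and "D = dual_graph L"
    and "coloring star dot D f"
    and "dual_reidemeister_move U D D'"
    and "coloring star dot D' f'"
    and "agree_outside U D f D' f'"
  shows "BW \<phi> D f = BW \<phi> D' f'"
proof -
  interpret boltzmann_weight star dot \<phi> by (rule assms(2))
  obtain K K' where move: "reidemeister_move U K K'" and D: "D = dual_graph K" "D' = dual_graph K'"
    using assms(6) unfolding dual_reidemeister_move_def by blast
  from move obtain T T' h h' where K: "oriented_link_diagram K" and K': "oriented_link_diagram K'"
    and same: "same_outside U K K'" and std: "standard_move T T' \<or> standard_move T' T"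
    and looks: "looks_like K h U T" and looks': "looks_like K' h' U T'" and bd: "\<forall>z\<in>csq - sq. h z = h' z"
    unfolding reidemeister_move_def by blast
  note col = assms(5)[unfolded D(1)] and col' = assms(7)[unfolded D(2)] and agree = assms(8)[unfolded D]
  have bd': "\<forall>z\<in>csq - sq. h' z = h z" using bd by simp
  have "(\<Sum>c\<in>{c \<in> crossings K. fst c \<in> U}. crossing_weight \<phi> K f c) =
      (\<Sum>c\<in>{c \<in> crossings K'. fst c \<in> U}. crossing_weight \<phi> K' f' c)"
    using std
  proof
    assume "standard_move T T'"
    from standard_move_weights_agree[OF K K' this looks looks' bd col col' agree] show ?thesis .
  next
    assume "standard_move T' T"
    from standard_move_weights_agree[OF K' K this looks' looks bd' col' col agree_outside_sym[OF agree]]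
    show ?thesis by simp
  qed
  then show ?thesis
    unfolding D BW_split[OF K, where U = U] BW_split[OF K', where U = U]
      outside_weights_agree[OF K K' same looks agree] by simp
qed

end
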